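(* Let $q\in(0,1)$, $r>0$, $n\in\mathbb{N}$ and let $\alpha_1,\dots,\alpha_n\in\mathbb{A}_q=\{z\in\mathbb{C}:q<|z|<1\}$ be distinct. With the notation of the context, the following hold. (i) The following equality in law of processes holds: $$\{X_{\mathbb{A}_q}^r(z):z\in\mathbb{A}_q\}\ \text{given}\ \{X_{\mathbb{A}_q}^r(\alpha_1)=\cdots=X_{\mathbb{A}_q}^r(\alpha_n)=0\}\ \stackrel{\mathrm{d}}{=}\ \Big\{\gamma^q_{\{\alpha_\ell\}_{\ell=1}^n}(z)\,X_{\mathbb{A}_q}^{r\prod_{\ell=1}^n|\alpha_\ell|^2}(z):z\in\mathbb{A}_q\Big\}.$$ (ii) Let $\mathcal{Z}_{X_{\mathbb{A}_q}^r}^{\alpha_1,\dots,\alpha_n}$ denote the zero point process of the GAF $X_{\mathbb{A}_q}^r$ given $\{X_{\mathbb{A}_q}^r(\alpha_1)=\cdots=X_{\mathbb{A}_q}^r(\alpha_n)=0\}$. Then $$\mathcal{Z}_{X_{\mathbb{A}_q}^r}^{\alpha_1,\dots,\alpha_n}\stackrel{\mathrm{d}}{=}\mathcal{Z}_{X_{\mathbb{A}_q}^{r\prod_{\ell=1}^n|\alpha_\ell|^2}}+\sum_{i=1}^n\delta_{\alpha_i}.$$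
   Context: Let $\{\zeta_n\}_{n\in\mathbb{Z}}$ be i.i.d. standard complex Gaussian random variables with density $e^{-|z|^2}/\pi$. For $s>0$ define the Gaussian analytic function (GAF) $X_{\mathbb{A}_q}^s(z)=\sum_{n\in\mathbb{Z}}\zeta_n z^n/\sqrt{1+sq^{2n}}$, $z\in\mathbb{A}_q$; it is centered with covariance kernel $S_{\mathbb{A}_q}(z,w;s)=\sum_{n\in\mathbb{Z}}(z\overline{w})^n/(1+sq^{2n})$. Its zero point process is $\mathcal{Z}_{X^s_{\mathbb{A}_q}}=\sum_{z\in\mathbb{A}_q:X^s_{\mathbb{A}_q}(z)=0}\delta_z$. Theta function: $\theta(z)=\prod_{n=0}^\infty(1-zq^{2n})(1-q^{2n+2}/z)$, $z\in\mathbb{C}\setminus\{0\}$. For $\alpha\in\mathbb{A}_q$ put $h^q_\alpha(z)=z\,\theta(\alpha/z)/\theta(\overline{\alpha}z)$, $z\in\mathbb{A}_q$, and $\gamma^q_{\{\alpha_\ell\}_{\ell=1}^n}(z)=\prod_{\ell=1}^n h^q_{\alpha_\ell}(z)$. Conditioning: for a positive definite kernel $k$ and a point $\alpha$ with $k(\alpha,\alpha)>0$, set $k^\alpha(z,w)=k(z,w)-k(z,\alpha)k(\alpha,w)/k(\alpha,\alpha)$, and inductively $k^{\alpha_1,\dots,\alpha_n}=(k^{\alpha_1,\dots,\alpha_{n-1}})^{\alpha_n}$. The process "$X_{\mathbb{A}_q}^r$ given $\{X_{\mathbb{A}_q}^r(\alpha_1)=\cdots=X_{\mathbb{A}_q}^r(\alpha_n)=0\}$"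 is the centered (complex) Gaussian process with covariance kernel $S_{\mathbb{A}_q}^{\alpha_1,\dots,\alpha_n}(\cdot,\cdot;r)$. $\stackrel{\mathrm{d}}{=}$ denotes equality in law. *)

theory Defs
  imports "HOL-Probability.Probability"
begin

section \<open>Equality in law of stochastic processes\<close>

text \<open>
  A process is a family \<open>X t \<omega>\<close> with \<open>t\<close> in an index set \<open>T\<close>.  Its law lives on the product
  sigma-algebra, so two processes agree in law iff all joint laws of finitely many values agree.
  The completion of the probability space is used because objects such as the zeros of a random
  series are well-behaved (and measurable) only up to a null set.
\<close>

definition process_law :: "'a measure \<Rightarrow> 't set \<Rightarrow> ('t \<Rightarrow> 'a \<Rightarrow> 'c::topological_space) \<Rightarrow> ('t \<Rightarrow> 'c) measure"
  where "process_law M T X = distr (completion M) (Pi\<^sub>M T (\<lambda>_. borel)) (\<lambda>\<omega>. \<lambda>t\<in>T. X t \<omega>)"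

definition equal_in_law ::
  "'t set \<Rightarrow> 'a measure \<Rightarrow> ('t \<Rightarrow> 'a \<Rightarrow> 'c::topological_space) \<Rightarrow> 'b measure \<Rightarrow> ('t \<Rightarrow> 'b \<Rightarrow> 'c) \<Rightarrow> bool"
  where "equal_in_law T M X N Y \<longleftrightarrow>
    (\<forall>t\<in>T. X t \<in> borel_measurable (completion M)) \<and>
    (\<forall>t\<in>T. Y t \<in> borel_measurable (completion N)) \<and>
    process_law M T X = process_law N T Y"

section \<open>Complex Gaussian processes\<close>

definition std_complex_gaussian_density :: "complex \<Rightarrow> real"
  where "std_complex_gaussian_density z = exp (- (cmod z)\<^sup>2) / pi"

definition iid_std_complex_gaussian :: "'a measure \<Rightarrow> ('i \<Rightarrow> 'a \<Rightarrow> complex) \<Rightarrow> bool"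
  where "iid_std_complex_gaussian M \<zeta> \<longleftrightarrow>
    prob_space M \<and>
    prob_space.indep_vars M (\<lambda>_. borel) \<zeta> UNIV \<and>
    (\<forall>n. distributed M lborel (\<zeta> n) (\<lambda>z. ennreal (std_complex_gaussian_density z)))"

text \<open>
  \<open>Z\<close> has the law of \<open>\<sigma> g\<close> for a standard complex Gaussian \<open>g\<close>: centered and circularly
  symmetric; \<open>\<sigma> = 0\<close> is the degenerate case \<open>Z = 0\<close> almost surely.
\<close>

definition centered_complex_gaussian :: "'a measure \<Rightarrow> ('a \<Rightarrow> complex) \<Rightarrow> bool"
  where "centered_complex_gaussian M Z \<longleftrightarrow>
    Z \<in> borel_measurable M \<and>
    (\<exists>\<sigma>\<ge>0. distr M borel Z =
      distr (density lborel (\<lambda>z. ennreal (std_complex_gaussian_density z))) borel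
        (\<lambda>g. complex_of_real \<sigma> * g))"

definition centered_complex_gaussian_process ::
  "'a measure \<Rightarrow> 't set \<Rightarrow> ('t \<Rightarrow> 't \<Rightarrow> complex) \<Rightarrow> ('t \<Rightarrow> 'a \<Rightarrow> complex) \<Rightarrow> bool"
  where "centered_complex_gaussian_process M T k Y \<longleftrightarrow>
    prob_space M \<and>
    (\<forall>F c. finite F \<and> F \<subseteq> T \<longrightarrow> centered_complex_gaussian M (\<lambda>\<omega>. \<Sum>t\<in>F. c t * Y t \<omega>)) \<and>
    (\<forall>t\<in>T. \<forall>u\<in>T. integral\<^sup>L M (\<lambda>\<omega>. Y t \<omega> * cnj (Y u \<omega>)) = k t u)"

definition gaussian_analytic_function ::
  "'a measure \<Rightarrow> complex set \<Rightarrow> (complex \<Rightarrow> complex \<Rightarrow> complex) \<Rightarrow> (complex \<Rightarrow> 'a \<Rightarrow> complex) \<Rightarrow> bool"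
  where "gaussian_analytic_function M D k Y \<longleftrightarrow>
    centered_complex_gaussian_process M D k Y \<and>
    (AE \<omega> in M. (\<lambda>z. Y z \<omega>) holomorphic_on D)"

section \<open>Conditioned kernels\<close>

text \<open>Meaningful only for \<open>k a a > 0\<close>; for \<open>k a a = 0\<close> the division convention returns \<open>k\<close> itself.\<close>

definition cond_kernel :: "('t \<Rightarrow> 't \<Rightarrow> complex) \<Rightarrow> 't \<Rightarrow> 't \<Rightarrow> 't \<Rightarrow> complex"
  where "cond_kernel k a z w = k z w - k z a * k a w / k a a"

text \<open>Conditioning on the points \<open>\<alpha> 1, \<dots>, \<alpha> n\<close>, in this order.\<close>

primrec cond_kernels :: "('t \<Rightarrow> 't \<Rightarrow> complex) \<Rightarrow> (nat \<Rightarrow> 't) \<Rightarrow> nat \<Rightarrow> 't \<Rightarrow> 't \<Rightarrow> complex"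
  where
    "cond_kernels k \<alpha> 0 = k"
  | "cond_kernels k \<alpha> (Suc n) = cond_kernel (cond_kernels k \<alpha> n) (\<alpha> (Suc n))"

section \<open>The Gaussian Laurent series on the annulus\<close>

definition annulus :: "real \<Rightarrow> complex set"
  where "annulus q = {z. q < cmod z \<and> cmod z < 1}"

text \<open>
  The bilateral series is an unordered sum, which almost surely converges absolutely on the
  annulus; where it does not converge \<open>infsum\<close> is \<open>0\<close>.
\<close>

definition gaf_annulus ::
  "real \<Rightarrow> (int \<Rightarrow> 'a \<Rightarrow> complex) \<Rightarrow> real \<Rightarrow> complex \<Rightarrow> 'a \<Rightarrow> complex"
  where "gaf_annulus q \<zeta> s z \<omega> =
    (\<Sum>\<^sub>\<infinity>n\<in>UNIV. \<zeta> n \<omega> * z powi n / complex_of_real (sqrt (1 + s * q powi (2 * n))))"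

definition szego_kernel :: "real \<Rightarrow> real \<Rightarrow> complex \<Rightarrow> complex \<Rightarrow> complex"
  where "szego_kernel q s z w =
    (\<Sum>\<^sub>\<infinity>n\<in>UNIV. (z * cnj w) powi n / complex_of_real (1 + s * q powi (2 * n)))"

definition theta :: "real \<Rightarrow> complex \<Rightarrow> complex"
  where "theta q z =
    (\<Prod>n. (1 - z * complex_of_real (q ^ (2 * n))) * (1 - complex_of_real (q ^ (2 * n + 2)) / z))"

definition h_fun :: "real \<Rightarrow> complex \<Rightarrow> complex \<Rightarrow> complex"
  where "h_fun q a z = z * theta q (a / z) / theta q (cnj a * z)"

definition gamma_fun :: "real \<Rightarrow> (nat \<Rightarrow> complex) \<Rightarrow> nat \<Rightarrow> complex \<Rightarrow> complex"
  where "gamma_fun q \<alpha> n z = (\<Prod>l=1..n. h_fun q (\<alpha> l) z)"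

section \<open>Zero point processes\<close>

definition dirac :: "'t \<Rightarrow> 't set \<Rightarrow> ennreal"
  where "dirac a B = indicator B a"

text \<open>
  Point processes on \<open>D\<close> are treated as processes indexed by the Borel subsets \<open>B\<close> of \<open>D\<close>, whose
  value at \<open>B\<close> is the mass of \<open>B\<close>; equality in law thus means equality of the joint laws of the
  masses of finitely many Borel sets.  Each zero is counted once.
\<close>

definition borel_subsets :: "complex set \<Rightarrow> complex set set"
  where "borel_subsets D = {B \<in> sets borel. B \<subseteq> D}"

definition zero_process ::
  "complex set \<Rightarrow> (complex \<Rightarrow> 'a \<Rightarrow> complex) \<Rightarrow> complex set \<Rightarrow> 'a \<Rightarrow> ennreal"
  where "zero_process D Y B \<omega> = (\<Sum>\<^sub>\<infinity>z\<in>{z\<in>D. Y z \<omega> = 0}. dirac z B)"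

end

theory Submission
  imports Defs "HOL-Complex_Analysis.Complex_Analysis"
begin

text \<open>
  Conditioning on a single zero \<open>a\<close> replaces the kernel \<open>S(\<cdot>, \<cdot>; s)\<close> by
  \<open>h\<^sub>a(z) * cnj (h\<^sub>a(w)) * S(z, w; s * norm a ^ 2)\<close>.  To see this, fix \<open>w\<close>, divide the difference of both
  sides by \<open>h\<^sub>a(z)\<close> and continue it in \<open>z\<close> to an annulus containing a full period of \<open>z \<mapsto> q\<^sup>2 z\<close>.  The
  singularities at \<open>a\<close> and \<open>1 / cnj w\<close> are removable, the one at \<open>1 / cnj a\<close> is cancelled by a zero of the
  theta function, and the resulting holomorphic \<open>g\<close> satisfies \<open>g(q\<^sup>2 z) = - g(z) / (s * norm a ^ 2)\<close>.
  Because of the negative multiplier only \<open>g = 0\<close> is possible.  Induction gives the kernel of the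
  process conditioned on all \<open>\<alpha> l\<close>.

  A centered complex Gaussian process is determined in law by its kernel, through the joint
  characteristic functions; this gives (i).  For (ii), the number of zeros in a Borel set is a measurable
  functional of a holomorphic path, so it has the same law for both processes; the zeros of the product
  are the \<open>\<alpha> l\<close> and the zeros of the unconditioned series, which almost surely avoids the \<open>\<alpha> l\<close>.
\<close>

text \<open>Let F_s(x) be the sum of x^n / (1 + s * q^(2n)) over all integers n. Formally F_s(x) + s
  * F_s(q^2 x) is the sum of all x^n, whose two halves continue to 1 / (1 - x) and -1 / (1 - x) and
  cancel; hence the multiplier -1 / s. The theta quotient contributes 1 / norm a ^ 2, which turns s
  into s * norm a ^ 2. The series converges only for q^2 < norm x < 1, a region that never contains
  both x and q^2 x, so it has to be continued past its pole at 1. In Laurent coefficients, g(p z) =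
  - kappa * g(z) reads (p^n + kappa) * g_n = 0, so kappa > 0 forces g = 0.

  The law of a path lives on a product over uncountably many points, so a functional must be
  expressed through countably many values, and the holomorphic paths enter only through the trace of
  the sigma-algebra on them. Uniqueness from characteristic functions is lifted from one real
  variable by restricting the measure to one coordinate event after another, which is why finite
  measures take the place of probabilities. Zeros are counted once, so the masses in (ii) add up
  only where the series does not vanish at the \<alpha> l.\<close>

section \<open>Power series with linearly growing coefficients and bilateral sums\<close>

text \<open>Linear growth is the bound that almost every realization of the Gaussian coefficients
  satisfies. The dominating series of (n + 1) * norm y ^ n is the derivative of the geometric
  series.\<close>

lemma summable_norm_power_series_linear:
  fixes a :: "nat \<Rightarrow> 'a::{real_normed_field,banach}"
  assumes "\<And>n. norm (a n) \<le> C * (1 + real n)" "norm y < 1"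
  shows "summable (\<lambda>n. norm (a n * y ^ n))"
proof (rule summable_comparison_test)
  show "\<exists>N. \<forall>n\<ge>N. norm (norm (a n * y ^ n)) \<le> C * (of_nat (Suc n) * norm y ^ n)"
    using mult_right_mono[OF assms(1)] by (auto simp: norm_mult norm_power mult.assoc)
  show "summable (\<lambda>n. C * (of_nat (Suc n) * norm y ^ n))"
    using geometric_deriv_sums[of "norm y"] assms(2) by (intro summable_mult) (auto simp: sums_iff)
qed

lemma holomorphic_linear_power_series:
  assumes "\<And>n. norm (a n) \<le> C * (1 + real n)"
  shows "(\<lambda>y. \<Sum>n. a n * y ^ n) holomorphic_on ball 0 1"
  by (rule power_series_holomorphic[of 0 1 a], simp add: dist_norm)
     (use assms in \<open>auto intro!: summable_sums summable_norm_cancel[OF summable_norm_power_series_linear]\<close>)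

lemma bounded_imp_linear_bound:
  assumes "\<And>n. norm (a n) \<le> C" shows "norm (a n) \<le> C * (1 + real n)"
proof -
  have "0 \<le> C" using assms[of 0] norm_ge_zero order_trans by blast
  then have "C \<le> C * (1 + real n)" by (simp add: algebra_simps)
  then show ?thesis using assms[of n] by linarith
qed

lemma summable_norm_power_series:
  fixes a :: "nat \<Rightarrow> 'a::{real_normed_field,banach}"
  assumes "\<And>n. norm (a n) \<le> C" "norm y < 1"
  shows "summable (\<lambda>n. norm (a n * y ^ n))"
  using summable_norm_power_series_linear[of a C y] bounded_imp_linear_bound[of a C] assms by blast

lemma holomorphic_bounded_power_series:
  assumes "\<And>n. norm (a n) \<le> C"
  shows "(\<lambda>y. \<Sum>n. a n * y ^ n) holomorphic_on ball 0 1"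
  using holomorphic_linear_power_series[of a C] bounded_imp_linear_bound[of a C] assms by blast

text \<open>The map n -> - n - 1 enumerates the negative integers starting from n = 0, so the index
  0 is counted in the first half only.\<close>

lemma has_sum_int_split:
  fixes f :: "int \<Rightarrow> 'a::real_normed_vector"
  assumes "((\<lambda>n. f (int n)) has_sum a) UNIV" "((\<lambda>n. f (- int n - 1)) has_sum b) UNIV"
  shows "(f has_sum (a + b)) UNIV"
proof -
  have "(f has_sum a) (range int)"
    by (subst has_sum_reindex) (use assms in \<open>auto simp: o_def inj_on_def\<close>)
  moreover have "(f has_sum b) (range (\<lambda>n. - int n - 1))"
    by (subst has_sum_reindex) (use assms in \<open>auto simp: o_def inj_on_def\<close>)
  moreover have "range int \<inter> range (\<lambda>n. - int n - 1) = {}" by auto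
  ultimately have "(f has_sum (a + b)) (range int \<union> range (\<lambda>n. - int n - 1))"
    by (rule has_sum_Un_disjoint)
  moreover have "range int \<union> range (\<lambda>n. - int n - 1) = UNIV"
  proof -
    have "k \<in> range int \<union> range (\<lambda>n. - int n - 1)" for k
      by (cases "k \<ge> 0") (auto intro: image_eqI[of _ _ "nat k"] image_eqI[of _ _ "nat (- k - 1)"])
    then show ?thesis by blast
  qed
  ultimately show ?thesis by simp
qed

lemma has_sum_bilateral:
  fixes f :: "int \<Rightarrow> 'a::banach"
  assumes "summable (\<lambda>n. norm (f (int n)))" "summable (\<lambda>n. norm (f (- int n - 1)))"
  shows "(f has_sum ((\<Sum>n. f (int n)) + (\<Sum>n. f (- int n - 1)))) UNIV"
  by (intro has_sum_int_split norm_summable_imp_has_sum assms summable_sums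
      summable_norm_cancel[of "\<lambda>n. f (int n)"] summable_norm_cancel[of "\<lambda>n. f (- int n - 1)"])

section \<open>The theta function\<close>

text \<open>The q-Pochhammer symbol (x; q^2)_infinity with base q^2.\<close>

definition qpoch :: "real \<Rightarrow> complex \<Rightarrow> complex"
  where "qpoch q x = (\<Prod>n. 1 - x * complex_of_real (q ^ (2 * n)))"

lemma square_less_1: "0 < q \<Longrightarrow> q < 1 \<Longrightarrow> (q::real)\<^sup>2 < 1"
  by (simp add: power_less_one_iff)

lemma convergent_prod_qpoch:
  assumes "0 < q" "q < 1"
  shows "convergent_prod (\<lambda>n. 1 - x * complex_of_real (q ^ (2 * n)))"
proof (intro abs_convergent_prod_imp_convergent_prod summable_imp_abs_convergent_prod)
  have "summable (\<lambda>n. norm x * (q\<^sup>2) ^ n)"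
    using assms square_less_1[of q] by (intro summable_mult summable_geometric) auto
  then show "summable (\<lambda>i. norm (1 - x * complex_of_real (q ^ (2 * i)) - 1))"
    using assms by (simp add: norm_mult norm_power power_mult)
qed

lemma qpoch_shift:
  assumes "0 < q" "q < 1"
  shows "qpoch q x = (1 - x) * qpoch q (complex_of_real (q\<^sup>2) * x)"
proof -
  let ?f = "\<lambda>x n. 1 - x * complex_of_real (q ^ (2 * n))"
  have eq: "(\<Prod>i\<le>Suc n. ?f x i) = (1 - x) * (\<Prod>i\<le>n. ?f (complex_of_real (q\<^sup>2) * x) i)" for n
    by (subst prod.atMost_Suc_shift) (simp add: algebra_simps power2_eq_square)
  have "(\<lambda>n. \<Prod>i\<le>Suc n. ?f x i) \<longlonglongrightarrow> qpoch q x"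
    unfolding qpoch_def by (intro LIMSEQ_Suc convergent_prod_LIMSEQ convergent_prod_qpoch assms)
  moreover have "(\<lambda>n. \<Prod>i\<le>Suc n. ?f x i) \<longlonglongrightarrow> (1 - x) * qpoch q (complex_of_real (q\<^sup>2) * x)"
    unfolding qpoch_def eq
    by (intro tendsto_mult tendsto_const convergent_prod_LIMSEQ convergent_prod_qpoch assms)
  ultimately show ?thesis by (rule LIMSEQ_unique)
qed

lemma qpoch_nonzero:
  assumes "0 < q" "q < 1" "norm x < 1"
  shows "qpoch q x \<noteq> 0"
  unfolding qpoch_def
proof (rule prodinf_nonzero[OF convergent_prod_qpoch[OF assms(1,2)]])
  fix n
  have "norm (x * complex_of_real (q ^ (2 * n))) \<le> norm x * 1"
    unfolding norm_mult using assms by (intro mult_left_mono) (auto simp: norm_power power_le_one)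
  then show "1 - x * complex_of_real (q ^ (2 * n)) \<noteq> 0"
    using assms(3) by auto
qed

lemma cnj_qpoch:
  assumes "0 < q" "q < 1"
  shows "cnj (qpoch q x) = qpoch q (cnj x)"
proof -
  let ?f = "\<lambda>x n. 1 - x * complex_of_real (q ^ (2 * n))"
  have "(\<lambda>n. cnj (\<Prod>i\<le>n. ?f x i)) \<longlonglongrightarrow> cnj (qpoch q x)"
    unfolding qpoch_def by (intro tendsto_cnj convergent_prod_LIMSEQ convergent_prod_qpoch assms)
  moreover have "(\<lambda>n. cnj (\<Prod>i\<le>n. ?f x i)) \<longlonglongrightarrow> qpoch q (cnj x)"
    unfolding qpoch_def using convergent_prod_LIMSEQ[OF convergent_prod_qpoch[OF assms, of "cnj x"]]
    by (simp add: cnj_prod)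
  ultimately show ?thesis by (rule LIMSEQ_unique)
qed

lemma holomorphic_qpoch:
  assumes "0 < q" "q < 1"
  shows "qpoch q holomorphic_on UNIV"
proof (rule holomorphic_uniform_sequence)
  let ?f = "\<lambda>n x. 1 - x * complex_of_real (q ^ (2 * n))"
  show "(\<lambda>x. \<Prod>n<N. ?f n x) holomorphic_on UNIV" for N
    by (intro holomorphic_intros)
  fix x :: complex
  have "uniformly_convergent_on (cball x 1) (\<lambda>N x. \<Prod>n<N. ?f n x)"
  proof (rule uniformly_convergent_on_prod')
    show "uniformly_convergent_on (cball x 1) (\<lambda>N x. \<Sum>n<N. norm (?f n x - 1))"
    proof (rule Weierstrass_m_test'_ev[OF always_eventually], safe)
      fix n y assume "y \<in> cball x 1"
      then have "norm y \<le> norm x + 1"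
        using norm_triangle_ineq2[of y x] by (simp add: dist_norm norm_minus_commute)
      then show "norm (norm (?f n y - 1)) \<le> (norm x + 1) * (q\<^sup>2) ^ n"
        using assms by (simp add: norm_mult norm_power power_mult mult_right_mono)
    next
      show "summable (\<lambda>n. (norm x + 1) * (q\<^sup>2) ^ n)"
        using assms square_less_1[of q] by (intro summable_mult summable_geometric) auto
    qed
  qed (auto intro!: continuous_intros)
  then obtain l where l: "uniform_limit (cball x 1) (\<lambda>N x. \<Prod>n<N. ?f n x) l sequentially"
    by (auto simp: uniformly_convergent_on_def)
  have "l y = qpoch q y" if "y \<in> cball x 1" for y
  proof (rule LIMSEQ_unique)
    show "(\<lambda>N. \<Prod>n<N. ?f n y) \<longlonglongrightarrow> l y" using l that by (rule tendsto_uniform_limitI)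
    show "(\<lambda>N. \<Prod>n<N. ?f n y) \<longlonglongrightarrow> qpoch q y"
      unfolding qpoch_def
      using convergent_prod_LIMSEQ[OF convergent_prod_qpoch[OF assms, of y]]
      by (subst (asm) lessThan_Suc_atMost[symmetric]) (rule LIMSEQ_imp_Suc)
  qed
  then have "uniform_limit (cball x 1) (\<lambda>N x. \<Prod>n<N. ?f n x) (qpoch q) sequentially"
    using l by (subst uniform_limit_cong'[of _ _ _ _ l]) auto
  then show "\<exists>d>0. cball x d \<subseteq> UNIV \<and> uniform_limit (cball x d) (\<lambda>N x. \<Prod>n<N. ?f n x) (qpoch q) sequentially"
    by (intro exI[of _ 1]) auto
qed auto

lemma theta_eq_qpoch:
  assumes "0 < q" "q < 1"
  shows "theta q x = qpoch q x * qpoch q (complex_of_real (q\<^sup>2) / x)"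
proof -
  have "theta q x = (\<Prod>n. (1 - x * complex_of_real (q ^ (2 * n))) *
      (1 - (complex_of_real (q\<^sup>2) / x) * complex_of_real (q ^ (2 * n))))"
    unfolding theta_def by (rule prodinf_cong) (simp add: power_add power2_eq_square mult.commute)
  also have "\<dots> = qpoch q x * qpoch q (complex_of_real (q\<^sup>2) / x)"
    unfolding qpoch_def by (rule prodinf_mult[symmetric]; rule convergent_prod_qpoch[OF assms])
  finally show ?thesis .
qed

text \<open>The theta function with its zero at \<open>1\<close> divided out.\<close>

definition theta1 :: "real \<Rightarrow> complex \<Rightarrow> complex"
  where "theta1 q x = qpoch q (complex_of_real (q\<^sup>2) * x) * qpoch q (complex_of_real (q\<^sup>2) / x)"

lemma theta_eq_theta1:
  assumes "0 < q" "q < 1"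
  shows "theta q x = (1 - x) * theta1 q x"
  unfolding theta_eq_qpoch[OF assms] theta1_def by (subst qpoch_shift[OF assms, of x]) simp

lemma theta1_nonzero:
  assumes "0 < q" "q < 1" "q\<^sup>2 < norm x" "q\<^sup>2 * norm x < 1"
  shows "theta1 q x \<noteq> 0"
proof -
  have "x \<noteq> 0" using assms by (metis norm_zero not_less zero_le_power2)
  then have "norm (complex_of_real (q\<^sup>2) * x) < 1" "norm (complex_of_real (q\<^sup>2) / x) < 1"
    using assms by (simp_all add: norm_mult norm_divide norm_power)
  then show ?thesis
    unfolding theta1_def using qpoch_nonzero[OF assms(1,2)] by simp
qed

lemma theta_nonzero:
  assumes "0 < q" "q < 1" "q\<^sup>2 < norm x" "q\<^sup>2 * norm x < 1" "x \<noteq> 1"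
  shows "theta q x \<noteq> 0"
  using theta1_nonzero[OF assms(1-4)] assms(5) by (simp add: theta_eq_theta1[OF assms(1,2)])

text \<open>The factor 1 - x leaves the first product and 1 - 1 / x enters the second; their
  quotient is -1 / x.\<close>

lemma theta_shift:
  assumes "0 < q" "q < 1" "x \<noteq> 0"
  shows "theta q (complex_of_real (q\<^sup>2) * x) = - theta q x / x"
proof (cases "x = 1")
  case True
  have "theta q (complex_of_real (q\<^sup>2) * x) = 0"
    using assms(1) qpoch_shift[OF assms(1,2), of 1]
    by (simp add: theta_eq_qpoch[OF assms(1,2)] True power2_eq_square)
  then show ?thesis using True by (simp add: theta_eq_theta1[OF assms(1,2)])
next
  case False
  have "theta q (complex_of_real (q\<^sup>2) * x) = qpoch q (complex_of_real (q\<^sup>2) * x) * qpoch q (1 / x)"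
    using assms by (simp add: theta_eq_qpoch)
  also have "qpoch q (1 / x) = (1 - 1 / x) * qpoch q (complex_of_real (q\<^sup>2) / x)"
    by (subst qpoch_shift[OF assms(1,2)]) simp
  finally show ?thesis
    using False assms(3) unfolding theta_eq_theta1[OF assms(1,2)] theta1_def
    by (simp add: field_simps)
qed

lemma cnj_theta:
  assumes "0 < q" "q < 1"
  shows "cnj (theta q x) = theta q (cnj x)"
  by (simp add: theta_eq_qpoch[OF assms] cnj_qpoch[OF assms])

lemma holomorphic_qpoch_compose [holomorphic_intros]:
  assumes "0 < q" "q < 1" "f holomorphic_on A"
  shows "(\<lambda>x. qpoch q (f x)) holomorphic_on A"
  using holomorphic_on_compose[OF assms(3) holomorphic_on_subset[OF holomorphic_qpoch[OF assms(1,2)]]]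
  by (simp add: o_def)

lemma holomorphic_theta1 [holomorphic_intros]:
  assumes "0 < q" "q < 1" "f holomorphic_on A" "\<And>x. x \<in> A \<Longrightarrow> f x \<noteq> 0"
  shows "(\<lambda>x. theta1 q (f x)) holomorphic_on A"
  unfolding theta1_def using assms by (intro holomorphic_intros) auto

lemma holomorphic_theta [holomorphic_intros]:
  assumes "0 < q" "q < 1" "f holomorphic_on A" "\<And>x. x \<in> A \<Longrightarrow> f x \<noteq> 0"
  shows "(\<lambda>x. theta q (f x)) holomorphic_on A"
  unfolding theta_eq_theta1[OF assms(1,2)] using assms by (intro holomorphic_intros) auto

section \<open>The Szego kernel as a function of one variable\<close>

definition szego_sum :: "real \<Rightarrow> real \<Rightarrow> complex \<Rightarrow> complex"
  where "szego_sum q s x = (\<Sum>\<^sub>\<infinity>n\<in>UNIV. x powi n / complex_of_real (1 + s * q powi (2 * n)))"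

definition szego_pos :: "real \<Rightarrow> real \<Rightarrow> complex \<Rightarrow> complex"
  where "szego_pos p s y = (\<Sum>n. complex_of_real (1 / (1 + s * p ^ n)) * y ^ n)"

text \<open>The half with negative indices: for p = q^2 and y = p / x, the term of index -(n + 1) is
  y^(n+1) / (s + p^(n+1)). Clearing the negative powers of q keeps the coefficients bounded by 1 /
  s.\<close>

definition szego_neg :: "real \<Rightarrow> real \<Rightarrow> complex \<Rightarrow> complex"
  where "szego_neg p s y = y * (\<Sum>n. complex_of_real (1 / (s + p ^ Suc n)) * y ^ n)"

text \<open>Continues \<open>(1 - x) * szego_sum q s x\<close> from \<open>q\<^sup>2 < norm x < 1\<close> across the pole at \<open>1\<close>
  to \<open>q\<^sup>2 < norm x < 1 / q\<^sup>2\<close>.\<close>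

definition szego_ext :: "real \<Rightarrow> real \<Rightarrow> complex \<Rightarrow> complex"
  where "szego_ext q s x = 1 + (1 - x) * (szego_neg (q\<^sup>2) s (complex_of_real (q\<^sup>2) / x)
     - complex_of_real s * szego_pos (q\<^sup>2) s (complex_of_real (q\<^sup>2) * x))"

lemma szego_kernel_eq: "szego_kernel q s z w = szego_sum q s (z * cnj w)"
  by (simp add: szego_kernel_def szego_sum_def)

lemma norm_szego_pos_coeff:
  assumes "0 < p" "0 < s" shows "norm (complex_of_real (1 / (1 + s * p ^ n))) \<le> 1"
  using assms by (simp del: of_real_divide of_real_add add: add_pos_pos)

lemma norm_szego_neg_coeff:
  assumes "0 < p" "0 < s" shows "norm (complex_of_real (1 / (s + p ^ Suc n))) \<le> 1 / s"
  using assms by (simp del: of_real_divide of_real_add power_Suc add: add_pos_pos frac_le)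

lemma
  assumes "0 < q" "q < 1" "0 < s" "q\<^sup>2 < norm x" "norm x < 1"
  shows szego_sum_has_sum:
      "((\<lambda>n. x powi n / complex_of_real (1 + s * q powi (2 * n))) has_sum szego_sum q s x) UNIV"
    and szego_sum_split:
      "szego_sum q s x = szego_pos (q\<^sup>2) s x + szego_neg (q\<^sup>2) s (complex_of_real (q\<^sup>2) / x)"
proof -
  let ?f = "\<lambda>n. x powi n / complex_of_real (1 + s * q powi (2 * n))"
  let ?y = "complex_of_real (q\<^sup>2) / x"
  have "x \<noteq> 0" using assms by (metis norm_zero not_less zero_le_power2)
  have 1: "?f (int n) = complex_of_real (1 / (1 + s * (q\<^sup>2) ^ n)) * x ^ n" for n
    using power_int_of_nat[of q "2 * n"]
    by (simp add: power_int_of_nat power_mult[symmetric])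
  have 2: "?f (- int n - 1) = ?y * (complex_of_real (1 / (s + (q\<^sup>2) ^ Suc n)) * ?y ^ n)" for n
  proof -
    have "- int n - 1 = - int (Suc n)" by simp
    then have "?f (- int n - 1) = inverse (x ^ Suc n) / complex_of_real (1 + s * inverse (q ^ (2 * Suc n)))"
    proof -
      have "x powi (- int n - 1) = inverse (x ^ Suc n)"
        unfolding \<open>- int n - 1 = - int (Suc n)\<close> power_int_minus power_int_of_nat ..
      moreover have "2 * (- int n - 1) = - int (2 * Suc n)" by simp
      then have "q powi (2 * (- int n - 1)) = inverse (q ^ (2 * Suc n))"
        by (simp only: power_int_minus power_int_of_nat)
      ultimately show ?thesis by (simp only:)
    qed
    also have "1 + s * inverse (q ^ (2 * Suc n)) = (s + (q\<^sup>2) ^ Suc n) / (q\<^sup>2) ^ Suc n"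
      using assms unfolding power_mult by (simp add: divide_simps del: power_Suc)
    also have "inverse (x ^ Suc n) / complex_of_real ((s + (q\<^sup>2) ^ Suc n) / (q\<^sup>2) ^ Suc n)
      = complex_of_real (1 / (s + (q\<^sup>2) ^ Suc n)) * ?y ^ Suc n"
      using assms by (simp add: power_divide divide_inverse mult_ac power_mult_distrib power_inverse)
    finally show ?thesis by (simp add: mult_ac)
  qed
  have y: "norm ?y < 1" using assms \<open>x \<noteq> 0\<close> by (simp add: norm_divide norm_power)
  note s1 = summable_norm_power_series[OF norm_szego_pos_coeff[of "q\<^sup>2" s] assms(5)]
  note s2 = summable_norm_power_series[OF norm_szego_neg_coeff[of "q\<^sup>2" s] y]
  have "0 < q\<^sup>2" using assms by simp
  have "(?f has_sum ((\<Sum>n. ?f (int n)) + (\<Sum>n. ?f (- int n - 1)))) UNIV"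
  proof (rule has_sum_bilateral)
    show "summable (\<lambda>n. norm (?f (int n)))"
      unfolding 1 using s1[OF \<open>0 < q\<^sup>2\<close> assms(3)] .
    show "summable (\<lambda>n. norm (?f (- int n - 1)))"
      unfolding 2 norm_mult[of ?y] using s2[OF \<open>0 < q\<^sup>2\<close> assms(3)] by (intro summable_mult)
  qed
  moreover have "(\<Sum>n. ?f (int n)) = szego_pos (q\<^sup>2) s x"
    unfolding 1 szego_pos_def ..
  moreover have "(\<Sum>n. ?f (- int n - 1)) = szego_neg (q\<^sup>2) s ?y"
    unfolding 2 szego_neg_def
    by (rule suminf_mult) (rule summable_norm_cancel[OF s2[OF \<open>0 < q\<^sup>2\<close> assms(3)]])
  ultimately have hs: "(?f has_sum (szego_pos (q\<^sup>2) s x + szego_neg (q\<^sup>2) s ?y)) UNIV" by simp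
  then show "szego_sum q s x = szego_pos (q\<^sup>2) s x + szego_neg (q\<^sup>2) s ?y"
    unfolding szego_sum_def by (rule infsumI)
  then show "(?f has_sum szego_sum q s x) UNIV" using hs by simp
qed

text \<open>From 1 / (1 + s p^n) = 1 - s p^n / (1 + s p^n). The remaining series is evaluated at p *
  y, so the identity isolates the pole at 1 and continues the function to norm y < 1 / p.\<close>

lemma szego_pos_shift:
  assumes "0 < p" "p < 1" "0 < s" "norm y < 1"
  shows "szego_pos p s y = 1 / (1 - y) - complex_of_real s * szego_pos p s (complex_of_real p * y)"
proof -
  have py: "norm (complex_of_real p * y) < 1"
    using assms mult_strict_mono[of p 1 "norm y" 1] by (simp add: norm_mult)
  note s2 = summable_norm_cancel[OF summable_norm_power_series[OF norm_szego_pos_coeff[OF assms(1,3)] py]]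
  have "complex_of_real (1 / (1 + s * p ^ n)) * y ^ n =
     y ^ n - complex_of_real s * (complex_of_real (1 / (1 + s * p ^ n)) * (complex_of_real p * y) ^ n)" for n
  proof -
    have "complex_of_real (1 / (1 + s * p ^ n)) = 1 - complex_of_real (s * (1 / (1 + s * p ^ n)) * p ^ n)"
    proof -
      have "1 + s * p ^ n \<noteq> 0" using assms add_pos_pos[of 1 "s * p ^ n"] by simp
      then have "1 / (1 + s * p ^ n) = 1 - s * (1 / (1 + s * p ^ n)) * p ^ n" by (simp add: field_simps)
      then show ?thesis by (metis of_real_1 of_real_diff)
    qed
    then have "complex_of_real (1 / (1 + s * p ^ n)) * y ^ n = (1 - complex_of_real (s * (1 / (1 + s * p ^ n)) * p ^ n)) * y ^ n" by (simp only:)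
    then show ?thesis by (simp add: algebra_simps power_mult_distrib)
  qed
  then have "szego_pos p s y = (\<Sum>n. y ^ n - complex_of_real s * (complex_of_real (1 / (1 + s * p ^ n)) * (complex_of_real p * y) ^ n))"
    unfolding szego_pos_def by simp
  also have "\<dots> = (\<Sum>n. y ^ n) - (\<Sum>n. complex_of_real s * (complex_of_real (1 / (1 + s * p ^ n)) * (complex_of_real p * y) ^ n))"
    using s2 assms by (intro suminf_diff[symmetric] summable_geometric summable_mult) auto
  also have "\<dots> = 1 / (1 - y) - complex_of_real s * szego_pos p s (complex_of_real p * y)"
    unfolding szego_pos_def suminf_mult[OF s2] using assms by (simp add: suminf_geometric)
  finally show ?thesis .
qed

text \<open>The same splitting, applied to s / (s + p^(n+1)) = 1 - p^(n+1) / (s + p^(n+1)).\<close>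

lemma szego_neg_shift:
  assumes "0 < p" "p < 1" "0 < s" "norm y < 1"
  shows "complex_of_real s * szego_neg p s y = y / (1 - y) - szego_neg p s (complex_of_real p * y)"
proof -
  have py: "norm (complex_of_real p * y) < 1"
    using assms mult_strict_mono[of p 1 "norm y" 1] by (simp add: norm_mult)
  note s1 = summable_norm_cancel[OF summable_norm_power_series[OF norm_szego_neg_coeff[OF assms(1,3)] assms(4)]]
  note s2 = summable_norm_cancel[OF summable_norm_power_series[OF norm_szego_neg_coeff[OF assms(1,3)] py]]
  have eq: "complex_of_real s * (complex_of_real (1 / (s + p ^ Suc n)) * y ^ n) =
     y ^ n - complex_of_real p * (complex_of_real (1 / (s + p ^ Suc n)) * (complex_of_real p * y) ^ n)" for n
  proof -
    have "complex_of_real (s * (1 / (s + p ^ Suc n))) = 1 - complex_of_real (p * (1 / (s + p ^ Suc n)) * p ^ n)"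
    proof -
      have "s + p ^ Suc n \<noteq> 0" using assms add_pos_pos[of s "p ^ Suc n"] by simp
      then have "s * (1 / (s + p ^ Suc n)) = 1 - p * (1 / (s + p ^ Suc n)) * p ^ n" by (simp add: field_simps)
      then show ?thesis by (metis of_real_1 of_real_diff)
    qed
    then have "complex_of_real (s * (1 / (s + p ^ Suc n))) * y ^ n = (1 - complex_of_real (p * (1 / (s + p ^ Suc n)) * p ^ n)) * y ^ n" by (simp only:)
    then show ?thesis by (simp add: algebra_simps power_mult_distrib)
  qed
  have "complex_of_real s * szego_neg p s y = y * (\<Sum>n. complex_of_real s * (complex_of_real (1 / (s + p ^ Suc n)) * y ^ n))"
    unfolding szego_neg_def suminf_mult[OF s1] by (simp only: mult_ac)
  also have "\<dots> = y * ((\<Sum>n. y ^ n) - (\<Sum>n. complex_of_real p * (complex_of_real (1 / (s + p ^ Suc n)) * (complex_of_real p * y) ^ n)))"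
    unfolding eq using s2 assms
    by (subst suminf_diff[symmetric]) (simp_all only: summable_geometric summable_mult)
  also have "\<dots> = y / (1 - y) - szego_neg p s (complex_of_real p * y)"
    unfolding szego_neg_def suminf_mult[OF s2] using assms by (simp add: suminf_geometric algebra_simps)
  finally show ?thesis .
qed

lemma szego_ext_eq:
  assumes "0 < q" "q < 1" "0 < s" "q\<^sup>2 < norm x" "norm x < 1"
  shows "szego_ext q s x = (1 - x) * szego_sum q s x"
proof -
  have "x \<noteq> 1" using assms by auto
  then show ?thesis
    unfolding szego_ext_def szego_sum_split[OF assms]
    using szego_pos_shift[of "q\<^sup>2" s x] assms square_less_1[of q] by (simp add: field_simps)
qed

text \<open>At q^2 x the positive half already has the argument occurring in
  \<open>szego_ext q s x\<close>. The negative half has the argument 1 / x, of modulus below 1, and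
  \<open>szego_neg_shift\<close> moves it to q^2 / x.\<close>

lemma szego_ext_shift:
  assumes "0 < q" "q < 1" "0 < s" "1 < norm x" "q\<^sup>2 * norm x < 1"
  shows "szego_sum q s (complex_of_real (q\<^sup>2) * x) = - szego_ext q s x / (complex_of_real s * (1 - x))"
proof -
  let ?y = "complex_of_real (q\<^sup>2) * x"
  have "x \<noteq> 0" "x \<noteq> 1" using assms by auto
  have n: "norm ?y = q\<^sup>2 * norm x" by (simp add: norm_mult norm_power)
  have "q\<^sup>2 < norm ?y" "norm ?y < 1" unfolding n using assms by auto
  then have "szego_sum q s ?y = szego_pos (q\<^sup>2) s ?y + szego_neg (q\<^sup>2) s (1 / x)"
    using szego_sum_split[OF assms(1-3), of ?y] assms by simp
  moreover have "complex_of_real s * szego_neg (q\<^sup>2) s (1 / x) =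
      (1 / x) / (1 - 1 / x) - szego_neg (q\<^sup>2) s (complex_of_real (q\<^sup>2) / x)"
    using szego_neg_shift[of "q\<^sup>2" s "1 / x"] assms square_less_1[of q] by (simp add: norm_divide divide_less_eq)
  moreover have "(1 / x) / (1 - 1 / x) = - 1 / (1 - x)"
    using \<open>x \<noteq> 0\<close> \<open>x \<noteq> 1\<close> by (simp add: field_simps)
  ultimately have "complex_of_real s * szego_sum q s ?y = complex_of_real s * szego_pos (q\<^sup>2) s ?y
      + (- 1 / (1 - x) - szego_neg (q\<^sup>2) s (complex_of_real (q\<^sup>2) / x))"
    by (simp only: distrib_left)
  also have "\<dots> = - szego_ext q s x / (1 - x)"
    unfolding szego_ext_def using \<open>x \<noteq> 1\<close> by (simp add: divide_simps) (simp add: algebra_simps)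
  finally have "complex_of_real s * szego_sum q s ?y = - szego_ext q s x / (1 - x)" .
  then show ?thesis using assms \<open>x \<noteq> 1\<close>
    by (metis divide_divide_eq_left' nonzero_mult_div_cancel_left of_real_eq_0_iff less_irrefl)
qed

lemma szego_ext_1 [simp]: "szego_ext q s 1 = 1"
  by (simp add: szego_ext_def)

lemma holomorphic_szego_ext:
  assumes "0 < q" "q < 1" "0 < s" "f holomorphic_on A"
    "\<And>x. x \<in> A \<Longrightarrow> q\<^sup>2 < norm (f x)" "\<And>x. x \<in> A \<Longrightarrow> q\<^sup>2 * norm (f x) < 1"
  shows "(\<lambda>x. szego_ext q s (f x)) holomorphic_on A"
proof -
  have p: "0 < q\<^sup>2" using assms by simp
  have pos: "szego_pos (q\<^sup>2) s holomorphic_on ball 0 1"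
    unfolding szego_pos_def[abs_def]
    by (rule holomorphic_bounded_power_series[OF norm_szego_pos_coeff[OF p assms(3)]])
  have neg: "szego_neg (q\<^sup>2) s holomorphic_on ball 0 1"
    unfolding szego_neg_def[abs_def]
    by (intro holomorphic_intros holomorphic_bounded_power_series[OF norm_szego_neg_coeff[OF p assms(3)]])
  have nz: "f x \<noteq> 0" if "x \<in> A" for x
    using assms(5)[OF that] by (metis norm_zero not_less zero_le_power2)
  have 1: "(\<lambda>x. szego_pos (q\<^sup>2) s (complex_of_real (q\<^sup>2) * f x)) holomorphic_on A"
    by (rule holomorphic_on_compose_gen[OF _ pos, unfolded o_def])
      (auto intro!: holomorphic_intros assms simp: norm_mult norm_power)
  have 2: "(\<lambda>x. szego_neg (q\<^sup>2) s (complex_of_real (q\<^sup>2) / f x)) holomorphic_on A"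
  proof (rule holomorphic_on_compose_gen[OF _ neg, unfolded o_def])
    show "(\<lambda>x. complex_of_real (q\<^sup>2) / f x) holomorphic_on A"
      using nz by (intro holomorphic_intros assms) auto
    show "(\<lambda>x. complex_of_real (q\<^sup>2) / f x) ` A \<subseteq> ball 0 1"
      using assms(5) nz by (auto simp: norm_divide norm_power)
  qed
  show ?thesis unfolding szego_ext_def by (intro holomorphic_intros 1 2 assms)
qed

text \<open>All terms are positive, and the one at n = 0 alone is 1 / (1 + s). On the diagonal this
  excludes the degenerate case of \<open>cond_kernel\<close> for the Szego kernel.\<close>

lemma szego_sum_pos:
  assumes "0 < q" "q < 1" "0 < s" "q\<^sup>2 < x" "x < 1"
  shows "\<exists>y>0. szego_sum q s (complex_of_real x) = complex_of_real y"
proof -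
  let ?g = "\<lambda>n. x powi n / (1 + s * q powi (2 * n))"
  have x: "x > 0" using assms by (smt (verit) zero_le_power2)
  have hs: "((\<lambda>n. complex_of_real (?g n)) has_sum szego_sum q s (complex_of_real x)) UNIV"
    using szego_sum_has_sum[OF assms(1-3), of "complex_of_real x"] assms x by (simp add: of_real_power_int)
  have "(?g has_sum Re (szego_sum q s (complex_of_real x))) UNIV"
    using has_sum_Re[OF hs] by (simp only: Re_complex_of_real)
  moreover have g: "?g n > 0" for n
    using x assms by (intro divide_pos_pos add_pos_pos mult_pos_pos zero_less_power_int) auto
  ultimately have "sum ?g {0} \<le> Re (szego_sum q s (complex_of_real x))"
    using less_imp_le[OF g] by (intro has_sum_mono_neutral[OF has_sum_finite[of "{0}" ?g]]) auto
  moreover have "Im (szego_sum q s (complex_of_real x)) = 0"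
    using infsumI[OF has_sum_Im[OF hs]] by (simp only: Im_complex_of_real infsum_0_simp)
  moreover have "sum ?g {0} > 0" using assms by simp
  ultimately have "Re (szego_sum q s (complex_of_real x)) > 0" "Im (szego_sum q s (complex_of_real x)) = 0"
    by linarith+
  then show ?thesis
    by (intro exI[of _ "Re (szego_sum q s (complex_of_real x))"]) (auto simp: complex_eq_iff)
qed

section \<open>Conditioning the kernel on a zero\<close>

lemma holomorphic_factor_zero:
  assumes "f holomorphic_on S" "open S" "f a = 0"
  obtains g where "g holomorphic_on S" "\<And>z. z \<in> S \<Longrightarrow> f z = (z - a) * g z"
  by (rule that[OF pole_lemma_open[OF assms(1,2), of a]]) (auto simp: assms(3))

text \<open>After the substitution \<open>z = exp u\<close> and a twist by \<open>exp (- b * u)\<close> the modulus of \<open>g\<close> becomes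
  doubly periodic, hence attains a maximum; the twisted function is then constant, but it also
  changes sign under a period.\<close>

lemma quasi_periodic_imp_zero:
  fixes g :: "complex \<Rightarrow> complex"
  assumes holo: "g holomorphic_on {z. \<rho>1 < norm z \<and> norm z < \<rho>2}"
    and p: "0 < p" "p < 1" and \<rho>: "0 < \<rho>1" "\<rho>1 < p * \<rho>2" and "0 < \<kappa>"
    and per: "\<And>z. \<rho>1 < p * norm z \<Longrightarrow> norm z < \<rho>2 \<Longrightarrow>
      g (complex_of_real p * z) = - complex_of_real \<kappa> * g z"
    and z: "\<rho>1 < norm z" "norm z < \<rho>2"
  shows "g z = 0"
proof -
  define L where "L = ln p"
  \<comment> \<open>\<open>exp (- b * L) = 1 / \<kappa>\<close>, so the twist removes the size of
    the multiplier and leaves only its sign.\<close>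
  define b where "b = ln \<kappa> / L"
  \<comment> \<open>Any radius strictly between \<rho>1 and p * \<rho>2 would do: it keeps the
    closed period from r1 to r1 / p inside the domain.\<close>
  define r1 where "r1 = (\<rho>1 + p * \<rho>2) / 2"
  define S where "S = {u. ln \<rho>1 < Re u \<and> Re u < ln \<rho>2}"
  define f where "f = (\<lambda>u. g (exp u) * exp (- complex_of_real b * u))"
  have L: "L < 0" "exp L = p" "b * L = ln \<kappa>" using p by (auto simp: L_def b_def)
  have r1: "\<rho>1 < r1" "r1 < p * \<rho>2" "0 < r1" using \<rho> by (auto simp: r1_def field_simps)
  have \<rho>2: "0 < \<rho>2" using \<rho> p by (metis less_trans zero_less_mult_pos)
  have lnr1: "ln \<rho>1 < ln r1" "ln r1 - L < ln \<rho>2"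
  proof -
    show "ln \<rho>1 < ln r1" using r1 \<rho> by simp
    have "ln r1 < ln (p * \<rho>2)" using r1 p \<rho>2 by (subst ln_less_cancel_iff) auto
    then show "ln r1 - L < ln \<rho>2" using p \<rho>2 by (simp add: ln_mult L_def)
  qed
  have exp_S: "\<rho>1 < norm (exp u) \<and> norm (exp u) < \<rho>2" if "u \<in> S" for u
    using that \<rho> \<rho>2 exp_less_cancel_iff[of "ln \<rho>1" "Re u"] exp_less_cancel_iff[of "Re u" "ln \<rho>2"]
    by (simp add: S_def)
  have S: "open S" "connected S"
  proof -
    have "S = {u. ln \<rho>1 < Re u} \<inter> {u. Re u < ln \<rho>2}" by (auto simp: S_def)
    then show "open S" "connected S"
      by (auto intro!: convex_connected convex_Int open_halfspace_Re_gt open_halfspace_Re_lt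
          convex_halfspace_Re_gt convex_halfspace_Re_lt)
  qed
  have f_holo: "f holomorphic_on S"
  proof -
    have "(\<lambda>u. g (exp u)) holomorphic_on S"
      by (rule holomorphic_on_compose_gen[OF _ holo, unfolded o_def]) (use exp_S in \<open>auto intro!: holomorphic_intros\<close>)
    then show ?thesis unfolding f_def by (intro holomorphic_intros)
  qed
  have f_shift: "f (u + complex_of_real L) = - f u" if "u \<in> S" "u + complex_of_real L \<in> S" for u
  proof -
    have e: "exp (u + complex_of_real L) = complex_of_real p * exp u"
      using L by (simp add: exp_add exp_of_real)
    have "g (exp (u + complex_of_real L)) = - complex_of_real \<kappa> * g (exp u)"
      unfolding e by (rule per) (use exp_S[OF that(1)] exp_S[OF that(2)] p in \<open>auto simp: e norm_mult\<close>)
    moreover have "exp (- complex_of_real b * (u + complex_of_real L)) =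
        exp (- complex_of_real b * u) / complex_of_real \<kappa>"
    proof -
      have "- complex_of_real b * (u + complex_of_real L) = - complex_of_real b * u - complex_of_real (b * L)"
        by (simp add: algebra_simps)
      then show ?thesis using \<open>0 < \<kappa>\<close> L by (simp only: exp_diff exp_of_real) simp
    qed
    ultimately show ?thesis unfolding f_def using \<open>0 < \<kappa>\<close> by simp
  qed
  have norm_f: "norm (f u) = norm (g (exp u)) * exp (- b * Re u)" for u
    by (simp add: f_def norm_mult)
  \<comment> \<open>A closed fundamental rectangle: the real part runs through one step of length -
    L, the imaginary part through one period of exp.\<close>
  define K where "K = cbox (Complex (ln r1) (- pi)) (Complex (ln r1 - L) pi)"
  have K_S: "K \<subseteq> S" using lnr1 by (auto simp: K_def S_def in_cbox_complex_iff)
  have "Complex (ln r1) 0 \<in> K" using L by (auto simp: K_def in_cbox_complex_iff)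
  then have "K \<noteq> {}" by blast
  moreover have "continuous_on K (\<lambda>u. norm (f u))"
    using holomorphic_on_imp_continuous_on[OF f_holo] continuous_on_subset[OF _ K_S]
    by (intro continuous_on_norm) blast
  ultimately obtain \<xi> where \<xi>: "\<xi> \<in> K" "\<And>u. u \<in> K \<Longrightarrow> norm (f u) \<le> norm (f \<xi>)"
    using continuous_attains_sup[of K "\<lambda>u. norm (f u)"] by (auto simp: K_def)
  have strip: "norm (f u) \<le> norm (f \<xi>)" if "ln r1 \<le> Re u" "Re u \<le> ln r1 - L" for u
  proof -
    have "norm (f u) = norm (f (Ln (exp u)))" by (simp add: norm_f)
    moreover have "Ln (exp u) \<in> K"
      using that mpi_less_Im_Ln[of "exp u"] Im_Ln_le_pi[of "exp u"]
      by (auto simp: K_def in_cbox_complex_iff)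
    ultimately show ?thesis using \<xi> by simp
  qed
  \<comment> \<open>The maximum over K may sit on an edge of K. V adds a further period of the real
    part on either side, as far as S allows, which makes it an interior maximum.\<close>
  define V where "V = S \<inter> {u. ln r1 + L < Re u} \<inter> {u. Re u < ln r1 - 2 * L}"
  have "f constant_on S"
  proof (rule maximum_modulus_principle[OF f_holo S, of V \<xi>])
    show "open V" unfolding V_def using S by (intro open_Int open_halfspace_Re_gt open_halfspace_Re_lt)
    show "V \<subseteq> S" by (auto simp: V_def)
    show "\<xi> \<in> V" using \<xi>(1) K_S L by (auto simp: V_def K_def in_cbox_complex_iff)
    fix u assume u: "u \<in> V"
    consider "Re u < ln r1" | "ln r1 \<le> Re u" "Re u \<le> ln r1 - L" | "ln r1 - L < Re u" by linarith
    then show "norm (f u) \<le> norm (f \<xi>)"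
    proof cases
      case 1
      have "f (u - complex_of_real L + complex_of_real L) = - f (u - complex_of_real L)"
        by (rule f_shift) (use u 1 lnr1 L in \<open>auto simp: V_def S_def\<close>)
      then show ?thesis using strip[of "u - complex_of_real L"] u 1 L by (auto simp: V_def)
    next
      case 3
      have "f (u + complex_of_real L) = - f u"
        by (rule f_shift) (use u 3 lnr1 L in \<open>auto simp: V_def S_def\<close>)
      then show ?thesis using strip[of "u + complex_of_real L"] u 3 L by (auto simp: V_def)
    qed (use strip in auto)
  qed
  then obtain c where c: "\<And>u. u \<in> S \<Longrightarrow> f u = c" by (auto simp: constant_on_def)
  let ?u = "complex_of_real (ln r1 - L)"
  have "?u \<in> S" "?u + complex_of_real L \<in> S" using lnr1 L by (auto simp: S_def)
  then have "c = - c" using f_shift[of ?u] c by metis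
  then have "c = 0" by simp
  have "z \<noteq> 0" using z \<rho> by auto
  moreover from this have "Ln z \<in> S" using z \<rho> \<rho>2 by (simp add: S_def)
  ultimately have "f (Ln z) = 0" "exp (Ln z) = z" using c \<open>c = 0\<close> by auto
  then show ?thesis by (simp add: f_def)
qed

lemma annulus_mult:
  assumes "z \<in> annulus q" "w \<in> annulus q" "0 < q"
  shows "q\<^sup>2 < norm (z * cnj w)" "norm (z * cnj w) < 1"
proof -
  have n: "q < norm z" "norm z < 1" "q < norm w" "norm w < 1" using assms by (auto simp: annulus_def)
  show "q\<^sup>2 < norm (z * cnj w)" "norm (z * cnj w) < 1"
    using mult_strict_mono'[OF n(1,3)] mult_strict_mono'[OF n(2,4)] n assms(3)
    by (simp_all add: norm_mult power2_eq_square)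
qed

lemma szego_sum_diag:
  assumes "0 < q" "q < 1" "0 < s" "a \<in> annulus q"
  shows "\<exists>y>0. szego_sum q s (a * cnj a) = complex_of_real y"
proof -
  have eq: "a * cnj a = complex_of_real ((norm a)\<^sup>2)" by (simp only: complex_norm_square)
  have "norm (a * cnj a) = (norm a)\<^sup>2" by (simp add: norm_mult power2_eq_square)
  then show ?thesis
    using szego_sum_pos[OF assms(1-3), of "(norm a)\<^sup>2"] annulus_mult[OF assms(4,4,1)] unfolding eq by simp
qed

lemma szego_cond_step:
  assumes q: "0 < q" "q < 1" and s: "0 < s"
    and a: "a \<in> annulus q" and z: "z \<in> annulus q" and w: "w \<in> annulus q"
  shows "cond_kernel (szego_kernel q s) a z w =
    h_fun q a z * cnj (h_fun q a w) * szego_kernel q (s * (cmod a)\<^sup>2) z w"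
proof -
  define t where "t = s * (cmod a)\<^sup>2"
  define c where "c = szego_sum q s (a * cnj w) / szego_sum q s (a * cnj a)"
  define C where "C = cnj (h_fun q a w)"
  \<comment> \<open>For y in U the moduli of y * cnj w, y * cnj a and a / y all lie between q^2 and
    1 / q^2, where \<open>szego_ext\<close> is holomorphic and \<open>theta1\<close> has no zero.
    Since \<rho>1 < q < norm a = q^2 * \<rho>2, the annulus U is wider than one period.\<close>
  define \<rho>1 where "\<rho>1 = max (q\<^sup>2 / norm w) (q\<^sup>2 / norm a)"
  define \<rho>2 where "\<rho>2 = norm a / q\<^sup>2"
  define U where "U = {z :: complex. \<rho>1 < norm z \<and> norm z < \<rho>2}"
  let ?p = "complex_of_real (q\<^sup>2)"
  have aw: "q < norm a" "norm a < 1" "q < norm w" "norm w < 1" "q < norm z" "norm z < 1"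
    using a w z by (auto simp: annulus_def)
  then have nz: "a \<noteq> 0" "w \<noteq> 0" using q by auto
  have t: "0 < t" using s nz by (simp add: t_def)
  have diag: "szego_sum q s (a * cnj a) \<noteq> 0" using szego_sum_diag[OF q s a] by auto
  note ann = annulus_mult[OF a w q(1)] annulus_mult[OF a a q(1)]
  have p1: "q\<^sup>2 < 1" "0 < q\<^sup>2" using q square_less_1 by auto
  have \<rho>1: "q\<^sup>2 \<le> \<rho>1" "0 < \<rho>1" "\<rho>1 < q"
  proof -
    show "q\<^sup>2 \<le> \<rho>1" using aw q by (auto simp: \<rho>1_def le_max_iff_disj divide_simps)
    then show "0 < \<rho>1" using p1 by linarith
    show "\<rho>1 < q" using aw q by (auto simp: \<rho>1_def divide_simps power2_eq_square)
  qed
  have q\<rho>2: "q < q\<^sup>2 * \<rho>2" using aw q by (simp add: \<rho>2_def)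
  have U_w: "q\<^sup>2 < norm (y * cnj w)" "q\<^sup>2 * norm (y * cnj w) < 1" 
    and U_a: "q\<^sup>2 < norm (y * cnj a)" "q\<^sup>2 * norm (y * cnj a) < 1"
    and U_ay: "q\<^sup>2 < norm (a / y)" "q\<^sup>2 * norm (a / y) < 1"
    and U_nz: "y \<noteq> 0" if "y \<in> U" for y :: complex
  proof -
    from that have y: "q\<^sup>2 / norm w < norm y" "q\<^sup>2 / norm a < norm y" "norm y < norm a / q\<^sup>2" "0 < norm y"
      "q\<^sup>2 < norm y"
      using \<rho>1 by (auto simp: U_def \<rho>1_def \<rho>2_def)
    then show "y \<noteq> 0" by auto
    have y3: "q\<^sup>2 * norm y < norm a" using y(3) p1 by (simp add: pos_less_divide_eq mult.commute)
    show "q\<^sup>2 < norm (y * cnj w)" "q\<^sup>2 < norm (y * cnj a)"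
      using y nz by (simp_all add: norm_mult pos_divide_less_eq)
    show "q\<^sup>2 * norm (y * cnj w) < 1" "q\<^sup>2 * norm (y * cnj a) < 1"
      using mult_strict_mono'[OF y3, of "norm w" 1] mult_strict_mono'[OF y3, of "norm a" 1] aw q
      by (simp_all add: norm_mult mult_ac)
    show "q\<^sup>2 < norm (a / y)" using y3 y by (simp add: norm_divide pos_less_divide_eq)
    have "q\<^sup>2 * norm a < q\<^sup>2" using aw p1 by simp
    then show "q\<^sup>2 * norm (a / y) < 1" using y by (simp add: norm_divide pos_divide_less_eq)
  qed
  \<comment> \<open>(y - a) * (1 - y * cnj w) times the difference of the two kernels divided by
    \<open>h_fun q a y\<close>. These factors clear the zero of theta q (a / y) and the pole at 1 /
    cnj w. In the term with y * cnj a, \<open>theta1\<close> remains because the factor 1 - cnj a *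
    y of theta has cancelled the pole there.\<close>
  define A where "A = (\<lambda>y. (szego_ext q s (y * cnj w) * theta q (cnj a * y)
       - c * (1 - y * cnj w) * szego_ext q s (y * cnj a) * theta1 q (cnj a * y)) / theta1 q (a / y)
     - C * szego_ext q t (y * cnj w) * (y - a))"
  have "A holomorphic_on U"
    unfolding A_def using q s t U_w U_a U_ay U_nz nz theta1_nonzero[OF q U_ay]
    by (intro holomorphic_intros holomorphic_szego_ext) auto
  moreover have U: "open U"
  proof -
    have "U = norm -` {\<rho>1<..<\<rho>2}" by (auto simp: U_def)
    then show ?thesis by (simp add: open_vimage continuous_on_norm_id)
  qed
  \<comment> \<open>c is the coefficient for which the conditioned kernel vanishes at z = a.\<close>
  moreover have "A a = 0"
  proof -
    have "szego_ext q s (a * cnj w) = (1 - a * cnj w) * szego_sum q s (a * cnj w)"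
      "szego_ext q s (a * cnj a) = (1 - a * cnj a) * szego_sum q s (a * cnj a)"
      by (rule szego_ext_eq[OF q s]; use ann in simp)+
    moreover have "theta q (cnj a * a) = (1 - a * cnj a) * theta1 q (cnj a * a)"
      by (simp add: theta_eq_theta1[OF q] mult.commute)
    ultimately show ?thesis using diag by (simp add: A_def c_def)
  qed
  ultimately obtain g1 where g1: "g1 holomorphic_on U" "\<And>y. y \<in> U \<Longrightarrow> A y = (y - a) * g1 y"
    by (rule holomorphic_factor_zero) blast
  have winv: "1 / cnj w \<in> U"
  proof -
    have "norm (1 / cnj w) > 1" using aw nz by (simp add: norm_divide)
    moreover have "norm (1 / cnj w) < 1 / q" using aw q by (simp add: norm_divide frac_less2)
    moreover have "1 / q < \<rho>2" using q\<rho>2 q by (simp add: field_simps power2_eq_square)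
    ultimately show ?thesis using \<rho>1 q by (auto simp: U_def)
  qed
  have "norm (a * cnj w) \<noteq> 1" using ann by linarith
  then have aw1: "a * cnj w \<noteq> 1" by auto
  \<comment> \<open>The residues of both kernels agree: \<open>szego_ext\<close> is 1 at 1 for
    either parameter, and C is the matching value of the theta quotient at y = 1 / cnj w.\<close>
  have "A (1 / cnj w) = 0"
  proof -
    have "C = cnj w * theta q (cnj a / cnj w) / theta q (a * cnj w)"
      by (simp add: C_def h_fun_def cnj_theta[OF q])
    moreover have "theta1 q (a * cnj w) \<noteq> 0" "theta q (a * cnj w) = (1 - a * cnj w) * theta1 q (a * cnj w)"
      using theta1_nonzero[OF q U_ay[OF winv]] by (simp_all add: theta_eq_theta1[OF q])
    ultimately show ?thesis using nz aw1 by (simp add: A_def field_simps)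
  qed
  moreover have "1 / cnj w \<noteq> a" using aw1 nz by auto
  ultimately have "g1 (1 / cnj w) = 0" using g1(2)[OF winv] by simp
  with g1(1) U obtain g where g: "g holomorphic_on U" "\<And>y. y \<in> U \<Longrightarrow> g1 y = (y - 1 / cnj w) * g y"
    by (rule holomorphic_factor_zero) blast
  have A_eq: "A y = (y - a) * (y - 1 / cnj w) * g y" if "y \<in> U" for y
    using g1(2) g(2) that by simp
  \<comment> \<open>The meromorphic continuation of \<open>szego_sum q s\<close>, with its simple
    pole at 1.\<close>
  define E where "E = (\<lambda>s x. szego_ext q s x / (1 - x))"
  \<comment> \<open>The constant - cnj w comes from 1 - y * cnj w = - cnj w * (y - 1 / cnj w). The
    excluded points are those where the quotients on the right degenerate.\<close>
  have g_eq: "g y = - cnj w * ((E s (y * cnj w) - c * E s (y * cnj a)) * (theta q (cnj a * y) / (y * theta q (a / y)))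
      - C * E t (y * cnj w))"
    if y: "y \<in> U" "y \<noteq> a" "y * cnj w \<noteq> 1" "y * cnj a \<noteq> 1" for y
  proof -
    note nz' = theta1_nonzero[OF q U_ay[OF y(1)]] U_nz[OF y(1)]
    have 1: "y * theta q (a / y) = (y - a) * theta1 q (a / y)"
      using nz' by (simp add: theta_eq_theta1[OF q] field_simps)
    have 2: "theta q (cnj a * y) = (1 - y * cnj a) * theta1 q (cnj a * y)"
      by (simp add: theta_eq_theta1[OF q] mult.commute)
    have "A y = (y - a) * (1 - y * cnj w) * ((E s (y * cnj w) - c * E s (y * cnj a)) * (theta q (cnj a * y) / (y * theta q (a / y)))
      - C * E t (y * cnj w))"
      unfolding 1 A_def E_def 2 using nz' y by (simp add: divide_simps) (simp add: algebra_simps)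
    moreover have "A y = (y - a) * (1 - y * cnj w) * (- g y / cnj w)"
      unfolding A_eq[OF y(1)] using nz by (simp add: field_simps)
    ultimately have "(y - a) * (1 - y * cnj w) * (- g y / cnj w) = (y - a) * (1 - y * cnj w) * ((E s (y * cnj w) - c * E s (y * cnj a)) * (theta q (cnj a * y) / (y * theta q (a / y)))
      - C * E t (y * cnj w))"
      by (rule trans[OF sym, rotated])
    then have "- g y / cnj w = (E s (y * cnj w) - c * E s (y * cnj a)) * (theta q (cnj a * y) / (y * theta q (a / y)))
      - C * E t (y * cnj w)"
      using y by (subst (asm) mult_cancel_left) auto
    then show ?thesis using nz by (metis (no_types) complex_cnj_zero_iff minus_divide_left minus_mult_left minus_minus nonzero_mult_div_cancel_left times_divide_eq_right)
  qed
  have E_shift: "E s' (?p * x) = - E s' x / complex_of_real s'"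
    if "1 < norm x" "q\<^sup>2 * norm x < 1" "0 < s'" for s' x
  proof -
    have n: "norm (?p * x) = q\<^sup>2 * norm x" by (simp add: norm_mult norm_power)
    have "q\<^sup>2 < norm (?p * x)" "norm (?p * x) < 1" "?p * x \<noteq> 1" unfolding n using that p1 n by auto
    then have "E s' (?p * x) = szego_sum q s' (?p * x)"
      unfolding E_def using szego_ext_eq[OF q that(3), of "?p * x"] by simp
    then show ?thesis using szego_ext_shift[OF q that(3,1,2)] by (simp add: E_def)
  qed
  have ne1: "x \<noteq> 1" if "norm x < 1 \<or> 1 < norm x" for x :: complex
    using that by auto
  have g_shift: "g (?p * y) = - complex_of_real (1 / t) * g y"
    if y: "\<rho>1 < q\<^sup>2 * norm y" "norm y < \<rho>2" for y
  proof -
    have n: "norm (?p * y) = q\<^sup>2 * norm y" by (simp add: norm_mult norm_power)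
    have "q\<^sup>2 * norm y \<le> norm y" using p1 by (simp add: mult_left_le_one_le)
    then have yU: "y \<in> U" "?p * y \<in> U" using y n by (auto simp: U_def)
    \<comment> \<open>The lower radius \<rho>1 pays off here: if q^2 y still lies in U, then y * cnj
      w and y * cnj a have modulus above 1, as \<open>E_shift\<close> requires.\<close>
    have "q\<^sup>2 / norm w < q\<^sup>2 * norm y" "q\<^sup>2 / norm a < q\<^sup>2 * norm y" using y by (auto simp: \<rho>1_def)
    then have big: "1 < norm (y * cnj w)" "1 < norm (y * cnj a)"
      using p1 nz by (simp_all add: norm_mult divide_less_eq)
    have small: "norm (?p * y * cnj w) < 1" "norm (?p * y * cnj a) < 1"
      using U_w(2)[OF yU(1)] U_a(2)[OF yU(1)] by (simp_all add: norm_mult norm_power)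
    have "1 < norm y"
      using big(1) aw by (simp add: norm_mult) (smt (verit) mult_left_le norm_ge_zero)
    then have "y \<noteq> a" using aw by auto
    have "?p * y \<noteq> a" 
    proof -
      have "norm (?p * y) < norm a" using y(2) p1 unfolding n by (simp add: \<rho>2_def pos_less_divide_eq mult.commute)
      then show ?thesis by auto
    qed
    have "theta q (cnj a * (?p * y)) = theta q (?p * (cnj a * y))" by (simp add: mult_ac)
    also have "\<dots> = - theta q (cnj a * y) / (cnj a * y)"
      using nz U_nz[OF yU(1)] by (intro theta_shift q) auto
    finally have t1: "theta q (cnj a * (?p * y)) = - theta q (cnj a * y) / (cnj a * y)" .
    have "theta q (a / y) = theta q (?p * (a / (?p * y)))" using q by simp
    also have "\<dots> = - theta q (a / (?p * y)) / (a / (?p * y))"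
      using nz q U_nz[OF yU(1)] by (intro theta_shift q) auto
    finally have t2: "theta q (a / (?p * y)) = - (a / (?p * y)) * theta q (a / y)"
      using nz q U_nz[OF yU(1)] by (simp add: field_simps)
    have aa: "complex_of_real ((cmod a)\<^sup>2) = a * cnj a" by (simp only: complex_norm_square)
    have quot: "theta q (cnj a * (?p * y)) / (?p * y * theta q (a / (?p * y))) =
        theta q (cnj a * y) / (y * theta q (a / y)) / complex_of_real ((cmod a)\<^sup>2)"
      unfolding t1 t2 aa using nz q U_nz[OF yU(1)] by (simp add: field_simps)
    have Es: "E s (?p * y * cnj w) = - E s (y * cnj w) / complex_of_real s"
        "E s (?p * y * cnj a) = - E s (y * cnj a) / complex_of_real s"
        "E t (?p * y * cnj w) = - E t (y * cnj w) / complex_of_real t"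
      using E_shift[of "y * cnj w" s] E_shift[of "y * cnj a" s] E_shift[of "y * cnj w" t]
        big U_w(2)[OF yU(1)] U_a(2)[OF yU(1)] s t by (simp_all add: mult.assoc)
    \<comment> \<open>The first term carries -1 / s from \<open>E s\<close> and 1 / norm a ^ 2 from
      the theta quotient, the second -1 / t from \<open>E t\<close>; the two agree by the choice of
      t.\<close>
    have alg: "- W * ((- e1 / complex_of_real s - c * (- e2 / complex_of_real s)) * (T / complex_of_real ((cmod a)\<^sup>2))
        - C * (- e3 / complex_of_real t)) = - complex_of_real (1 / t) * (- W * ((e1 - c * e2) * T - C * e3))"
      for W e1 e2 T e3 :: complex
      unfolding t_def using s nz by (simp add: field_simps)
    have "g (?p * y) = - cnj w * ((E s (?p * y * cnj w) - c * E s (?p * y * cnj a)) * (theta q (cnj a * (?p * y)) / (?p * y * theta q (a / (?p * y))))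
      - C * E t (?p * y * cnj w))"
      by (rule g_eq) (use yU \<open>?p * y \<noteq> a\<close> ne1[OF disjI1[OF small(1)]] ne1[OF disjI1[OF small(2)]] in simp_all)
    also have "\<dots> = - complex_of_real (1 / t) * (- cnj w * ((E s (y * cnj w) - c * E s (y * cnj a)) * (theta q (cnj a * y) / (y * theta q (a / y)))
      - C * E t (y * cnj w)))"
      unfolding quot Es by (rule alg)
    also have "\<dots> = - complex_of_real (1 / t) * g y"
      by (subst g_eq) (use yU \<open>y \<noteq> a\<close> ne1[OF disjI2[OF big(1)]] ne1[OF disjI2[OF big(2)]] in simp_all)
    finally show ?thesis .
  qed
  have zU: "z \<in> U"
  proof -
    have "1 < \<rho>2" using q\<rho>2 q by (simp add: \<rho>2_def) (smt (verit) aw p1 power2_eq_square less_divide_eq_1_pos mult_le_cancel_left2 zero_less_power2)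
    then show ?thesis using aw \<rho>1 by (auto simp: U_def)
  qed
  have "g z = 0"
    by (rule quasi_periodic_imp_zero[of g \<rho>1 \<rho>2 "q\<^sup>2" "1 / t"])
      (use g(1) p1 \<rho>1 q\<rho>2 t g_shift zU in \<open>auto simp: U_def\<close>)
  have zw: "norm (z * cnj w) < 1" "norm (z * cnj a) < 1" "z * cnj w \<noteq> 1" "z * cnj a \<noteq> 1"
    using annulus_mult(2)[OF z w q(1)] annulus_mult(2)[OF z a q(1)] by auto
  have k: "cond_kernel (szego_kernel q s) a z w = szego_sum q s (z * cnj w) - c * szego_sum q s (z * cnj a)"
    by (simp add: cond_kernel_def szego_kernel_eq c_def)
  show ?thesis
  proof (cases "z = a")
    case True
    have "h_fun q a a = 0" by (simp add: h_fun_def theta_eq_theta1[OF q] nz)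
    moreover have "cond_kernel (szego_kernel q s) a z w = 0" unfolding True using diag by (simp add: cond_kernel_def szego_kernel_eq)
    ultimately show ?thesis by (simp add: True)
  next
    case False
    have "0 = (E s (z * cnj w) - c * E s (z * cnj a)) * (theta q (cnj a * z) / (z * theta q (a / z)))
      - C * E t (z * cnj w)"
      using g_eq[OF zU False zw(3,4)] \<open>g z = 0\<close> nz by simp
    moreover have "E s (z * cnj w) = szego_sum q s (z * cnj w)" "E t (z * cnj w) = szego_sum q t (z * cnj w)"
        "E s (z * cnj a) = szego_sum q s (z * cnj a)"
      using szego_ext_eq[OF q s annulus_mult[OF z w q(1)]] szego_ext_eq[OF q t annulus_mult[OF z w q(1)]]
        szego_ext_eq[OF q s annulus_mult[OF z a q(1)]] zw by (simp_all add: E_def)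
    moreover have "theta q (cnj a * z) \<noteq> 0"
      by (rule theta_nonzero[OF q]) (use U_a[OF zU] zw in \<open>auto simp: mult.commute\<close>)
    moreover have "theta q (a / z) \<noteq> 0"
      by (rule theta_nonzero[OF q]) (use U_ay[OF zU] False U_nz[OF zU] in auto)
    ultimately show ?thesis using U_nz[OF zU]
      unfolding k t_def[symmetric] C_def[symmetric] szego_kernel_eq by (simp add: h_fun_def field_simps)
  qed
qed

text \<open>Both theta arguments have modulus between q^2 and 1 / q^2, where theta vanishes only at
  1. The denominator has an argument of modulus below 1, and a / z = 1 only for z = a.\<close>

lemma h_fun_eq_0_iff:
  assumes q: "0 < q" "q < 1" and "a \<in> annulus q" "z \<in> annulus q"
  shows "h_fun q a z = 0 \<longleftrightarrow> z = a"
proof -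
  have n: "q < norm a" "norm a < 1" "q < norm z" "norm z < 1" using assms by (auto simp: annulus_def)
  then have nz: "a \<noteq> 0" "z \<noteq> 0" using q by auto
  have "q\<^sup>2 < norm (cnj a * z)" "norm (cnj a * z) < 1"
    using annulus_mult[OF assms(4,3) q(1)] by (simp_all add: mult.commute)
  moreover from this have "q\<^sup>2 * norm (cnj a * z) < 1"
    using square_less_1[OF q] mult_strict_mono[of "q\<^sup>2" 1 "norm (cnj a * z)" 1] by simp
  ultimately have 1: "theta q (cnj a * z) \<noteq> 0" by (intro theta_nonzero[OF q]) auto
  have "q * norm z < norm a" using mult_strict_mono'[OF n(1,4)] n q by simp
  moreover have q1: "q\<^sup>2 * norm z < q * norm z" using nz q by (simp add: power2_eq_square)
  moreover have "q * norm a < norm z" and q2: "q\<^sup>2 * norm a < q * norm a"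
    using mult_strict_mono'[OF n(3,2)] n nz q by (simp_all add: power2_eq_square)
  ultimately have "q\<^sup>2 < norm (a / z)" "q\<^sup>2 * norm (a / z) < 1"
    using nz less_trans[OF q1, of "norm a"] less_trans[OF q2, of "norm z"]
    by (simp_all add: norm_divide pos_less_divide_eq pos_divide_less_eq)
  then have "theta q (a / z) = 0 \<longleftrightarrow> z = a"
    using theta_nonzero[OF q] nz theta_eq_theta1[OF q, of 1] by (cases "z = a") auto
  then show ?thesis using 1 nz by (simp add: h_fun_def)
qed

lemma gamma_fun_eq_0_iff:
  assumes "0 < q" "q < 1" "\<forall>l\<in>{1..n}. \<alpha> l \<in> annulus q" "z \<in> annulus q"
  shows "gamma_fun q \<alpha> n z = 0 \<longleftrightarrow> z \<in> \<alpha> ` {1..n}"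
  using assms h_fun_eq_0_iff[OF assms(1,2) _ assms(4)] by (auto simp: gamma_fun_def)

text \<open>A factor f(z) * cnj (f(w)) of a kernel passes through conditioning at a whenever f(a) is
  nonzero, since f(a) and its conjugate cancel in the quotient. For the factor collected so far this
  holds because the points are distinct.\<close>

lemma cond_kernels_szego:
  assumes q: "0 < q" "q < 1" and r: "0 < r"
    and "\<forall>l\<in>{1..n}. \<alpha> l \<in> annulus q" "inj_on \<alpha> {1..n}"
    and z: "z \<in> annulus q" "w \<in> annulus q"
  shows "cond_kernels (szego_kernel q r) \<alpha> n z w =
    gamma_fun q \<alpha> n z * cnj (gamma_fun q \<alpha> n w) * szego_kernel q (r * (\<Prod>l=1..n. (cmod (\<alpha> l))\<^sup>2)) z w"
  using assms(4,5) z
proof (induction n arbitrary: z w)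
  case 0
  then show ?case by (simp add: gamma_fun_def)
next
  case (Suc n)
  define t where "t = r * (\<Prod>l=1..n. (cmod (\<alpha> l))\<^sup>2)"
  let ?a = "\<alpha> (Suc n)" and ?g = "gamma_fun q \<alpha> n"
  have \<alpha>: "\<forall>l\<in>{1..n}. \<alpha> l \<in> annulus q" "inj_on \<alpha> {1..n}" and a: "?a \<in> annulus q"
    using Suc.prems by (auto intro: inj_on_subset)
  have "0 \<notin> annulus q" using q by (auto simp: annulus_def)
  then have "0 < t" unfolding t_def using r \<alpha> by (intro mult_pos_pos prod_pos) fastforce+
  have "?a \<notin> \<alpha> ` {1..n}"
    using inj_onD[OF Suc.prems(2), of "Suc n"] by fastforce
  then have "?g ?a \<noteq> 0" using gamma_fun_eq_0_iff[OF q \<alpha>(1) a] by simp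
  moreover have "szego_kernel q t ?a ?a \<noteq> 0"
    using szego_sum_diag[OF q \<open>0 < t\<close> a] by (auto simp: szego_kernel_eq)
  ultimately have "cond_kernels (szego_kernel q r) \<alpha> (Suc n) z w =
      ?g z * cnj (?g w) * cond_kernel (szego_kernel q t) ?a z w"
    unfolding cond_kernels.simps cond_kernel_def Suc.IH[OF \<alpha> Suc.prems(3,4), folded t_def]
      Suc.IH[OF \<alpha> Suc.prems(3) a, folded t_def] Suc.IH[OF \<alpha> a Suc.prems(4), folded t_def]
      Suc.IH[OF \<alpha> a a, folded t_def] by (simp add: field_simps)
  also have "\<dots> = ?g z * cnj (?g w) * (h_fun q ?a z * cnj (h_fun q ?a w) * szego_kernel q (t * (cmod ?a)\<^sup>2) z w)"
    using szego_cond_step[OF q \<open>0 < t\<close> a] Suc.prems(3,4) by simp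
  finally show ?case by (simp add: gamma_fun_def t_def mult_ac)
qed

section \<open>Laws are determined by their characteristic functions\<close>

definition char_determining :: "'c::euclidean_space itself \<Rightarrow> bool"
  where "char_determining _ \<longleftrightarrow> (\<forall>\<mu> \<nu> :: 'c measure.
    finite_measure \<mu> \<longrightarrow> finite_measure \<nu> \<longrightarrow> sets \<mu> = sets borel \<longrightarrow> sets \<nu> = sets borel \<longrightarrow>
    (\<forall>w. (\<integral>x. iexp (w \<bullet> x) \<partial>\<mu>) = (\<integral>x. iexp (w \<bullet> x) \<partial>\<nu>)) \<longrightarrow> \<mu> = \<nu>)"

lemma finite_measure_integrable_iexp:
  assumes "finite_measure M" "f \<in> borel_measurable M"
  shows "integrable M (\<lambda>x. iexp (f x))"
  using assms(2) by (intro finite_measure.integrable_const_bound[OF assms(1), of _ 1]) auto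

definition cos_weighted_law ::
  "'a measure \<Rightarrow> ('a \<Rightarrow> 'c::euclidean_space) \<Rightarrow> ('a \<Rightarrow> real) \<Rightarrow> 'c measure"
  where "cos_weighted_law M X U = distr (density M (\<lambda>\<omega>. ennreal (1 + cos (U \<omega>)))) borel X"

text \<open>Nonnegativity makes 1 + cos U a density, and the bound by 2 keeps the weighted measure
  finite.\<close>

lemma one_plus_cos_bounds: "1 + cos x \<ge> 0" "\<bar>1 + cos x\<bar> \<le> 2" for x :: real
  using cos_ge_minus_one[of x] cos_le_one[of x] by linarith+

lemma
  fixes X :: "'a \<Rightarrow> 'c::euclidean_space"
  assumes fin: "finite_measure M" and [measurable]: "X \<in> borel_measurable M" "U \<in> borel_measurable M"
  shows emeasure_cos_weighted_law: "B \<in> sets borel \<Longrightarrow>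
      emeasure (cos_weighted_law M X U) B = ennreal (\<integral>\<omega>. indicator B (X \<omega>) * (1 + cos (U \<omega>)) \<partial>M)"
    and finite_measure_cos_weighted_law: "finite_measure (cos_weighted_law M X U)"
    and char_cos_weighted_law: "(\<integral>x. iexp (w \<bullet> x) \<partial>cos_weighted_law M X U) = (\<integral>\<omega>. iexp (w \<bullet> X \<omega>) \<partial>M)
        + (\<integral>\<omega>. iexp (U \<omega> + w \<bullet> X \<omega>) \<partial>M) / 2 + (\<integral>\<omega>. iexp (- U \<omega> + w \<bullet> X \<omega>) \<partial>M) / 2"
proof -
  show em: "emeasure (cos_weighted_law M X U) B = ennreal (\<integral>\<omega>. indicator B (X \<omega>) * (1 + cos (U \<omega>)) \<partial>M)"
    if [measurable]: "B \<in> sets borel" for B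
  proof -
    have "emeasure (cos_weighted_law M X U) B =
        (\<integral>\<^sup>+\<omega>. ennreal (1 + cos (U \<omega>)) * indicator (X -` B \<inter> space M) \<omega> \<partial>M)"
      unfolding cos_weighted_law_def by (subst emeasure_distr) (auto simp: emeasure_density)
    also have "\<dots> = (\<integral>\<^sup>+\<omega>. ennreal (indicator B (X \<omega>) * (1 + cos (U \<omega>))) \<partial>M)"
      by (intro nn_integral_cong) (auto simp: indicator_def)
    also have "\<dots> = ennreal (\<integral>\<omega>. indicator B (X \<omega>) * (1 + cos (U \<omega>)) \<partial>M)"
      using one_plus_cos_bounds(1)
      by (intro nn_integral_eq_integral finite_measure.integrable_const_bound[OF fin, of _ 2])
        (auto simp: indicator_def one_plus_cos_bounds(2))
    finally show ?thesis .
  qed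
  show "finite_measure (cos_weighted_law M X U)"
    using em[of UNIV] by (intro finite_measureI) (simp add: cos_weighted_law_def)
  have "(\<integral>x. iexp (w \<bullet> x) \<partial>cos_weighted_law M X U) = (\<integral>\<omega>. (1 + cos (U \<omega>)) *\<^sub>R iexp (w \<bullet> X \<omega>) \<partial>M)"
    unfolding cos_weighted_law_def using one_plus_cos_bounds(1)
    by (subst integral_distr, simp, simp) (subst integral_density, auto)
  also have "\<dots> = (\<integral>\<omega>. iexp (w \<bullet> X \<omega>) + iexp (U \<omega> + w \<bullet> X \<omega>) / 2 + iexp (- U \<omega> + w \<bullet> X \<omega>) / 2 \<partial>M)"
  proof (intro Bochner_Integration.integral_cong refl)
    fix \<omega>
    have "complex_of_real (cos (U \<omega>)) = (iexp (U \<omega>) + iexp (- U \<omega>)) / 2"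
      by (simp add: cos_exp_eq flip: cos_of_real)
    moreover have "iexp (V + w \<bullet> X \<omega>) = iexp V * iexp (w \<bullet> X \<omega>)" for V
      by (simp only: of_real_add distrib_left exp_add)
    ultimately show "(1 + cos (U \<omega>)) *\<^sub>R iexp (w \<bullet> X \<omega>) =
        iexp (w \<bullet> X \<omega>) + iexp (U \<omega> + w \<bullet> X \<omega>) / 2 + iexp (- U \<omega> + w \<bullet> X \<omega>) / 2"
      by (simp only: scaleR_conv_of_real of_real_add of_real_1 distrib_right add_divide_distrib add.assoc mult_1_left
          times_divide_eq_left)
  qed
  also have "\<dots> = (\<integral>\<omega>. iexp (w \<bullet> X \<omega>) \<partial>M)
      + (\<integral>\<omega>. iexp (U \<omega> + w \<bullet> X \<omega>) \<partial>M) / 2 + (\<integral>\<omega>. iexp (- U \<omega> + w \<bullet> X \<omega>) \<partial>M) / 2"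
    using finite_measure_integrable_iexp[OF fin, of "\<lambda>\<omega>. w \<bullet> X \<omega>"] finite_measure_integrable_iexp[OF fin, of "\<lambda>\<omega>. U \<omega> + w \<bullet> X \<omega>"]
      finite_measure_integrable_iexp[OF fin, of "\<lambda>\<omega>. - U \<omega> + w \<bullet> X \<omega>"]
    by simp
  finally show "(\<integral>x. iexp (w \<bullet> x) \<partial>cos_weighted_law M X U) = \<dots>" .
qed

lemma sets_cos_weighted_law [simp]: "sets (cos_weighted_law M X U) = sets borel"
  by (simp add: cos_weighted_law_def)

lemma integrable_indicator_bounded:
  assumes "finite_measure M" "X \<in> borel_measurable M" "B \<in> sets borel"
  shows "U \<in> borel_measurable M \<Longrightarrow> integrable M (\<lambda>\<omega>. indicator B (X \<omega>) * cos (U \<omega>) :: real)"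
    and "integrable M (\<lambda>\<omega>. indicator B (X \<omega>) :: real)"
  using assms(2,3)
  by (auto intro!: finite_measure.integrable_const_bound[OF assms(1), of _ 1] simp: indicator_def)

lemma integral_iexp_shift:
  "(\<integral>\<omega>. iexp (s * (U \<omega> + d) + V \<omega>) \<partial>M) = iexp (s * d) * (\<integral>\<omega>. iexp (s * U \<omega> + V \<omega>) \<partial>M)"
proof -
  have "iexp (s * (U \<omega> + d) + V \<omega>) = iexp (s * d) * iexp (s * U \<omega> + V \<omega>)" for \<omega>
    by (simp add: algebra_simps flip: exp_add)
  then show ?thesis by simp
qed

text \<open>Weighting \<open>M\<close> with \<open>1 + cos (U + d) \<ge> 0\<close> keeps it a measure, which reduces the claim to
  the uniqueness of the law of \<open>X\<close> alone.\<close>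

lemma char_determining_weighted:
  fixes X :: "'a \<Rightarrow> 'c::euclidean_space" and Y :: "'b \<Rightarrow> 'c"
  assumes det: "char_determining TYPE('c)"
    and fin: "finite_measure M" "finite_measure N"
    and [measurable]: "X \<in> borel_measurable M" "Y \<in> borel_measurable N"
      "U \<in> borel_measurable M" "V \<in> borel_measurable N" "B \<in> sets borel"
    and eq: "\<And>s w. (\<integral>\<omega>. iexp (s * U \<omega> + w \<bullet> X \<omega>) \<partial>M) = (\<integral>\<omega>. iexp (s * V \<omega> + w \<bullet> Y \<omega>) \<partial>N)"
  shows "(\<integral>\<omega>. indicator B (X \<omega>) *\<^sub>R iexp (U \<omega>) \<partial>M) = (\<integral>\<omega>. indicator B (Y \<omega>) *\<^sub>R iexp (V \<omega>) \<partial>N)"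
proof -
  \<comment> \<open>Scale c and phase d are kept free: c = 0 and d = 0 recover the unweighted
    measure, while c = 1 with d = 0 and d = - pi / 2 give the real and the imaginary part of
    \<open>iexp U\<close>.\<close>
  have cw: "(\<integral>\<omega>. indicator B (X \<omega>) * (1 + cos (c * U \<omega> + d)) \<partial>M) =
      (\<integral>\<omega>. indicator B (Y \<omega>) * (1 + cos (c * V \<omega> + d)) \<partial>N)" for c d :: real
  proof -
    have "cos_weighted_law M X (\<lambda>\<omega>. c * U \<omega> + d) = cos_weighted_law N Y (\<lambda>\<omega>. c * V \<omega> + d)"
    proof (rule det[unfolded char_determining_def, rule_format])
      fix w
      have "(\<integral>\<omega>. iexp (s * (c * U \<omega> + d) + w \<bullet> X \<omega>) \<partial>M) = (\<integral>\<omega>. iexp (s * (c * V \<omega> + d) + w \<bullet> Y \<omega>) \<partial>N)" for s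
        using eq[of "s * c" w] integral_iexp_shift[where M = M and U = "\<lambda>\<omega>. c * U \<omega>" and V = "\<lambda>\<omega>. w \<bullet> X \<omega>" and s = s and d = d]
          integral_iexp_shift[where M = N and U = "\<lambda>\<omega>. c * V \<omega>" and V = "\<lambda>\<omega>. w \<bullet> Y \<omega>" and s = s and d = d]
        by (simp only: mult.assoc)
      from this[of 0] this[of 1] this[of "-1"]
      show "(\<integral>x. iexp (w \<bullet> x) \<partial>cos_weighted_law M X (\<lambda>\<omega>. c * U \<omega> + d)) =
          (\<integral>x. iexp (w \<bullet> x) \<partial>cos_weighted_law N Y (\<lambda>\<omega>. c * V \<omega> + d))"
        using fin by (simp add: char_cos_weighted_law)
    qed (auto intro!: finite_measure_cos_weighted_law fin)
    then have "emeasure (cos_weighted_law M X (\<lambda>\<omega>. c * U \<omega> + d)) B = emeasure (cos_weighted_law N Y (\<lambda>\<omega>. c * V \<omega> + d)) B"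
      by simp
    then have "ennreal (\<integral>\<omega>. indicator B (X \<omega>) * (1 + cos (c * U \<omega> + d)) \<partial>M) =
      ennreal (\<integral>\<omega>. indicator B (Y \<omega>) * (1 + cos (c * V \<omega> + d)) \<partial>N)"
      using fin by (simp add: emeasure_cos_weighted_law)
    then show ?thesis
      by (subst (asm) ennreal_inj) (auto intro!: integral_nonneg_AE AE_I2 mult_nonneg_nonneg one_plus_cos_bounds)
  qed
  have int: "integrable M (\<lambda>\<omega>. indicator B (X \<omega>) * cos (U \<omega> + d))" "integrable M (\<lambda>\<omega>. indicator B (X \<omega>) :: real)"
     "integrable N (\<lambda>\<omega>. indicator B (Y \<omega>) * cos (V \<omega> + d))" "integrable N (\<lambda>\<omega>. indicator B (Y \<omega>) :: real)" for d :: real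
    by (intro integrable_indicator_bounded fin; simp)+
  have ind: "(\<integral>\<omega>. indicator B (X \<omega>) \<partial>M) = (\<integral>\<omega>. indicator B (Y \<omega>) \<partial>N :: real)"
    using cw[of 0 0] by simp
  have cos: "(\<integral>\<omega>. indicator B (X \<omega>) * cos (U \<omega> + d) \<partial>M) = (\<integral>\<omega>. indicator B (Y \<omega>) * cos (V \<omega> + d) \<partial>N)" for d :: real
    using cw[of 1 d] int(1)[of d] int(2) int(3)[of d] int(4) ind by (simp add: distrib_left)
  have re_im: "indicator B x *\<^sub>R iexp u = complex_of_real (indicator B x * cos (u + 0)) +
      \<i> * complex_of_real (indicator B x * cos (u + - pi / 2))" for x :: 'c and u :: real
  proof -
    have "cos (u + - pi / 2) = sin u" by (simp add: cos_diff)
    then show ?thesis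
      by (simp add: complex_eq_iff Re_exp Im_exp)
  qed
  show ?thesis
    unfolding re_im using int(1)[of 0] int(1)[of "- pi / 2"] int(3)[of 0] int(3)[of "- pi / 2"] cos[of 0] cos[of "- pi / 2"]
    by (simp only: Bochner_Integration.integral_add integrable_of_real integrable_mult_right
        integral_mult_right_zero integral_complex_of_real)
qed

text \<open>Induction on J, with M and N restricted to the event that coordinate a lies in A a. By
  \<open>char_determining_weighted\<close> the remaining coordinates still have equal joint
  characteristic functions under the restricted measures, which is why the induction generalizes
  over M and N.\<close>

lemma joint_law_eqI:
  fixes X :: "'i \<Rightarrow> 'a \<Rightarrow> 'c::euclidean_space" and Y :: "'i \<Rightarrow> 'b \<Rightarrow> 'c"
  assumes det: "char_determining TYPE('c)"
    and "finite J" "finite_measure M" "finite_measure N"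
    and "\<And>j. j \<in> J \<Longrightarrow> X j \<in> borel_measurable M" "\<And>j. j \<in> J \<Longrightarrow> Y j \<in> borel_measurable N"
    and "\<And>c. (\<integral>\<omega>. iexp (\<Sum>j\<in>J. c j \<bullet> X j \<omega>) \<partial>M) = (\<integral>\<omega>. iexp (\<Sum>j\<in>J. c j \<bullet> Y j \<omega>) \<partial>N)"
    and "\<And>j. j \<in> J \<Longrightarrow> A j \<in> sets borel"
  shows "emeasure M {\<omega> \<in> space M. \<forall>j\<in>J. X j \<omega> \<in> A j} = emeasure N {\<omega> \<in> space N. \<forall>j\<in>J. Y j \<omega> \<in> A j}"
  using assms(2-)
proof (induction J arbitrary: M N)
  case empty
  interpret M: finite_measure M by fact
  interpret N: finite_measure N by fact
  from empty.prems(5) have "measure M (space M) = measure N (space N)" by simp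
  then show ?case by (simp add: M.emeasure_eq_measure N.emeasure_eq_measure)
next
  case (insert a J)
  have [measurable]: "X a \<in> borel_measurable M" "Y a \<in> borel_measurable N" "A a \<in> sets borel"
    "\<And>j. j \<in> J \<Longrightarrow> X j \<in> borel_measurable M" "\<And>j. j \<in> J \<Longrightarrow> Y j \<in> borel_measurable N"
    "\<And>j. j \<in> J \<Longrightarrow> A j \<in> sets borel"
    using insert.prems by auto
  define M' where "M' = density M (indicator (X a -` A a \<inter> space M))"
  define N' where "N' = density N (indicator (Y a -` A a \<inter> space N))"
  have emM: "emeasure M' S = emeasure M (X a -` A a \<inter> space M \<inter> S)" if "S \<in> sets M" for S
    unfolding M'_def by (subst emeasure_restricted) (use that in \<open>auto simp: Int_commute\<close>)
  have emN: "emeasure N' S = emeasure N (Y a -` A a \<inter> space N \<inter> S)" if "S \<in> sets N" for S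
    unfolding N'_def by (subst emeasure_restricted) (use that in \<open>auto simp: Int_commute\<close>)
  have sp: "space M' = space M" "space N' = space N" "sets M' = sets M" "sets N' = sets N"
    by (auto simp: M'_def N'_def)
  have "emeasure M' {\<omega> \<in> space M'. \<forall>j\<in>J. X j \<omega> \<in> A j} = emeasure N' {\<omega> \<in> space N'. \<forall>j\<in>J. Y j \<omega> \<in> A j}"
  proof (rule insert.IH)
    show "finite_measure M'" "finite_measure N'"
      using finite_measure.emeasure_finite[OF insert.prems(1)] finite_measure.emeasure_finite[OF insert.prems(2)]
      by (auto intro!: finite_measureI simp: sp emM emN)
    fix c
    let ?U = "\<lambda>\<omega>. \<Sum>j\<in>J. c j \<bullet> X j \<omega>" and ?V = "\<lambda>\<omega>. \<Sum>j\<in>J. c j \<bullet> Y j \<omega>"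
    have "(\<integral>\<omega>. indicator (A a) (X a \<omega>) *\<^sub>R iexp (?U \<omega>) \<partial>M) = (\<integral>\<omega>. indicator (A a) (Y a \<omega>) *\<^sub>R iexp (?V \<omega>) \<partial>N)"
    proof (rule char_determining_weighted[OF det insert.prems(1,2)])
      fix s w
      have 1: "(\<Sum>j\<in>insert a J. (if j = a then w else s *\<^sub>R c j) \<bullet> Z j) = s * (\<Sum>j\<in>J. c j \<bullet> Z j) + w \<bullet> Z a" for Z :: "'i \<Rightarrow> 'c"
        using insert.hyps by (simp add: sum_distrib_left) (intro sum.cong, auto)
      show "(\<integral>\<omega>. iexp (s * ?U \<omega> + w \<bullet> X a \<omega>) \<partial>M) = (\<integral>\<omega>. iexp (s * ?V \<omega> + w \<bullet> Y a \<omega>) \<partial>N)"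
        using insert.prems(5)[of "\<lambda>j. if j = a then w else s *\<^sub>R c j"] unfolding 1 .
    qed auto
    moreover have "(\<integral>\<omega>. iexp (?U \<omega>) \<partial>M') = (\<integral>\<omega>. indicator (A a) (X a \<omega>) *\<^sub>R iexp (?U \<omega>) \<partial>M)"
      unfolding M'_def ennreal_indicator[symmetric]
      by (subst integral_density) (auto intro!: Bochner_Integration.integral_cong simp: indicator_def)
    moreover have "(\<integral>\<omega>. iexp (?V \<omega>) \<partial>N') = (\<integral>\<omega>. indicator (A a) (Y a \<omega>) *\<^sub>R iexp (?V \<omega>) \<partial>N)"
      unfolding N'_def ennreal_indicator[symmetric]
      by (subst integral_density) (auto intro!: Bochner_Integration.integral_cong simp: indicator_def)
    ultimately show "(\<integral>\<omega>. iexp (?U \<omega>) \<partial>M') = (\<integral>\<omega>. iexp (?V \<omega>) \<partial>N')" by simp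
  qed (use insert.prems in \<open>auto simp: M'_def N'_def\<close>)
  moreover have "emeasure M' {\<omega> \<in> space M'. \<forall>j\<in>J. X j \<omega> \<in> A j} = emeasure M {\<omega> \<in> space M. \<forall>j\<in>insert a J. X j \<omega> \<in> A j}"
    using \<open>finite J\<close> by (subst emM) (auto simp: sp intro!: arg_cong[of _ _ "emeasure M"])
  moreover have "emeasure N' {\<omega> \<in> space N'. \<forall>j\<in>J. Y j \<omega> \<in> A j} = emeasure N {\<omega> \<in> space N. \<forall>j\<in>insert a J. Y j \<omega> \<in> A j}"
    using \<open>finite J\<close> by (subst emN) (auto simp: sp intro!: arg_cong[of _ _ "emeasure N"])
  ultimately show ?case by simp
qed

text \<open>Levy's theorem after dividing by the common total mass, which is read off the
  characteristic functions at 0; for mass 0 both measures are null.\<close>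

lemma char_determining_real: "char_determining TYPE(real)"
  unfolding char_determining_def
proof safe
  fix \<mu> \<nu> :: "real measure"
  assume fin: "finite_measure \<mu>" "finite_measure \<nu>" and sets: "sets \<mu> = sets borel" "sets \<nu> = sets borel"
    and eq: "\<forall>w. (\<integral>x. iexp (w \<bullet> x) \<partial>\<mu>) = (\<integral>x. iexp (w \<bullet> x) \<partial>\<nu>)"
  interpret \<mu>: finite_measure \<mu> by fact
  interpret \<nu>: finite_measure \<nu> by fact
  have space: "space \<mu> = UNIV" "space \<nu> = UNIV" using sets_eq_imp_space_eq[OF sets(1)] sets_eq_imp_space_eq[OF sets(2)] by simp_all
  define m where "m = measure \<mu> UNIV"
  have m: "measure \<nu> UNIV = m" using eq[rule_format, of 0] by (simp add: m_def space)
  show "\<mu> = \<nu>"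
  proof (cases "m = 0")
    case True
    have "emeasure \<mu> A \<le> emeasure \<mu> UNIV" "emeasure \<nu> A \<le> emeasure \<nu> UNIV" for A
      using sets by (auto intro!: emeasure_mono)
    moreover have "emeasure \<mu> UNIV = 0" "emeasure \<nu> UNIV = 0"
      using True m by (simp_all add: \<mu>.emeasure_eq_measure \<nu>.emeasure_eq_measure m_def)
    ultimately have "emeasure \<mu> A = 0" "emeasure \<nu> A = 0" for A
      by (metis le_zero_eq)+
    then show ?thesis using sets by (intro measure_eqI) auto
  next
    case False
    then have "0 < m" by (simp add: m_def zero_less_measure_iff measure_nonneg less_le)
    have dist: "real_distribution (density K (\<lambda>_. ennreal (1 / m)))"
      if "finite_measure K" "sets K = sets borel" "measure K UNIV = m" for K :: "real measure"
    proof -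
      have "space K = UNIV" using sets_eq_imp_space_eq[OF that(2)] by simp
      then have "emeasure (density K (\<lambda>_. ennreal (1 / m))) UNIV = 1"
        using that(2,3) \<open>0 < m\<close> by (simp add: emeasure_density_const finite_measure.emeasure_eq_measure[OF that(1)]
            flip: ennreal_mult)
      then show ?thesis
        using that(2) \<open>space K = UNIV\<close> by (auto simp: real_distribution_def real_distribution_axioms_def intro!: prob_spaceI)
    qed
    have "density \<mu> (\<lambda>_. ennreal (1 / m)) = density \<nu> (\<lambda>_. ennreal (1 / m))"
    proof (rule Levy_uniqueness)
      have char: "char (density K (\<lambda>_. ennreal (1 / m))) t = (\<integral>x. iexp (t \<bullet> x) \<partial>K) / m"
        if [measurable_cong]: "sets K = sets borel" for K :: "real measure" and t
        unfolding char_def using \<open>0 < m\<close> by (subst integral_density) (auto simp: scaleR_conv_of_real)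
      show "char (density \<mu> (\<lambda>_. ennreal (1 / m))) = char (density \<nu> (\<lambda>_. ennreal (1 / m)))"
        using eq by (intro ext) (simp only: char[OF sets(1)] char[OF sets(2)])
    qed (use dist fin sets m in \<open>auto simp: m_def\<close>)
    then have "ennreal (1 / m) * emeasure \<mu> A = ennreal (1 / m) * emeasure \<nu> A" if "A \<in> sets borel" for A
      using emeasure_density_const[of A \<mu>] emeasure_density_const[of A \<nu>] sets that by metis
    then show ?thesis
      using sets \<open>0 < m\<close> by (intro measure_eqI) (auto simp: ennreal_mult_cancel_left)
  qed
qed

text \<open>Boxes are stable under intersection and generate the Borel sets, and the measure of a
  box is a joint law of the real coordinates.\<close>

lemma char_determining_euclidean: "char_determining TYPE('c::euclidean_space)"
  unfolding char_determining_def
proof safe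
  fix \<mu> \<nu> :: "'c measure"
  assume fin: "finite_measure \<mu>" "finite_measure \<nu>" and sets [measurable_cong]: "sets \<mu> = sets borel" "sets \<nu> = sets borel"
    and eq: "\<forall>w. (\<integral>x. iexp (w \<bullet> x) \<partial>\<mu>) = (\<integral>x. iexp (w \<bullet> x) \<partial>\<nu>)"
  have space: "space \<mu> = UNIV" "space \<nu> = UNIV" using sets_eq_imp_space_eq[OF sets(1)] sets_eq_imp_space_eq[OF sets(2)] by simp_all
  let ?E = "range (\<lambda>(a, b). box a b :: 'c set)"
  show "\<mu> = \<nu>"
  proof (rule measure_eqI_generator_eq)
    show "Int_stable ?E" by (auto simp: Int_stable_def box_Int_box)
    show "?E \<subseteq> Pow UNIV" "sets \<mu> = sigma_sets UNIV ?E" "sets \<nu> = sigma_sets UNIV ?E"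
      by (simp_all add: borel_eq_box sets)
    let ?A = "\<lambda>n::nat. box (- (real n *\<^sub>R One)) (real n *\<^sub>R One) :: 'c set"
    show "range ?A \<subseteq> ?E" "(\<Union>i. ?A i) = UNIV"
      unfolding UN_box_eq_UNIV by auto
    show "emeasure \<mu> (?A i) \<noteq> \<infinity>" for i using finite_measure.emeasure_finite[OF fin(1)] by simp
    fix B assume "B \<in> ?E"
    then obtain a b where B: "B = box a b" by auto
    have "emeasure \<mu> {x \<in> space \<mu>. \<forall>j\<in>Basis. x \<bullet> j \<in> {a \<bullet> j<..<b \<bullet> j}} =
        emeasure \<nu> {x \<in> space \<nu>. \<forall>j\<in>Basis. x \<bullet> j \<in> {a \<bullet> j<..<b \<bullet> j}}"
    proof (rule joint_law_eqI[OF char_determining_real finite_Basis fin])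
      fix c :: "'c \<Rightarrow> real"
      have "(\<Sum>j\<in>Basis. c j \<bullet> (x \<bullet> j)) = (\<Sum>j\<in>Basis. c j *\<^sub>R j) \<bullet> x" for x
        by (simp add: inner_sum_left inner_commute[of x])
      then show "(\<integral>x. iexp (\<Sum>j\<in>Basis. c j \<bullet> (x \<bullet> j)) \<partial>\<mu>) = (\<integral>x. iexp (\<Sum>j\<in>Basis. c j \<bullet> (x \<bullet> j)) \<partial>\<nu>)"
        using eq by simp
    qed (auto simp: measurable_cong_sets[OF sets(1) refl] measurable_cong_sets[OF sets(2) refl])
    moreover have "{x \<in> space K. \<forall>j\<in>Basis. x \<bullet> j \<in> {a \<bullet> j<..<b \<bullet> j}} = B" if "space K = UNIV" for K :: "'c measure"
      unfolding B that by (auto simp: box_def)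
    ultimately show "emeasure \<mu> B = emeasure \<nu> B" using space by simp
  qed
qed

section \<open>The standard complex Gaussian law\<close>

definition std_complex_gaussian :: "complex measure"
  where "std_complex_gaussian = density lborel (\<lambda>z. ennreal (std_complex_gaussian_density z))"

text \<open>The law of the real part of a standard complex Gaussian, a centered normal law of
  variance 1/2; it is not the law of an absolute value.\<close>

definition half_normal :: "real measure"
  where "half_normal = density lborel (normal_density 0 (1 / sqrt 2))"

lemma borel_measurable_std_complex_gaussian_density [measurable]:
  "std_complex_gaussian_density \<in> borel_measurable borel"
  unfolding std_complex_gaussian_density_def[abs_def] by measurable

lemma sets_std_complex_gaussian [simp, measurable_cong]: "sets std_complex_gaussian = sets borel"
  and space_std_complex_gaussian [simp]: "space std_complex_gaussian = UNIV"
  by (simp_all add: std_complex_gaussian_def)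

lemma borel_measurable_Complex [measurable]: "(\<lambda>z. Complex (fst z) (snd z)) \<in> borel_measurable (borel \<Otimes>\<^sub>M borel)"
  unfolding Complex_eq by measurable

lemma lborel_complex: "(lborel :: complex measure) = distr (lborel \<Otimes>\<^sub>M lborel) borel (\<lambda>z. Complex (fst z) (snd z))"
proof (rule lborel_eqI)
  fix l u :: complex assume le: "\<And>b. b \<in> Basis \<Longrightarrow> l \<bullet> b \<le> u \<bullet> b"
  have "(\<lambda>z. Complex (fst z) (snd z)) -` box l u \<inter> space (lborel \<Otimes>\<^sub>M lborel) = {Re l<..<Re u} \<times> {Im l<..<Im u}"
    by (auto simp: box_def Basis_complex_def space_pair_measure)
  then have "emeasure (distr (lborel \<Otimes>\<^sub>M lborel) borel (\<lambda>z. Complex (fst z) (snd z))) (box l u) =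
      ennreal (Re u - Re l) * ennreal (Im u - Im l)"
    using le[of 1] le[of \<i>]
    by (subst emeasure_distr) (auto simp: Basis_complex_def lborel.emeasure_pair_measure_Times)
  also have "\<dots> = ennreal (\<Prod>b\<in>Basis. (u - l) \<bullet> b)"
    using le[of 1] le[of \<i>] by (simp add: Basis_complex_def ennreal_mult complex_i_not_one[symmetric] del: complex_i_not_one)
  finally show "emeasure (distr (lborel \<Otimes>\<^sub>M lborel) borel (\<lambda>z. Complex (fst z) (snd z))) (box l u) =
      (\<Prod>b\<in>Basis. (u - l) \<bullet> b)" .
qed simp

lemma prob_space_half_normal: "prob_space half_normal"
  unfolding half_normal_def by (rule prob_space_normal_density) simp

lemma sets_half_normal [simp, measurable_cong]: "sets half_normal = sets borel"
  and space_half_normal [simp]: "space half_normal = UNIV"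
  by (simp_all add: half_normal_def)

lemma std_complex_gaussian_eq_distr:
  "std_complex_gaussian = distr (half_normal \<Otimes>\<^sub>M half_normal) borel (\<lambda>z. Complex (fst z) (snd z))"
proof -
  have dens: "ennreal (std_complex_gaussian_density (Complex x y)) =
      ennreal (normal_density 0 (1 / sqrt 2) x) * ennreal (normal_density 0 (1 / sqrt 2) y)" for x y
    by (simp add: std_complex_gaussian_density_def normal_density_def cmod_def power_divide
        exp_add[symmetric] flip: ennreal_mult)
  have "half_normal \<Otimes>\<^sub>M half_normal = density (lborel \<Otimes>\<^sub>M lborel)
      (\<lambda>(x, y). ennreal (normal_density 0 (1 / sqrt 2) x) * ennreal (normal_density 0 (1 / sqrt 2) y))"
    unfolding half_normal_def
    by (rule pair_measure_density)
      (auto intro!: prob_space_imp_sigma_finite prob_space_half_normal[unfolded half_normal_def] lborel.sigma_finite_measure_axioms)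
  also have "\<dots> = density (lborel \<Otimes>\<^sub>M lborel) (\<lambda>z. ennreal (std_complex_gaussian_density (Complex (fst z) (snd z))))"
    by (simp add: dens split_beta')
  finally have "distr (half_normal \<Otimes>\<^sub>M half_normal) borel (\<lambda>z. Complex (fst z) (snd z)) =
    density (distr (lborel \<Otimes>\<^sub>M lborel) borel (\<lambda>z. Complex (fst z) (snd z))) (\<lambda>z. ennreal (std_complex_gaussian_density z))"
    by (subst density_distr) auto
  then show ?thesis by (simp add: std_complex_gaussian_def lborel_complex[symmetric])
qed

lemma prob_space_std_complex_gaussian: "prob_space std_complex_gaussian"
proof -
  interpret prob_space half_normal by (rule prob_space_half_normal)
  interpret P: pair_prob_space half_normal half_normal ..
  show ?thesis unfolding std_complex_gaussian_eq_distr by (rule P.prob_space_distr) measurable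
qed

lemma char_half_normal: "(\<integral>x. iexp (t * x) \<partial>half_normal) = complex_of_real (exp (- t\<^sup>2 / 4))"
proof -
  let ?c = "1 / sqrt 2 :: real"
  have "(\<integral>x. iexp (t * x) \<partial>half_normal) = (\<integral>x. normal_density 0 ?c x *\<^sub>R iexp (t * x) \<partial>lborel)"
    unfolding half_normal_def by (subst integral_density) auto
  also have "\<dots> = \<bar>?c\<bar> *\<^sub>R (\<integral>x. normal_density 0 ?c (0 + ?c * x) *\<^sub>R iexp (t * (0 + ?c * x)) \<partial>lborel)"
    by (rule lborel_integral_real_affine) simp
  also have "\<dots> = (\<integral>x. \<bar>?c\<bar> *\<^sub>R (normal_density 0 ?c (0 + ?c * x) *\<^sub>R iexp (t * (0 + ?c * x))) \<partial>lborel)"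
    by (rule integral_scaleR_right[symmetric])
  also have "\<dots> = (\<integral>x. std_normal_density x *\<^sub>R iexp ((t / sqrt 2) * x) \<partial>lborel)"
    by (intro Bochner_Integration.integral_cong refl)
      (simp add: normal_density_def power_divide real_sqrt_mult field_simps)
  also have "\<dots> = char std_normal_distribution (t / sqrt 2)"
    unfolding char_def by (subst integral_density) auto
  also have "\<dots> = complex_of_real (exp (- t\<^sup>2 / 4))"
    by (simp add: char_std_normal_distribution power_divide)
  finally show ?thesis .
qed

lemma char_std_complex_gaussian:
  "(\<integral>g. iexp (Re (w * g)) \<partial>std_complex_gaussian) = complex_of_real (exp (- (cmod w)\<^sup>2 / 4))"
proof -
  interpret prob_space half_normal by (rule prob_space_half_normal)
  interpret P: pair_prob_space half_normal half_normal ..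
  have "(\<integral>g. iexp (Re (w * g)) \<partial>std_complex_gaussian) =
      (\<integral>z. iexp (Re w * fst z) * iexp (- Im w * snd z) \<partial>(half_normal \<Otimes>\<^sub>M half_normal))"
    unfolding std_complex_gaussian_eq_distr
    by (subst integral_distr) (simp_all add: exp_add[symmetric] algebra_simps)
  also have "\<dots> = (\<integral>x. \<integral>y. iexp (Re w * fst (x, y)) * iexp (- Im w * snd (x, y)) \<partial>half_normal \<partial>half_normal)"
    by (rule P.integral_fst'[symmetric]) (rule P.P.integrable_const_bound[of _ 1]; simp add: norm_mult)
  also have "\<dots> = complex_of_real (exp (- (Re w)\<^sup>2 / 4)) * complex_of_real (exp (- (Im w)\<^sup>2 / 4))"
    using char_half_normal[of "Re w"] char_half_normal[of "- Im w"] by simp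
  also have "\<dots> = complex_of_real (exp (- (cmod w)\<^sup>2 / 4))"
    by (simp only: of_real_mult[symmetric] exp_add[symmetric] cmod_power2) (simp add: field_simps)
  finally show ?thesis .
qed

lemma half_normal_square:
  "integrable half_normal (\<lambda>x. x\<^sup>2)" "(\<integral>x. x\<^sup>2 \<partial>half_normal) = 1 / 2"
proof -
  have "has_bochner_integral lborel (\<lambda>x. normal_density 0 (1 / sqrt 2) x * x\<^sup>2) (1 / 2)"
    using normal_moment_even[of "1 / sqrt 2" 0 1] by (simp add: power_divide)
  then have "has_bochner_integral half_normal (\<lambda>x. x\<^sup>2) (1 / 2)"
    unfolding half_normal_def by (intro has_bochner_integral_density) auto
  then show "integrable half_normal (\<lambda>x. x\<^sup>2)" "(\<integral>x. x\<^sup>2 \<partial>half_normal) = 1 / 2"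
    by (auto simp: has_bochner_integral_iff)
qed

lemma std_complex_gaussian_square:
  "integrable std_complex_gaussian (\<lambda>g. (cmod g)\<^sup>2)" "(\<integral>g. (cmod g)\<^sup>2 \<partial>std_complex_gaussian) = 1"
proof -
  interpret prob_space half_normal by (rule prob_space_half_normal)
  interpret P: pair_prob_space half_normal half_normal ..
  let ?P = "half_normal \<Otimes>\<^sub>M half_normal"
  have snd: "distr ?P half_normal snd = half_normal"
  proof (rule measure_eqI)
    fix A assume A: "A \<in> sets (distr ?P half_normal snd)"
    then have "emeasure (distr ?P half_normal snd) A = emeasure ?P (space half_normal \<times> A)"
      by (subst emeasure_distr) (auto intro!: arg_cong2[where f=emeasure] simp: space_pair_measure)
    with A show "emeasure (distr ?P half_normal snd) A = emeasure half_normal A"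
      by (simp add: emeasure_pair_measure_Times emeasure_space_1[simplified])
  qed simp
  have 1: "integrable ?P (\<lambda>z. (fst z)\<^sup>2)" "(\<integral>z. (fst z)\<^sup>2 \<partial>?P) = 1 / 2"
    using half_normal_square integrable_distr_eq[of fst ?P half_normal "\<lambda>x. x\<^sup>2"] integral_distr[of fst ?P half_normal "\<lambda>x. x\<^sup>2"]
    by (simp_all add: distr_pair_fst)
  have 2: "integrable ?P (\<lambda>z. (snd z)\<^sup>2)" "(\<integral>z. (snd z)\<^sup>2 \<partial>?P) = 1 / 2"
    using half_normal_square integrable_distr_eq[of snd ?P half_normal "\<lambda>x. x\<^sup>2"] integral_distr[of snd ?P half_normal "\<lambda>x. x\<^sup>2"]
    by (simp_all add: snd)
  show "integrable std_complex_gaussian (\<lambda>g. (cmod g)\<^sup>2)"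
    unfolding std_complex_gaussian_eq_distr using 1 2 by (subst integrable_distr_eq) (simp_all add: cmod_power2)
  show "(\<integral>g. (cmod g)\<^sup>2 \<partial>std_complex_gaussian) = 1"
    unfolding std_complex_gaussian_eq_distr using 1 2 by (subst integral_distr) (simp_all add: cmod_power2)
qed

text \<open>The second moment is \<sigma>^2 and hence determines the law. The real part carries half
  of it as its variance, whence the 1/4 in the exponent.\<close>

lemma
  assumes "centered_complex_gaussian M Z"
  shows centered_complex_gaussian_square: "integrable M (\<lambda>\<omega>. (cmod (Z \<omega>))\<^sup>2)"
    and centered_complex_gaussian_char:
      "(\<integral>\<omega>. iexp (Re (Z \<omega>)) \<partial>M) = complex_of_real (exp (- (\<integral>\<omega>. (cmod (Z \<omega>))\<^sup>2 \<partial>M) / 4))"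
    and centered_complex_gaussian_nonzero: "(\<integral>\<omega>. (cmod (Z \<omega>))\<^sup>2 \<partial>M) \<noteq> 0 \<Longrightarrow> AE \<omega> in M. Z \<omega> \<noteq> 0"
proof -
  obtain \<sigma> where \<sigma>: "\<sigma> \<ge> 0" "distr M borel Z = distr std_complex_gaussian borel (\<lambda>g. complex_of_real \<sigma> * g)"
    and [measurable]: "Z \<in> borel_measurable M"
    using assms by (auto simp: centered_complex_gaussian_def std_complex_gaussian_def)
  have "integrable (distr M borel Z) (\<lambda>z. (cmod z)\<^sup>2)"
    unfolding \<sigma>(2) using std_complex_gaussian_square by (subst integrable_distr_eq) (simp_all add: norm_mult power_mult_distrib)
  then show "integrable M (\<lambda>\<omega>. (cmod (Z \<omega>))\<^sup>2)" by (subst (asm) integrable_distr_eq) simp_all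
  have "(\<integral>\<omega>. (cmod (Z \<omega>))\<^sup>2 \<partial>M) = (\<integral>z. (cmod z)\<^sup>2 \<partial>distr M borel Z)"
    by (subst integral_distr) simp_all
  also have "\<dots> = \<sigma>\<^sup>2"
    unfolding \<sigma>(2) using std_complex_gaussian_square by (subst integral_distr) (simp_all add: norm_mult power_mult_distrib)
  finally have sq: "(\<integral>\<omega>. (cmod (Z \<omega>))\<^sup>2 \<partial>M) = \<sigma>\<^sup>2" .
  have "(\<integral>\<omega>. iexp (Re (Z \<omega>)) \<partial>M) = (\<integral>z. iexp (Re z) \<partial>distr M borel Z)"
    by (subst integral_distr) simp_all
  also have "\<dots> = (\<integral>g. iexp (Re (complex_of_real \<sigma> * g)) \<partial>std_complex_gaussian)"
    unfolding \<sigma>(2) by (subst integral_distr) simp_all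
  also have "\<dots> = complex_of_real (exp (- \<sigma>\<^sup>2 / 4))"
    by (subst char_std_complex_gaussian) simp
  finally show "(\<integral>\<omega>. iexp (Re (Z \<omega>)) \<partial>M) = complex_of_real (exp (- (\<integral>\<omega>. (cmod (Z \<omega>))\<^sup>2 \<partial>M) / 4))"
    by (simp add: sq)
  assume "(\<integral>\<omega>. (cmod (Z \<omega>))\<^sup>2 \<partial>M) \<noteq> 0"
  then have "\<sigma> \<noteq> 0" by (simp add: sq)
  have "AE z in lborel. z \<noteq> (0 :: complex)" by (rule AE_lborel_singleton)
  then have "AE g in std_complex_gaussian. complex_of_real \<sigma> * g \<noteq> 0"
    using \<open>\<sigma> \<noteq> 0\<close> unfolding std_complex_gaussian_def by (subst AE_density) auto
  then have "AE z in distr M borel Z. z \<noteq> 0"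
    unfolding \<sigma>(2) by (subst AE_distr_iff) auto
  then show "AE \<omega> in M. Z \<omega> \<noteq> 0" by (subst (asm) AE_distr_iff) auto
qed

text \<open>Complex w cover all real directions of the plane, because the inner product of w and z
  is Re (cnj w * z).\<close>

lemma centered_complex_gaussianI:
  assumes "prob_space M" and [measurable]: "Z \<in> borel_measurable M" and "0 \<le> v"
    and char: "\<And>w. (\<integral>\<omega>. iexp (Re (w * Z \<omega>)) \<partial>M) = complex_of_real (exp (- (cmod w)\<^sup>2 * v / 4))"
  shows "centered_complex_gaussian M Z"
proof -
  interpret prob_space M by fact
  interpret G: prob_space std_complex_gaussian by (rule prob_space_std_complex_gaussian)
  have inner: "w \<bullet> z = Re (cnj w * z)" for w z :: complex by (simp add: inner_complex_def)
  have "distr M borel Z = distr std_complex_gaussian borel (\<lambda>g. complex_of_real (sqrt v) * g)"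
  proof (rule char_determining_euclidean[where 'c = complex, unfolded char_determining_def, rule_format])
    fix w :: complex
    have "(\<integral>x. iexp (w \<bullet> x) \<partial>distr M borel Z) = (\<integral>\<omega>. iexp (Re (cnj w * Z \<omega>)) \<partial>M)"
      unfolding inner by (subst integral_distr) simp_all
    also have "\<dots> = (\<integral>g. iexp (Re (cnj w * complex_of_real (sqrt v) * g)) \<partial>std_complex_gaussian)"
      unfolding char_std_complex_gaussian char using \<open>0 \<le> v\<close> by (simp add: norm_mult power_mult_distrib)
    also have "\<dots> = (\<integral>x. iexp (w \<bullet> x) \<partial>distr std_complex_gaussian borel (\<lambda>g. complex_of_real (sqrt v) * g))"
      unfolding inner by (subst integral_distr) (simp_all add: mult.assoc)
    finally show "(\<integral>x. iexp (w \<bullet> x) \<partial>distr M borel Z) = \<dots>" .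
  qed (auto intro!: prob_space.finite_measure prob_space_distr G.prob_space_distr)
  then show ?thesis
    unfolding centered_complex_gaussian_def std_complex_gaussian_def[symmetric]
    using \<open>0 \<le> v\<close> by (auto intro!: exI[of _ "sqrt v"])
qed

section \<open>Gaussian series\<close>

lemma
  assumes "iid_std_complex_gaussian M \<zeta>"
  shows iid_prob_space: "prob_space M"
    and iid_measurable: "\<zeta> n \<in> borel_measurable M"
    and iid_distr: "distr M borel (\<zeta> n) = std_complex_gaussian"
    and iid_indep: "prob_space.indep_vars M (\<lambda>_. borel) \<zeta> UNIV"
proof -
  have "distributed M lborel (\<zeta> n) (\<lambda>z. ennreal (std_complex_gaussian_density z))"
    using assms by (auto simp: iid_std_complex_gaussian_def)
  then have "distr M lborel (\<zeta> n) = std_complex_gaussian" "\<zeta> n \<in> measurable M lborel"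
    by (auto simp: distributed_def std_complex_gaussian_def)
  moreover have "distr M borel (\<zeta> n) = distr M lborel (\<zeta> n)" by (rule distr_cong) simp_all
  ultimately show "\<zeta> n \<in> borel_measurable M" "distr M borel (\<zeta> n) = std_complex_gaussian"
    by simp_all
qed (use assms in \<open>auto simp: iid_std_complex_gaussian_def\<close>)

lemma iid_char:
  assumes "iid_std_complex_gaussian M \<zeta>"
  shows "(\<integral>\<omega>. iexp (Re (w * \<zeta> n \<omega>)) \<partial>M) = complex_of_real (exp (- (cmod w)\<^sup>2 / 4))"
  using char_std_complex_gaussian[of w] iid_measurable[OF assms, of n]
  by (simp add: iid_distr[OF assms, of n, symmetric] integral_distr)

lemma iid_char_sum:
  assumes iid: "iid_std_complex_gaussian M \<zeta>" and "finite F"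
  shows "(\<integral>\<omega>. iexp (Re (\<Sum>n\<in>F. a n * \<zeta> n \<omega>)) \<partial>M) = complex_of_real (exp (- (\<Sum>n\<in>F. (cmod (a n))\<^sup>2) / 4))"
proof -
  interpret prob_space M using iid by (rule iid_prob_space)
  have ind: "indep_vars (\<lambda>_. borel) (\<lambda>n \<omega>. iexp (Re (a n * \<zeta> n \<omega>))) F"
    using indep_vars_compose2[OF indep_vars_subset[OF iid_indep[OF iid], of F], of "\<lambda>n z. iexp (Re (a n * z))" "\<lambda>_. borel"]
    by simp
  have "(\<integral>\<omega>. iexp (Re (\<Sum>n\<in>F. a n * \<zeta> n \<omega>)) \<partial>M) = (\<integral>\<omega>. (\<Prod>n\<in>F. iexp (Re (a n * \<zeta> n \<omega>))) \<partial>M)"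
    using \<open>finite F\<close> by (simp only: Re_sum of_real_sum sum_distrib_left exp_sum)
  also have "\<dots> = (\<Prod>n\<in>F. \<integral>\<omega>. iexp (Re (a n * \<zeta> n \<omega>)) \<partial>M)"
  proof (rule indep_vars_lebesgue_integral[OF \<open>finite F\<close> ind])
    note [measurable] = iid_measurable[OF iid]
    fix n show "integrable M (\<lambda>\<omega>. iexp (Re (a n * \<zeta> n \<omega>)))"
      by (rule finite_measure_integrable_iexp[OF finite_measure_axioms]) measurable
  qed
  also have "\<dots> = (\<Prod>n\<in>F. complex_of_real (exp (- (cmod (a n))\<^sup>2 / 4)))"
    by (simp only: iid_char[OF iid])
  also have "\<dots> = complex_of_real (exp (\<Sum>n\<in>F. - (cmod (a n))\<^sup>2 / 4))"
    using \<open>finite F\<close> by (simp only: of_real_prod[symmetric] exp_sum)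
  finally show ?thesis by (simp add: sum_negf sum_divide_distrib)
qed

lemma filterlim_int_intervals: "filterlim (\<lambda>N. {- int N..int N}) (finite_subsets_at_top UNIV) sequentially"
proof (rule filterlim_finite_subsets_at_top[THEN iffD2], safe)
  fix X :: "int set" assume "finite X"
  define N where "N = Max (abs ` insert 0 X)"
  have N: "\<bar>x\<bar> \<le> N" if "x \<in> X" for x
    unfolding N_def using \<open>finite X\<close> that by (intro Max_ge) auto
  show "\<forall>\<^sub>F n in sequentially. finite {- int n..int n} \<and> X \<subseteq> {- int n..int n} \<and> {- int n..int n} \<subseteq> UNIV"
    using eventually_ge_at_top[of "nat N"] by eventually_elim (use N in fastforce)
qed

text \<open>The characteristic functions of partial sums are explicit and their integrands have
  modulus 1, so dominated convergence carries the formula to the limit. The unordered sums are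
  followed along the intervals from - N to N because dominated convergence needs a sequence.\<close>

lemma gaussian_series_char:
  fixes \<zeta> :: "int \<Rightarrow> 'a \<Rightarrow> complex"
  assumes iid: "iid_std_complex_gaussian M \<zeta>" and [measurable]: "Z \<in> borel_measurable M"
    and Z: "AE \<omega> in M. ((\<lambda>n. a n * \<zeta> n \<omega>) has_sum Z \<omega>) UNIV"
    and v: "((\<lambda>n. (cmod (a n))\<^sup>2) has_sum v) UNIV"
  shows "(\<integral>\<omega>. iexp (Re (w * Z \<omega>)) \<partial>M) = complex_of_real (exp (- (cmod w)\<^sup>2 * v / 4))"
proof -
  interpret prob_space M using iid by (rule iid_prob_space)
  note [measurable] = iid_measurable[OF iid]
  let ?I = "\<lambda>N. {- int N..int N}"
  let ?S = "\<lambda>N \<omega>. \<Sum>n\<in>?I N. w * a n * \<zeta> n \<omega>"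
  have "(\<lambda>N. \<integral>\<omega>. iexp (Re (?S N \<omega>)) \<partial>M) \<longlonglongrightarrow> (\<integral>\<omega>. iexp (Re (w * Z \<omega>)) \<partial>M)"
  proof (rule integral_dominated_convergence[where w = "\<lambda>_. 1"])
    show "AE \<omega> in M. (\<lambda>N. iexp (Re (?S N \<omega>))) \<longlonglongrightarrow> iexp (Re (w * Z \<omega>))"
      using Z
    proof eventually_elim
      case (elim \<omega>)
      then have "((\<lambda>n. w * (a n * \<zeta> n \<omega>)) has_sum (w * Z \<omega>)) UNIV" by (rule has_sum_cmult_right)
      then have "(\<lambda>N. ?S N \<omega>) \<longlonglongrightarrow> w * Z \<omega>"
        unfolding has_sum_def mult.assoc using filterlim_compose filterlim_int_intervals by blast
      then show ?case by (intro tendsto_intros)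
    qed
  qed auto
  moreover have "(\<lambda>N. complex_of_real (exp (- (\<Sum>n\<in>?I N. (cmod (w * a n))\<^sup>2) / 4))) \<longlonglongrightarrow>
      complex_of_real (exp (- ((cmod w)\<^sup>2 * v) / 4))"
  proof -
    have "((\<lambda>n. (cmod w)\<^sup>2 * (cmod (a n))\<^sup>2) has_sum ((cmod w)\<^sup>2 * v)) UNIV" using v by (rule has_sum_cmult_right)
    then have "(\<lambda>N. \<Sum>n\<in>?I N. (cmod (w * a n))\<^sup>2) \<longlonglongrightarrow> (cmod w)\<^sup>2 * v"
      unfolding has_sum_def norm_mult power_mult_distrib using filterlim_compose filterlim_int_intervals by blast
    then show ?thesis by (intro tendsto_intros)  auto
  qed
  ultimately show ?thesis
    unfolding iid_char_sum[OF iid finite_atLeastAtMost_int] using LIMSEQ_unique by fastforce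
qed

section \<open>Gaussian processes are determined by their covariance\<close>

text \<open>For a covariance kernel k this is the second moment of the linear combination with
  coefficients c, see \<open>process_second_moment\<close>.\<close>

definition quadratic_form :: "('t \<Rightarrow> 't \<Rightarrow> complex) \<Rightarrow> 't set \<Rightarrow> ('t \<Rightarrow> complex) \<Rightarrow> complex"
  where "quadratic_form k F c = (\<Sum>t\<in>F. \<Sum>u\<in>F. c t * cnj (c u) * k t u)"

lemma quadratic_form_sum:
  "quadratic_form (\<lambda>t u. f t * cnj (f u)) F c = complex_of_real ((cmod (\<Sum>t\<in>F. c t * f t))\<^sup>2)"
  unfolding complex_norm_square quadratic_form_def cnj_sum sum_product by (simp add: mult_ac)

lemma
  assumes "centered_complex_gaussian_process M T k Y"
  shows process_prob_space: "prob_space M"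
    and process_gaussian: "finite F \<Longrightarrow> F \<subseteq> T \<Longrightarrow> centered_complex_gaussian M (\<lambda>\<omega>. \<Sum>t\<in>F. c t * Y t \<omega>)"
    and process_covariance: "t \<in> T \<Longrightarrow> u \<in> T \<Longrightarrow> integral\<^sup>L M (\<lambda>\<omega>. Y t \<omega> * cnj (Y u \<omega>)) = k t u"
  using assms by (auto simp: centered_complex_gaussian_process_def)

lemma process_gaussian_single:
  assumes "centered_complex_gaussian_process M T k Y" "t \<in> T"
  shows "centered_complex_gaussian M (Y t)"
  using process_gaussian[OF assms(1), of "{t}" "\<lambda>_. 1"] assms(2) by simp

lemma process_measurable:
  assumes "centered_complex_gaussian_process M T k Y" "t \<in> T"
  shows "Y t \<in> borel_measurable M"
  using process_gaussian_single[OF assms] by (simp add: centered_complex_gaussian_def)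

lemma borel_measurable_cnj [measurable]: "cnj \<in> borel_measurable borel"
  by (intro borel_measurable_continuous_onI continuous_intros)

lemma integrable_mult_cnj:
  assumes [measurable]: "X \<in> borel_measurable M" "Y \<in> borel_measurable M"
    and "integrable M (\<lambda>\<omega>. (cmod (X \<omega>))\<^sup>2)" "integrable M (\<lambda>\<omega>. (cmod (Y \<omega>))\<^sup>2)"
  shows "integrable M (\<lambda>\<omega>. X \<omega> * cnj (Y \<omega>))"
proof (rule Bochner_Integration.integrable_bound)
  show "integrable M (\<lambda>\<omega>. (cmod (X \<omega>))\<^sup>2 + (cmod (Y \<omega>))\<^sup>2)" using assms by simp
  have "x * y \<le> x\<^sup>2 + y\<^sup>2" if "0 \<le> x" "0 \<le> y" for x y :: real
    using sum_squares_bound[of x y] mult_nonneg_nonneg[OF that] by linarith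
  then show "AE \<omega> in M. norm (X \<omega> * cnj (Y \<omega>)) \<le> norm ((cmod (X \<omega>))\<^sup>2 + (cmod (Y \<omega>))\<^sup>2)"
    by (simp add: norm_mult)
qed measurable

lemma process_second_moment:
  assumes Y: "centered_complex_gaussian_process M T k Y" and F: "finite F" "F \<subseteq> T"
  shows "complex_of_real (\<integral>\<omega>. (cmod (\<Sum>t\<in>F. c t * Y t \<omega>))\<^sup>2 \<partial>M) = quadratic_form k F c"
proof -
  have int: "integrable M (\<lambda>\<omega>. Y t \<omega> * cnj (Y u \<omega>))" if "t \<in> F" "u \<in> F" for t u
    using that F process_gaussian_single[OF Y] process_measurable[OF Y]
    by (intro integrable_mult_cnj centered_complex_gaussian_square) auto
  have "complex_of_real (\<integral>\<omega>. (cmod (\<Sum>t\<in>F. c t * Y t \<omega>))\<^sup>2 \<partial>M) =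
      (\<integral>\<omega>. complex_of_real ((cmod (\<Sum>t\<in>F. c t * Y t \<omega>))\<^sup>2) \<partial>M)"
    by (rule integral_complex_of_real[symmetric])
  also have "\<dots> = (\<integral>\<omega>. (\<Sum>t\<in>F. \<Sum>u\<in>F. c t * cnj (c u) * (Y t \<omega> * cnj (Y u \<omega>))) \<partial>M)"
    by (simp only: quadratic_form_sum[symmetric] quadratic_form_def)
  also have "\<dots> = (\<Sum>t\<in>F. \<Sum>u\<in>F. c t * cnj (c u) * (\<integral>\<omega>. Y t \<omega> * cnj (Y u \<omega>) \<partial>M))"
    using int by simp
  also have "\<dots> = quadratic_form k F c"
    unfolding quadratic_form_def using F by (intro sum.cong refl) (simp add: process_covariance[OF Y] subset_iff)
  finally show ?thesis .
qed

lemma process_char: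
  assumes Y: "centered_complex_gaussian_process M T k Y" and F: "finite F" "F \<subseteq> T"
  shows "(\<integral>\<omega>. iexp (Re (\<Sum>t\<in>F. c t * Y t \<omega>)) \<partial>M) = complex_of_real (exp (- Re (quadratic_form k F c) / 4))"
  using centered_complex_gaussian_char[OF process_gaussian[OF Y F]]
  by (simp add: process_second_moment[OF Y F, symmetric])

text \<open>Finite-dimensional cylinders generate the product sigma-algebra. On each of them
  \<open>joint_law_eqI\<close> asks only for characteristic functions of real linear combinations;
  these are real parts of complex combinations, which k determines.\<close>

lemma equal_in_law_gaussian:
  fixes X :: "'t \<Rightarrow> 'a \<Rightarrow> complex" and Y :: "'t \<Rightarrow> 'b \<Rightarrow> complex"
  assumes X: "centered_complex_gaussian_process M T k X" and Y: "centered_complex_gaussian_process N T k Y"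
  shows "equal_in_law T N Y M X"
proof -
  interpret M: prob_space M using X by (rule process_prob_space)
  interpret N: prob_space N using Y by (rule process_prob_space)
  note mX [measurable] = process_measurable[OF X]
  note mY [measurable] = process_measurable[OF Y]
  have [measurable]: "(\<lambda>\<omega>. \<lambda>t\<in>T. X t \<omega>) \<in> M \<rightarrow>\<^sub>M Pi\<^sub>M T (\<lambda>_. borel)" "(\<lambda>\<omega>. \<lambda>t\<in>T. Y t \<omega>) \<in> N \<rightarrow>\<^sub>M Pi\<^sub>M T (\<lambda>_. borel)"
    by (auto intro!: measurable_restrict)
  have "distr N (Pi\<^sub>M T (\<lambda>_. borel)) (\<lambda>\<omega>. \<lambda>t\<in>T. Y t \<omega>) = distr M (Pi\<^sub>M T (\<lambda>_. borel)) (\<lambda>\<omega>. \<lambda>t\<in>T. X t \<omega>)"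
  proof (rule measure_eqI_PiM_infinite)
    fix A :: "'t \<Rightarrow> complex set" and J assume J: "finite J" "J \<subseteq> T" and A: "\<And>i. i \<in> J \<Longrightarrow> A i \<in> sets borel"
    have [measurable]: "prod_emb T (\<lambda>_. borel) J (Pi\<^sub>E J A) \<in> sets (Pi\<^sub>M T (\<lambda>_. borel :: complex measure))"
      using J A by (intro sets_PiM_I) auto
    have emb: "(\<lambda>\<omega>. \<lambda>t\<in>T. Z t \<omega>) -` prod_emb T (\<lambda>_. borel) J (Pi\<^sub>E J A) \<inter> space K = {\<omega> \<in> space K. \<forall>j\<in>J. Z j \<omega> \<in> A j}"
      for Z :: "'t \<Rightarrow> 'k \<Rightarrow> complex" and K
      using J by (auto simp: prod_emb_def space_PiM subset_iff PiE_iff Pi_iff)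
    have "emeasure N {\<omega> \<in> space N. \<forall>j\<in>J. Y j \<omega> \<in> A j} = emeasure M {\<omega> \<in> space M. \<forall>j\<in>J. X j \<omega> \<in> A j}"
    proof (rule joint_law_eqI[OF char_determining_euclidean \<open>finite J\<close>])
      fix c :: "'t \<Rightarrow> complex"
      have "(\<Sum>j\<in>J. c j \<bullet> z j) = Re (\<Sum>j\<in>J. cnj (c j) * z j)" for z
        by (simp add: inner_complex_def)
      then show "(\<integral>\<omega>. iexp (\<Sum>j\<in>J. c j \<bullet> Y j \<omega>) \<partial>N) = (\<integral>\<omega>. iexp (\<Sum>j\<in>J. c j \<bullet> X j \<omega>) \<partial>M)"
        by (simp only: process_char[OF X J] process_char[OF Y J])
    qed (use J A mX mY in \<open>auto intro: M.finite_measure_axioms N.finite_measure_axioms\<close>)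
    then show "emeasure (distr N (Pi\<^sub>M T (\<lambda>_. borel)) (\<lambda>\<omega>. \<lambda>t\<in>T. Y t \<omega>)) (prod_emb T (\<lambda>_. borel) J (Pi\<^sub>E J A)) =
        emeasure (distr M (Pi\<^sub>M T (\<lambda>_. borel)) (\<lambda>\<omega>. \<lambda>t\<in>T. X t \<omega>)) (prod_emb T (\<lambda>_. borel) J (Pi\<^sub>E J A))"
      by (simp add: emeasure_distr emb)
  qed (auto intro!: prob_space.finite_measure N.prob_space_distr)
  then show ?thesis
    using mX mY by (auto simp: equal_in_law_def process_law_def distr_completion intro!: measurable_completion)
qed

text \<open>The characteristic functions give the second moments of all linear combinations, and
  polarization turns these into covariances. For the random series no convergence in mean square has
  to be shown.\<close>

lemma centered_complex_gaussian_processI: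
  assumes "prob_space M" and meas: "\<And>t. t \<in> T \<Longrightarrow> Y t \<in> borel_measurable M"
    and herm: "\<And>t u. t \<in> T \<Longrightarrow> u \<in> T \<Longrightarrow> k u t = cnj (k t u)"
    and nonneg: "\<And>F c. finite F \<Longrightarrow> F \<subseteq> T \<Longrightarrow> 0 \<le> Re (quadratic_form k F c)"
    and char: "\<And>F c. finite F \<Longrightarrow> F \<subseteq> T \<Longrightarrow> (\<integral>\<omega>. iexp (Re (\<Sum>t\<in>F. c t * Y t \<omega>)) \<partial>M) =
      complex_of_real (exp (- Re (quadratic_form k F c) / 4))"
  shows "centered_complex_gaussian_process M T k Y"
proof -
  interpret prob_space M by fact
  have gauss: "centered_complex_gaussian M (\<lambda>\<omega>. \<Sum>t\<in>F. c t * Y t \<omega>)" if F: "finite F" "F \<subseteq> T" for F c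
  proof (rule centered_complex_gaussianI[OF \<open>prob_space M\<close> _ nonneg[OF F]])
    show "(\<lambda>\<omega>. \<Sum>t\<in>F. c t * Y t \<omega>) \<in> borel_measurable M"
      using meas F by (intro borel_measurable_sum borel_measurable_times) auto
    fix w
    have "quadratic_form k F (\<lambda>t. w * c t) = complex_of_real ((cmod w)\<^sup>2) * quadratic_form k F c"
      unfolding quadratic_form_def complex_norm_square by (simp add: sum_distrib_left mult_ac)
    then have "Re (quadratic_form k F (\<lambda>t. w * c t)) = (cmod w)\<^sup>2 * Re (quadratic_form k F c)"
      by (simp flip: of_real_power)
    then show "(\<integral>\<omega>. iexp (Re (w * (\<Sum>t\<in>F. c t * Y t \<omega>))) \<partial>M) = complex_of_real (exp (- (cmod w)\<^sup>2 * Re (quadratic_form k F c) / 4))"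
      using char[OF F, of "\<lambda>t. w * c t"] by (simp add: sum_distrib_left mult.assoc)
  qed
  have sq: "(\<integral>\<omega>. (cmod (\<Sum>t\<in>F. c t * Y t \<omega>))\<^sup>2 \<partial>M) = Re (quadratic_form k F c)" if F: "finite F" "F \<subseteq> T" for F c
    using centered_complex_gaussian_char[OF gauss[OF F]] char[OF F] by (simp only: of_real_eq_iff exp_inj_iff) simp
  have gauss1: "centered_complex_gaussian M (Y t)" if "t \<in> T" for t
    using gauss[of "{t}" "\<lambda>_. 1"] that by simp
  have "(\<integral>\<omega>. Y t \<omega> * cnj (Y u \<omega>) \<partial>M) = k t u" if tu: "t \<in> T" "u \<in> T" for t u
  proof -
    have int: "integrable M (\<lambda>\<omega>. Y x \<omega> * cnj (Y y \<omega>))" if "x \<in> T" "y \<in> T" for x y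
      using that gauss1 meas by (intro integrable_mult_cnj centered_complex_gaussian_square) auto
    have diag: "(\<integral>\<omega>. (cmod (Y x \<omega>))\<^sup>2 \<partial>M) = Re (k x x)" if "x \<in> T" for x
      using sq[of "{x}" "\<lambda>_. 1"] that by (simp add: quadratic_form_def)
    show ?thesis
    proof (cases "t = u")
      case True
      have "Im (k t t) = 0" using herm[OF tu(1,1)] by (metis cnj.sel(2) equal_neg_zero)
      moreover have "(\<integral>\<omega>. Y t \<omega> * cnj (Y t \<omega>) \<partial>M) = complex_of_real (\<integral>\<omega>. (cmod (Y t \<omega>))\<^sup>2 \<partial>M)"
        unfolding integral_complex_of_real[symmetric] complex_norm_square ..
      ultimately show ?thesis using True diag[OF tu(1)] by (simp add: complex_eq_iff)
    next
      case False
      \<comment> \<open>The values c = 1 and c = \<i> give the real and the imaginary part of the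
        covariance.\<close>
      have "Re (cnj c * (\<integral>\<omega>. Y t \<omega> * cnj (Y u \<omega>) \<partial>M)) = Re (cnj c * k t u)" for c
      proof -
        have expand: "(cmod (x + c * y))\<^sup>2 = (cmod x)\<^sup>2 + (cmod c)\<^sup>2 * (cmod y)\<^sup>2 + 2 * Re (cnj c * (x * cnj y))" for x y
          unfolding cmod_power2 by (simp add: power2_eq_square algebra_simps)
        define R where "R = (\<lambda>\<omega>. Re (cnj c * (Y t \<omega> * cnj (Y u \<omega>))))"
        have i2: "integrable M R"
          unfolding R_def using int[OF tu] by (intro integrable_Re integrable_mult_right)
        have "(\<integral>\<omega>. (cmod (Y t \<omega> + c * Y u \<omega>))\<^sup>2 \<partial>M) =
          Re (k t t) + (cmod c)\<^sup>2 * Re (k u u) + 2 * (\<integral>\<omega>. R \<omega> \<partial>M)"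
          unfolding expand R_def[symmetric, THEN fun_cong] using i2 centered_complex_gaussian_square[OF gauss1] tu
          by (simp add: diag)
        also have "(\<integral>\<omega>. R \<omega> \<partial>M) = Re (cnj c * (\<integral>\<omega>. Y t \<omega> * cnj (Y u \<omega>) \<partial>M))"
          unfolding R_def using int[OF tu] by (simp only: integral_Re[OF integrable_mult_right] integral_mult_right_zero)
        finally have 1: "(\<integral>\<omega>. (cmod (Y t \<omega> + c * Y u \<omega>))\<^sup>2 \<partial>M) =
          Re (k t t) + (cmod c)\<^sup>2 * Re (k u u) + 2 * Re (cnj c * (\<integral>\<omega>. Y t \<omega> * cnj (Y u \<omega>) \<partial>M))" .
        have "(\<integral>\<omega>. (cmod (Y t \<omega> + c * Y u \<omega>))\<^sup>2 \<partial>M) = Re (k t t + cnj c * k t u + (c * k u t + c * cnj c * k u u))"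
          using sq[of "{t, u}" "\<lambda>x. if x = t then 1 else c"] False tu by (simp add: quadratic_form_def)
        also have "\<dots> = Re (k t t) + (cmod c)\<^sup>2 * Re (k u u) + 2 * Re (cnj c * k t u)"
          unfolding complex_norm_square[symmetric] herm[OF tu] by (simp add: algebra_simps)
        finally show ?thesis using 1 by simp
      qed
      from this[of 1] this[of \<i>] show ?thesis by (simp add: complex_eq_iff)
    qed
  qed
  then show ?thesis
    unfolding centered_complex_gaussian_process_def using gauss \<open>prob_space M\<close> by auto
qed

text \<open>f and g differ on a subset of a null set, and every such subset is measurable in the
  completion.\<close>

lemma measurable_completion_AE:
  assumes f: "f \<in> completion M \<rightarrow>\<^sub>M L" and "AE \<omega> in M. g \<omega> = f \<omega>" and "\<And>\<omega>. \<omega> \<in> space M \<Longrightarrow> g \<omega> \<in> space L"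
  shows "g \<in> completion M \<rightarrow>\<^sub>M L"
proof (rule measurableI)
  define Z where "Z = {\<omega> \<in> space M. g \<omega> \<noteq> f \<omega>}"
  obtain Z' where "Z' \<in> null_sets M" "Z \<subseteq> Z'"
    using assms(2) unfolding Z_def by (auto elim!: AE_E simp: null_sets_def)
  then have null: "S \<in> sets (completion M)" if "S \<subseteq> Z" for S
    using that null_sets_completion by blast
  fix A assume A: "A \<in> sets L"
  have "g -` A \<inter> space M = (f -` A \<inter> space (completion M) - Z) \<union> (g -` A \<inter> Z)"
    by (auto simp: Z_def)
  also have "\<dots> \<in> sets (completion M)"
    using measurable_sets[OF f A] null[of Z] null[of "g -` A \<inter> Z"] by blast
  finally show "g -` A \<inter> space (completion M) \<in> sets (completion M)" by simp
qed (use assms in auto)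

lemma equal_in_law_AE:
  assumes law: "equal_in_law T N Y M X" and ae: "AE \<omega> in M. \<forall>t\<in>T. X' t \<omega> = X t \<omega>"
  shows "equal_in_law T N Y M X'"
proof -
  have X: "\<And>t. t \<in> T \<Longrightarrow> X t \<in> borel_measurable (completion M)"
    using law by (auto simp: equal_in_law_def)
  have X': "X' t \<in> borel_measurable (completion M)" if "t \<in> T" for t
    using ae that by (intro measurable_completion_AE[OF X[OF that]]) auto
  have "process_law M T X' = process_law M T X"
    unfolding process_law_def
  proof (rule distr_cong_AE)
    show "AE \<omega> in completion M. (\<lambda>t\<in>T. X' t \<omega>) = (\<lambda>t\<in>T. X t \<omega>)"
      using AE_completion[OF ae] by eventually_elim (auto simp: restrict_def)
  qed (use X X' in \<open>auto intro!: measurable_restrict\<close>)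
  then show ?thesis using law X' by (auto simp: equal_in_law_def)
qed

section \<open>The Gaussian Laurent series\<close>

definition gaf_coeff :: "real \<Rightarrow> real \<Rightarrow> complex \<Rightarrow> int \<Rightarrow> complex"
  where "gaf_coeff q s z n = z powi n / complex_of_real (sqrt (1 + s * q powi (2 * n)))"

lemma has_sum_sum:
  fixes f :: "'i \<Rightarrow> 'b \<Rightarrow> 'c::topological_comm_monoid_add"
  assumes "\<And>i. i \<in> I \<Longrightarrow> (f i has_sum s i) A"
  shows "((\<lambda>x. \<Sum>i\<in>I. f i x) has_sum (\<Sum>i\<in>I. s i)) A"
  using assms by (induction I rule: infinite_finite_induct) (auto intro!: has_sum_add)

lemma gaf_annulus_eq: "gaf_annulus q \<zeta> s z \<omega> = (\<Sum>\<^sub>\<infinity>n\<in>UNIV. \<zeta> n \<omega> * gaf_coeff q s z n)"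
  by (simp add: gaf_annulus_def gaf_coeff_def)

lemma gaf_coeff_nonneg: "gaf_coeff q s z (int n) = complex_of_real (1 / sqrt (1 + s * (q\<^sup>2) ^ n)) * z ^ n"
proof -
  have "q powi (2 * int n) = (q\<^sup>2) ^ n"
    using power_int_of_nat[of q "2 * n"] by (simp add: power_mult)
  then show ?thesis by (simp add: gaf_coeff_def)
qed

text \<open>Numerator and denominator are multiplied by q^(n+1). Because of the square root this
  half is a series in q / z, convergent for norm z > q, whereas in the kernel the variable is q^2 /
  x.\<close>

lemma gaf_coeff_neg:
  assumes "0 < q" "0 < s"
  shows "gaf_coeff q s z (- int n - 1) =
    (q / z) * (complex_of_real (1 / sqrt (s + (q\<^sup>2) ^ Suc n)) * (complex_of_real q / z) ^ n)"
proof -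
  have n: "- int n - 1 = - int (Suc n)" "2 * (- int n - 1) = - int (2 * Suc n)" by simp_all
  have "1 + s * inverse (q ^ (2 * Suc n)) = (s + (q\<^sup>2) ^ Suc n) / (q ^ Suc n)\<^sup>2"
    using assms by (simp add: power_mult[symmetric] divide_simps mult.commute del: power_Suc)
  then have sq: "sqrt (1 + s * inverse (q ^ (2 * Suc n))) = sqrt (s + (q\<^sup>2) ^ Suc n) / q ^ Suc n"
    using assms by (simp add: real_sqrt_divide del: power_Suc)
  have "gaf_coeff q s z (- int n - 1) = inverse (z ^ Suc n) / complex_of_real (sqrt (1 + s * inverse (q ^ (2 * Suc n))))"
    unfolding gaf_coeff_def n(2) unfolding n(1) power_int_minus power_int_of_nat ..
  also have "\<dots> = complex_of_real (1 / sqrt (s + (q\<^sup>2) ^ Suc n)) * (complex_of_real q / z) ^ Suc n"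
    unfolding sq by (simp add: divide_inverse power_mult_distrib power_inverse mult_ac)
  finally show ?thesis by (simp add: mult_ac)
qed

text \<open>A single event on which the series converges at all points of the annulus at once. C is
  a natural number so that the quantifiers are countable and the event is measurable in M
  itself.\<close>

definition tempered :: "(int \<Rightarrow> 'a \<Rightarrow> complex) \<Rightarrow> 'a \<Rightarrow> bool"
  where "tempered \<zeta> \<omega> \<longleftrightarrow> (\<exists>C::nat. \<forall>n. cmod (\<zeta> n \<omega>) \<le> real C * (1 + real_of_int \<bar>n\<bar>))"

text \<open>The sum of the squares of norm (\<xi> n) / (1 + n) has as expectation the sum of 1 / (1
  + n)^2. It is therefore almost surely finite, and then it dominates each of its terms.\<close>

lemma AE_linear_bound:
  fixes \<xi> :: "nat \<Rightarrow> 'a \<Rightarrow> complex"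
  assumes [measurable]: "\<And>n. \<xi> n \<in> borel_measurable M"
    and sq: "\<And>n. (\<integral>\<^sup>+\<omega>. ennreal ((cmod (\<xi> n \<omega>))\<^sup>2) \<partial>M) = 1"
  shows "AE \<omega> in M. \<exists>C::nat. \<forall>n. cmod (\<xi> n \<omega>) \<le> real C * (1 + real n)"
proof -
  let ?f = "\<lambda>n \<omega>. (cmod (\<xi> n \<omega>) / (1 + real n))\<^sup>2"
  have "summable (\<lambda>n. 1 / (1 + real n)\<^sup>2)"
    using inverse_power_summable[of 2, where 'a = real] summable_Suc_iff[of "\<lambda>n. inverse (real n ^ 2)"]
    by (simp add: divide_inverse power_inverse)
  have "(\<integral>\<^sup>+\<omega>. (\<Sum>n. ennreal (?f n \<omega>)) \<partial>M) = (\<Sum>n. \<integral>\<^sup>+\<omega>. ennreal (?f n \<omega>) \<partial>M)"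
    by (rule nn_integral_suminf) measurable
  also have "\<dots> = (\<Sum>n. ennreal (1 / (1 + real n)\<^sup>2))"
  proof (rule suminf_cong)
    fix n
    have "(\<integral>\<^sup>+\<omega>. ennreal (?f n \<omega>) \<partial>M) = (\<integral>\<^sup>+\<omega>. ennreal (1 / (1 + real n)\<^sup>2) * ennreal ((cmod (\<xi> n \<omega>))\<^sup>2) \<partial>M)"
      by (intro nn_integral_cong) (simp add: power_divide flip: ennreal_mult)
    also have "\<dots> = ennreal (1 / (1 + real n)\<^sup>2)"
      by (subst nn_integral_cmult) (simp_all add: sq)
    finally show "(\<integral>\<^sup>+\<omega>. ennreal (?f n \<omega>) \<partial>M) = \<dots>" .
  qed
  also have "\<dots> < \<infinity>" using \<open>summable _\<close> by (simp add: less_top[symmetric] suminf_ennreal2)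
  finally have "AE \<omega> in M. (\<Sum>n. ennreal (?f n \<omega>)) \<noteq> \<infinity>"
    by (intro nn_integral_PInf_AE) auto
  then show ?thesis
  proof eventually_elim
    case (elim \<omega>)
    then have s: "summable (\<lambda>n. ?f n \<omega>)" by (intro summable_suminf_not_top) auto
    obtain C :: nat where C: "sqrt (\<Sum>n. ?f n \<omega>) \<le> real C" using real_arch_simple by blast
    have "cmod (\<xi> n \<omega>) \<le> real C * (1 + real n)" for n
    proof -
      have "?f n \<omega> \<le> (\<Sum>n. ?f n \<omega>)" using sum_le_suminf[OF s, of "{n}"] by simp
      then have "cmod (\<xi> n \<omega>) / (1 + real n) \<le> real C"
        using C real_le_rsqrt order_trans by blast
      then show ?thesis by (simp add: pos_divide_le_eq)
    qed
    then show ?case by blast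
  qed
qed

lemma iid_second_moment:
  assumes iid: "iid_std_complex_gaussian M \<zeta>"
  shows "(\<integral>\<^sup>+\<omega>. ennreal ((cmod (\<zeta> n \<omega>))\<^sup>2) \<partial>M) = 1"
proof -
  note [measurable] = iid_measurable[OF iid]
  have "(\<integral>\<^sup>+\<omega>. ennreal ((cmod (\<zeta> n \<omega>))\<^sup>2) \<partial>M) = (\<integral>\<^sup>+z. ennreal ((cmod z)\<^sup>2) \<partial>distr M borel (\<zeta> n))"
    by (subst nn_integral_distr) auto
  also have "\<dots> = ennreal (\<integral>z. (cmod z)\<^sup>2 \<partial>std_complex_gaussian)"
    unfolding iid_distr[OF iid] by (intro nn_integral_eq_integral std_complex_gaussian_square) auto
  finally show ?thesis by (simp add: std_complex_gaussian_square)
qed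

lemma AE_tempered:
  assumes iid: "iid_std_complex_gaussian M \<zeta>"
  shows "AE \<omega> in M. tempered \<zeta> \<omega>"
  using AE_linear_bound[of "\<lambda>n. \<zeta> (int n)", OF iid_measurable[OF iid] iid_second_moment[OF iid]]
    AE_linear_bound[of "\<lambda>n. \<zeta> (- int n)", OF iid_measurable[OF iid] iid_second_moment[OF iid]]
proof eventually_elim
  case (elim \<omega>)
  then obtain C D :: nat where C: "\<And>n. cmod (\<zeta> (int n) \<omega>) \<le> real C * (1 + real n)"
    and D: "\<And>n. cmod (\<zeta> (- int n) \<omega>) \<le> real D * (1 + real n)" by blast
  have "cmod (\<zeta> n \<omega>) \<le> real (max C D) * (1 + real_of_int \<bar>n\<bar>)" for n
  proof (cases "n \<ge> 0")
    case True
    have "cmod (\<zeta> n \<omega>) \<le> real C * (1 + real_of_int \<bar>n\<bar>)" using C[of "nat n"] True by simp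
    also have "\<dots> \<le> real (max C D) * (1 + real_of_int \<bar>n\<bar>)" by (intro mult_right_mono) auto
    finally show ?thesis .
  next
    case False
    have "cmod (\<zeta> n \<omega>) \<le> real D * (1 + real_of_int \<bar>n\<bar>)" using D[of "nat (- n)"] False by simp
    also have "\<dots> \<le> real (max C D) * (1 + real_of_int \<bar>n\<bar>)" by (intro mult_right_mono) auto
    finally show ?thesis .
  qed
  then show ?case unfolding tempered_def by blast
qed

lemma measurable_tempered:
  assumes iid: "iid_std_complex_gaussian M \<zeta>"
  shows "Measurable.pred M (tempered \<zeta>)"
proof -
  note [measurable] = iid_measurable[OF iid]
  show ?thesis unfolding tempered_def[abs_def] by measurable
qed

definition gaf_pos :: "real \<Rightarrow> (int \<Rightarrow> 'a \<Rightarrow> complex) \<Rightarrow> real \<Rightarrow> 'a \<Rightarrow> nat \<Rightarrow> complex"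
  where "gaf_pos q \<zeta> s \<omega> n = \<zeta> (int n) \<omega> * complex_of_real (1 / sqrt (1 + s * (q\<^sup>2) ^ n))"

definition gaf_neg :: "real \<Rightarrow> (int \<Rightarrow> 'a \<Rightarrow> complex) \<Rightarrow> real \<Rightarrow> 'a \<Rightarrow> nat \<Rightarrow> complex"
  where "gaf_neg q \<zeta> s \<omega> n = \<zeta> (- int n - 1) \<omega> * complex_of_real (1 / sqrt (s + (q\<^sup>2) ^ Suc n))"

lemma tempered_bounds:
  assumes "0 < q" "0 < s" "tempered \<zeta> \<omega>"
  shows "\<exists>C. \<forall>n. cmod (gaf_pos q \<zeta> s \<omega> n) \<le> C * (1 + real n) \<and> cmod (gaf_neg q \<zeta> s \<omega> n) \<le> C * (1 + real n)"
proof -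
  obtain C :: nat where C: "\<And>n. cmod (\<zeta> n \<omega>) \<le> real C * (1 + real_of_int \<bar>n\<bar>)"
    using assms(3) by (auto simp: tempered_def)
  \<comment> \<open>The weights are at most 1 and 1 / sqrt s. The 2 absorbs the index shift, as 1 +
    (n + 1) is at most 2 * (1 + n).\<close>
  define K where "K = max (real C) (2 * real C * (1 / sqrt s))"
  have "cmod (gaf_pos q \<zeta> s \<omega> n) \<le> K * (1 + real n)" for n
  proof -
    have "cmod (gaf_pos q \<zeta> s \<omega> n) \<le> cmod (\<zeta> (int n) \<omega>) * 1"
      unfolding gaf_pos_def norm_mult norm_of_real using assms
      by (intro mult_left_mono) (simp_all add: divide_le_eq_1 add_pos_pos)
    also have "\<dots> \<le> real C * (1 + real n)" using C[of "int n"] by simp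
    also have "\<dots> \<le> K * (1 + real n)" by (intro mult_right_mono) (simp_all add: K_def)
    finally show ?thesis .
  qed
  moreover have "cmod (gaf_neg q \<zeta> s \<omega> n) \<le> K * (1 + real n)" for n
  proof -
    have "1 / sqrt (s + (q\<^sup>2) ^ Suc n) \<le> 1 / sqrt s"
      using assms by (intro divide_left_mono mult_pos_pos) (simp_all add: add_pos_pos)
    moreover have "0 \<le> 1 / sqrt (s + (q\<^sup>2) ^ Suc n)" using assms by simp
    ultimately have "cmod (gaf_neg q \<zeta> s \<omega> n) \<le> (real C * (1 + real_of_int \<bar>- int n - 1\<bar>)) * (1 / sqrt s)"
      unfolding gaf_neg_def norm_mult norm_of_real using C[of "- int n - 1"] by (intro mult_mono) auto
    also have "\<dots> \<le> (2 * real C * (1 / sqrt s)) * (1 + real n)"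
    proof -
      have "1 + real_of_int \<bar>- int n - 1\<bar> \<le> 2 * (1 + real n)" by simp
      then have "(real C * (1 / sqrt s)) * (1 + real_of_int \<bar>- int n - 1\<bar>) \<le> (real C * (1 / sqrt s)) * (2 * (1 + real n))"
        using assms by (intro mult_left_mono) auto
      then show ?thesis by (simp only: mult_ac)
    qed
    also have "\<dots> \<le> K * (1 + real n)" by (intro mult_right_mono) (simp_all add: K_def)
    finally show ?thesis .
  qed
  ultimately show ?thesis by blast
qed

lemma
  assumes q: "0 < q" and s: "0 < s" and temp: "tempered \<zeta> \<omega>" and z: "z \<in> annulus q"
  shows gaf_has_sum: "((\<lambda>n. gaf_coeff q s z n * \<zeta> n \<omega>) has_sum gaf_annulus q \<zeta> s z \<omega>) UNIV"
    and gaf_split: "gaf_annulus q \<zeta> s z \<omega> = (\<Sum>n. gaf_pos q \<zeta> s \<omega> n * z ^ n) +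
      (q / z) * (\<Sum>n. gaf_neg q \<zeta> s \<omega> n * (q / z) ^ n)"
proof -
  let ?f = "\<lambda>n. gaf_coeff q s z n * \<zeta> n \<omega>"
  obtain C where C: "\<And>n. cmod (gaf_pos q \<zeta> s \<omega> n) \<le> C * (1 + real n)" "\<And>n. cmod (gaf_neg q \<zeta> s \<omega> n) \<le> C * (1 + real n)"
    using tempered_bounds[OF q s temp] by blast
  have zn: "q < cmod z" "cmod z < 1" using z by (auto simp: annulus_def)
  then have "cmod (q / z) < 1" using q by (simp add: norm_divide divide_less_eq)
  have 1: "?f (int n) = gaf_pos q \<zeta> s \<omega> n * z ^ n" for n
    by (simp add: gaf_coeff_nonneg gaf_pos_def mult_ac)
  have 2: "?f (- int n - 1) = (q / z) * (gaf_neg q \<zeta> s \<omega> n * (q / z) ^ n)" for n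
    unfolding gaf_coeff_neg[OF q s] gaf_neg_def by (simp only: mult_ac)
  note s1 = summable_norm_power_series_linear[OF C(1) zn(2)]
  note s2 = summable_norm_power_series_linear[OF C(2) \<open>cmod (q / z) < 1\<close>]
  have "(?f has_sum ((\<Sum>n. ?f (int n)) + (\<Sum>n. ?f (- int n - 1)))) UNIV"
  proof (rule has_sum_bilateral)
    show "summable (\<lambda>n. norm (?f (int n)))" unfolding 1 by (rule s1)
    show "summable (\<lambda>n. norm (?f (- int n - 1)))" unfolding 2 norm_mult[of "q / z"] by (intro summable_mult s2)
  qed
  then have hs: "(?f has_sum ((\<Sum>n. gaf_pos q \<zeta> s \<omega> n * z ^ n) +
      (q / z) * (\<Sum>n. gaf_neg q \<zeta> s \<omega> n * (q / z) ^ n))) UNIV"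
    unfolding 1 2 suminf_mult[OF summable_norm_cancel[OF s2]] .
  then show eq: "gaf_annulus q \<zeta> s z \<omega> = (\<Sum>n. gaf_pos q \<zeta> s \<omega> n * z ^ n) +
      (q / z) * (\<Sum>n. gaf_neg q \<zeta> s \<omega> n * (q / z) ^ n)"
    unfolding gaf_annulus_eq by (intro infsumI) (simp add: mult.commute)
  show "(?f has_sum gaf_annulus q \<zeta> s z \<omega>) UNIV" using hs unfolding eq .
qed

lemma holomorphic_gaf:
  assumes q: "0 < q" and s: "0 < s" and temp: "tempered \<zeta> \<omega>"
  shows "(\<lambda>z. gaf_annulus q \<zeta> s z \<omega>) holomorphic_on annulus q"
proof -
  obtain C where C: "\<And>n. cmod (gaf_pos q \<zeta> s \<omega> n) \<le> C * (1 + real n)" "\<And>n. cmod (gaf_neg q \<zeta> s \<omega> n) \<le> C * (1 + real n)"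
    using tempered_bounds[OF q s temp] by blast
  have zn: "q < cmod z" "cmod z < 1" "z \<noteq> 0" if "z \<in> annulus q" for z
    using that q by (auto simp: annulus_def)
  have 1: "(\<lambda>z. \<Sum>n. gaf_pos q \<zeta> s \<omega> n * z ^ n) holomorphic_on annulus q"
    by (rule holomorphic_on_subset[OF holomorphic_linear_power_series[OF C(1)]]) (use zn in auto)
  have 2: "(\<lambda>z. \<Sum>n. gaf_neg q \<zeta> s \<omega> n * (q / z) ^ n) holomorphic_on annulus q"
  proof (rule holomorphic_on_compose_gen[OF _ holomorphic_linear_power_series[OF C(2)], unfolded o_def])
    show "(\<lambda>z. complex_of_real q / z) holomorphic_on annulus q"
      using zn by (intro holomorphic_intros) auto
    show "(\<lambda>z. complex_of_real q / z) ` annulus q \<subseteq> ball 0 1"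
      using zn q by (auto simp: norm_divide divide_less_eq)
  qed
  have "(\<lambda>z. (\<Sum>n. gaf_pos q \<zeta> s \<omega> n * z ^ n) + (q / z) * (\<Sum>n. gaf_neg q \<zeta> s \<omega> n * (q / z) ^ n)) holomorphic_on annulus q"
    using zn by (intro holomorphic_intros 1 2) auto
  then show ?thesis
    by (rule holomorphic_transform) (simp add: gaf_split[OF assms])
qed

text \<open>A version of the series that is measurable without completing the probability space.\<close>

definition gaf_version :: "real \<Rightarrow> (int \<Rightarrow> 'a \<Rightarrow> complex) \<Rightarrow> real \<Rightarrow> complex \<Rightarrow> 'a \<Rightarrow> complex"
  where "gaf_version q \<zeta> s z \<omega> = (if tempered \<zeta> \<omega> then gaf_annulus q \<zeta> s z \<omega> else 0)"

text \<open>On the measurable event \<open>tempered\<close> the unordered sum is the limit of its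
  symmetric partial sums.\<close>

lemma measurable_gaf_version:
  assumes iid: "iid_std_complex_gaussian M \<zeta>" and q: "0 < q" and s: "0 < s" and z: "z \<in> annulus q"
  shows "gaf_version q \<zeta> s z \<in> borel_measurable M"
proof -
  note [measurable] = iid_measurable[OF iid] measurable_tempered[OF iid]
  have "gaf_version q \<zeta> s z \<omega> = (if tempered \<zeta> \<omega> then lim (\<lambda>N. \<Sum>n\<in>{- int N..int N}. gaf_coeff q s z n * \<zeta> n \<omega>) else 0)" for \<omega>
  proof (cases "tempered \<zeta> \<omega>")
    case True
    have "(\<lambda>N. \<Sum>n\<in>{- int N..int N}. gaf_coeff q s z n * \<zeta> n \<omega>) \<longlonglongrightarrow> gaf_annulus q \<zeta> s z \<omega>"
      using gaf_has_sum[OF q s True z] filterlim_int_intervals filterlim_compose unfolding has_sum_def by blast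
    then show ?thesis using True by (simp add: gaf_version_def limI)
  qed (simp add: gaf_version_def)
  then show ?thesis
    by (subst measurable_cong) (assumption, measurable)
qed

lemma gaf_coeff_mult_cnj:
  assumes "0 < q" "0 < s"
  shows "gaf_coeff q s z n * cnj (gaf_coeff q s w n) = (z * cnj w) powi n / complex_of_real (1 + s * q powi (2 * n))"
proof -
  have "0 \<le> 1 + s * q powi (2 * n)" using assms by simp
  then have "complex_of_real (sqrt (1 + s * q powi (2 * n))) * complex_of_real (sqrt (1 + s * q powi (2 * n))) =
      complex_of_real (1 + s * q powi (2 * n))"
    by (simp only: of_real_mult[symmetric] real_sqrt_mult_self abs_of_nonneg)
  then show ?thesis
    by (simp add: gaf_coeff_def power_int_mult_distrib complex_cnj_power_int)
qed

text \<open>Expanding the square and summing over n reproduces the kernel term by term. This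
  supplies both the variance of a combination of values of the series and the positive
  semidefiniteness of the kernel.\<close>

lemma quadratic_form_has_sum:
  assumes q: "0 < q" "q < 1" and s: "0 < s" and F: "F \<subseteq> annulus q"
  shows "((\<lambda>n. (cmod (\<Sum>z\<in>F. c z * gaf_coeff q s z n))\<^sup>2) has_sum Re (quadratic_form (szego_kernel q s) F c)) UNIV"
proof -
  have "((\<lambda>n. \<Sum>z\<in>F. \<Sum>w\<in>F. c z * cnj (c w) * (gaf_coeff q s z n * cnj (gaf_coeff q s w n))) has_sum
      quadratic_form (szego_kernel q s) F c) UNIV"
    unfolding quadratic_form_def szego_kernel_eq gaf_coeff_mult_cnj[OF q(1) s]
    using annulus_mult[OF subsetD[OF F] subsetD[OF F] q(1)]
    by (intro has_sum_sum has_sum_cmult_right szego_sum_has_sum[OF q s]) auto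
  from has_sum_Re[OF this] show ?thesis
    by (simp only: quadratic_form_def[symmetric] quadratic_form_sum Re_complex_of_real)
qed

text \<open>A combination of values at finitely many points is again a Gaussian series in the same
  \<zeta> n, with the combined coefficients.\<close>

lemma gaf_version_char:
  assumes iid: "iid_std_complex_gaussian M \<zeta>" and q: "0 < q" "q < 1" and s: "0 < s"
    and F: "finite F" "F \<subseteq> annulus q"
  shows "(\<integral>\<omega>. iexp (Re (\<Sum>z\<in>F. c z * gaf_version q \<zeta> s z \<omega>)) \<partial>M) =
    complex_of_real (exp (- Re (quadratic_form (szego_kernel q s) F c) / 4))"
proof -
  have "(\<integral>\<omega>. iexp (Re (1 * (\<Sum>z\<in>F. c z * gaf_version q \<zeta> s z \<omega>))) \<partial>M) =
    complex_of_real (exp (- (cmod 1)\<^sup>2 * Re (quadratic_form (szego_kernel q s) F c) / 4))"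
  proof (rule gaussian_series_char[OF iid])
    show "(\<lambda>\<omega>. \<Sum>z\<in>F. c z * gaf_version q \<zeta> s z \<omega>) \<in> borel_measurable M"
      using measurable_gaf_version[OF iid q(1) s] F by (intro borel_measurable_sum borel_measurable_times) auto
    show "((\<lambda>n. (cmod (\<Sum>z\<in>F. c z * gaf_coeff q s z n))\<^sup>2) has_sum Re (quadratic_form (szego_kernel q s) F c)) UNIV"
      by (rule quadratic_form_has_sum[OF q s F(2)])
    show "AE \<omega> in M. ((\<lambda>n. (\<Sum>z\<in>F. c z * gaf_coeff q s z n) * \<zeta> n \<omega>) has_sum (\<Sum>z\<in>F. c z * gaf_version q \<zeta> s z \<omega>)) UNIV"
      using AE_tempered[OF iid]
    proof eventually_elim
      case (elim \<omega>)
      have "((\<lambda>n. \<Sum>z\<in>F. c z * (gaf_coeff q s z n * \<zeta> n \<omega>)) has_sum (\<Sum>z\<in>F. c z * gaf_annulus q \<zeta> s z \<omega>)) UNIV"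
        using F gaf_has_sum[OF q(1) s elim] by (intro has_sum_sum has_sum_cmult_right) auto
      then show ?case using elim by (simp add: gaf_version_def sum_distrib_right mult.assoc)
    qed
  qed
  then show ?thesis by simp
qed

text \<open>The product form of k is asked for on the annulus only, where it is known for
  conditioned kernels. Used with f = \<open>gamma_fun q \<alpha> n\<close> and with f = 1.\<close>

lemma gaf_version_process:
  assumes iid: "iid_std_complex_gaussian M \<zeta>" and q: "0 < q" "q < 1" and s: "0 < s"
    and k: "\<And>z w. z \<in> annulus q \<Longrightarrow> w \<in> annulus q \<Longrightarrow> k z w = f z * cnj (f w) * szego_kernel q s z w"
  shows "centered_complex_gaussian_process M (annulus q) k (\<lambda>z \<omega>. f z * gaf_version q \<zeta> s z \<omega>)"
proof (rule centered_complex_gaussian_processI[OF iid_prob_space[OF iid]])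
  show "(\<lambda>\<omega>. f z * gaf_version q \<zeta> s z \<omega>) \<in> borel_measurable M" if "z \<in> annulus q" for z
    using measurable_gaf_version[OF iid q(1) s that] by measurable
  have herm: "szego_kernel q s w z = cnj (szego_kernel q s z w)" for z w
    by (simp add: szego_kernel_def infsum_cnj[symmetric] complex_cnj_power_int mult.commute)
  show "k w z = cnj (k z w)" if "z \<in> annulus q" "w \<in> annulus q" for z w
    using that herm[of w z] by (simp add: k)
  have form: "quadratic_form k F c = quadratic_form (szego_kernel q s) F (\<lambda>z. c z * f z)" if "F \<subseteq> annulus q" for F c
    unfolding quadratic_form_def by (intro sum.cong refl) (simp add: k[OF subsetD[OF that] subsetD[OF that]] mult_ac)
  show "0 \<le> Re (quadratic_form k F c)" if "F \<subseteq> annulus q" for F c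
    unfolding form[OF that] by (rule has_sum_nonneg[OF quadratic_form_has_sum[OF q s that]]) simp
  show "(\<integral>\<omega>. iexp (Re (\<Sum>z\<in>F. c z * (f z * gaf_version q \<zeta> s z \<omega>))) \<partial>M) = complex_of_real (exp (- Re (quadratic_form k F c) / 4))"
    if "finite F" "F \<subseteq> annulus q" for F c
    using gaf_version_char[OF iid q s that, of "\<lambda>z. c z * f z"] by (simp add: form[OF that(2)] mult.assoc)
qed

section \<open>Functionals of processes\<close>

text \<open>The set \<open>H\<close> need not be measurable: it only has to carry almost all paths.\<close>

lemma equal_in_law_functional:
  fixes Y :: "'t \<Rightarrow> 'b \<Rightarrow> 'c::topological_space" and X :: "'t \<Rightarrow> 'a \<Rightarrow> 'c"
    and \<Phi> :: "'s \<Rightarrow> ('t \<Rightarrow> 'c) \<Rightarrow> ennreal"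
  assumes law: "equal_in_law T N Y M X"
    and Y: "AE \<omega> in N. (\<lambda>t\<in>T. Y t \<omega>) \<in> H" and X: "AE \<omega> in M. (\<lambda>t\<in>T. X t \<omega>) \<in> H"
    and \<Phi>: "\<And>s. s \<in> S \<Longrightarrow> \<Phi> s \<in> borel_measurable (restrict_space (Pi\<^sub>M T (\<lambda>_. borel)) H)"
  shows "equal_in_law S N (\<lambda>s \<omega>. \<Phi> s (\<lambda>t\<in>T. Y t \<omega>)) M (\<lambda>s \<omega>. \<Phi> s (\<lambda>t\<in>T. X t \<omega>))"
proof -
  let ?P = "Pi\<^sub>M T (\<lambda>_. borel :: 'c measure)" and ?L = "Pi\<^sub>M S (\<lambda>_. borel :: ennreal measure)"
  define \<Psi> where "\<Psi> f = (\<lambda>s\<in>S. \<Phi> s f)" for f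
  have \<Psi>: "\<Psi> \<in> restrict_space ?P H \<rightarrow>\<^sub>M ?L"
    unfolding \<Psi>_def[abs_def] using \<Phi> by (intro measurable_restrict)
  have paths: "(\<lambda>\<omega>. \<Phi> s (y \<omega>)) \<in> borel_measurable (completion K)"
    if y: "y \<in> completion K \<rightarrow>\<^sub>M ?P" and ae: "AE \<omega> in K. y \<omega> \<in> H" and s: "s \<in> S" for y and K :: "'k measure" and s
  proof -
    define \<Omega> where "\<Omega> = {\<omega> \<in> space K. y \<omega> \<in> H}"
    \<comment> \<open>Paths outside H have probability 0, so this event belongs to the completion
      even if H itself is not measurable.\<close>
    have "Measurable.pred (completion K) (\<lambda>\<omega>. \<not> (y \<omega> \<notin> H))"
      using ae by (intro pred_intros_logic sets_completion_AE) auto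
    then have \<Omega>: "\<Omega> \<in> sets (completion K)" by (simp add: \<Omega>_def pred_def)
    have "y \<in> restrict_space (completion K) \<Omega> \<rightarrow>\<^sub>M restrict_space ?P H"
      using y by (intro measurable_restrict_space3) (auto simp: \<Omega>_def)
    from measurable_compose[OF this \<Phi>[OF s]]
    have "(\<lambda>\<omega>. if \<omega> \<in> \<Omega> then \<Phi> s (y \<omega>) else 0) \<in> borel_measurable (completion K)"
      using \<Omega> by (subst (asm) measurable_restrict_space_iff[where c = 0]) auto
    then show ?thesis
    proof (rule measurable_completion_AE)
      show "AE \<omega> in K. \<Phi> s (y \<omega>) = (if \<omega> \<in> \<Omega> then \<Phi> s (y \<omega>) else 0)"
        using ae AE_space by eventually_elim (auto simp: \<Omega>_def)
    qed auto
  qed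
  have y: "(\<lambda>\<omega>. \<lambda>t\<in>T. Y t \<omega>) \<in> completion N \<rightarrow>\<^sub>M ?P" and x: "(\<lambda>\<omega>. \<lambda>t\<in>T. X t \<omega>) \<in> completion M \<rightarrow>\<^sub>M ?P"
    and eq: "distr (completion N) ?P (\<lambda>\<omega>. \<lambda>t\<in>T. Y t \<omega>) = distr (completion M) ?P (\<lambda>\<omega>. \<lambda>t\<in>T. X t \<omega>)"
    using law by (auto simp: equal_in_law_def process_law_def intro!: measurable_restrict)
  have "distr (completion N) ?L (\<lambda>\<omega>. \<Psi> (\<lambda>t\<in>T. Y t \<omega>)) = distr (completion M) ?L (\<lambda>\<omega>. \<Psi> (\<lambda>t\<in>T. X t \<omega>))"
  proof (rule measure_eqI)
    have my: "(\<lambda>\<omega>. \<Psi> (\<lambda>t\<in>T. Y t \<omega>)) \<in> completion N \<rightarrow>\<^sub>M ?L" and mx: "(\<lambda>\<omega>. \<Psi> (\<lambda>t\<in>T. X t \<omega>)) \<in> completion M \<rightarrow>\<^sub>M ?L"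
      unfolding \<Psi>_def using paths[OF y Y] paths[OF x X] by (auto intro!: measurable_restrict)
    fix A assume "A \<in> sets (distr (completion N) ?L (\<lambda>\<omega>. \<Psi> (\<lambda>t\<in>T. Y t \<omega>)))"
    then have A: "A \<in> sets ?L" by simp
    \<comment> \<open>Preimages under \<Psi> are controlled on H only, as traces of measurable sets
      E of the product space. Passing from the preimage of A to E changes events by null sets, and E
      depends on A alone, so the two laws can be compared on E.\<close>
    from measurable_sets[OF \<Psi> this] obtain E where E: "E \<in> sets ?P" "\<Psi> -` A \<inter> (H \<inter> space ?P) = H \<inter> E"
      by (auto simp: sets_restrict_space space_restrict_space Int_commute)
    have mem: "\<Psi> f \<in> A \<longleftrightarrow> f \<in> E" if "f \<in> H" "f \<in> space ?P" for f
      using E(2) that by blast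
    have law_K: "emeasure (distr (completion K) ?L (\<lambda>\<omega>. \<Psi> (y \<omega>))) A = emeasure (distr (completion K) ?P y) E"
      if y: "y \<in> completion K \<rightarrow>\<^sub>M ?P" and \<Psi>y: "(\<lambda>\<omega>. \<Psi> (y \<omega>)) \<in> completion K \<rightarrow>\<^sub>M ?L" and ae: "AE \<omega> in K. y \<omega> \<in> H"
      for y and K :: "'k measure"
    proof -
      have "AE \<omega> in completion K. \<omega> \<in> (\<lambda>\<omega>. \<Psi> (y \<omega>)) -` A \<inter> space (completion K) \<longleftrightarrow> \<omega> \<in> y -` E \<inter> space (completion K)"
        using AE_completion[OF ae] AE_space
      proof eventually_elim
        case (elim \<omega>)
        then show ?case using mem[of "y \<omega>"] measurable_space[OF y] by auto
      qed
      then show ?thesis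
        unfolding emeasure_distr[OF \<Psi>y A] emeasure_distr[OF y E(1)]
        by (rule emeasure_eq_AE[OF _ measurable_sets[OF \<Psi>y A] measurable_sets[OF y E(1)]])
    qed
    show "emeasure (distr (completion N) ?L (\<lambda>\<omega>. \<Psi> (\<lambda>t\<in>T. Y t \<omega>))) A =
        emeasure (distr (completion M) ?L (\<lambda>\<omega>. \<Psi> (\<lambda>t\<in>T. X t \<omega>))) A"
      by (simp only: law_K[OF y my Y] law_K[OF x mx X] eq)
  qed simp
  then show ?thesis
    using paths[OF y Y] paths[OF x X] by (auto simp: equal_in_law_def process_law_def \<Psi>_def)
qed

section \<open>Counting zeros\<close>

text \<open>Cardinality as a counting measure, so that additivity in B and continuity along
  increasing sets are measure properties.\<close>

definition zero_count :: "complex set \<Rightarrow> (complex \<Rightarrow> complex) \<Rightarrow> complex set \<Rightarrow> ennreal"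
  where "zero_count D f B = emeasure (count_space UNIV) {z \<in> D. z \<in> B \<and> f z = 0}"

lemma infsum_dirac: "(\<Sum>\<^sub>\<infinity>z\<in>S. dirac z B) = emeasure (count_space UNIV) (S \<inter> B)"
proof -
  have "(\<Sum>\<^sub>\<infinity>z\<in>S. dirac z B) = (\<Sum>\<^sub>\<infinity>z\<in>S \<inter> B. 1)"
    by (rule infsum_cong_neutral) (auto simp: dirac_def indicator_def)
  also have "\<dots> = emeasure (count_space UNIV) (S \<inter> B)"
  proof (cases "finite (S \<inter> B)")
    case False
    then show ?thesis using infsum_superconst_infinite_ennreal[of "S \<inter> B" 1 "\<lambda>_. 1"] by simp
  qed (simp add: infsum_finite)
  finally show ?thesis .
qed

lemma zero_process_eq: "zero_process D Y B \<omega> = zero_count D (\<lambda>z. Y z \<omega>) B"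
  by (auto simp: zero_process_def infsum_dirac zero_count_def intro!: arg_cong[of _ _ "emeasure _"])

text \<open>The zero function is excluded because a compact set may contain infinitely many of its
  zeros.\<close>

definition holomorphic_nonzero :: "complex set \<Rightarrow> (complex \<Rightarrow> complex) set"
  where "holomorphic_nonzero D = {f. f holomorphic_on D \<and> (\<exists>z\<in>D. f z \<noteq> 0)}"

lemma finite_zeros_compact:
  assumes "open D" "connected D" "f \<in> holomorphic_nonzero D" "compact K" "K \<subseteq> D"
  shows "finite {z \<in> K. f z = 0}"
proof (rule ccontr)
  assume inf: "infinite {z \<in> K. f z = 0}"
  then obtain x where "x \<in> K" "x islimpt {z \<in> K. f z = 0}"
    using assms(4)[unfolded compact_eq_Bolzano_Weierstrass, THEN spec, of "{z \<in> K. f z = 0}"] by auto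
  have f: "f holomorphic_on D" using assms(3) by (simp add: holomorphic_nonzero_def)
  have "f w = 0" if "w \<in> D" for w
    by (rule analytic_continuation[OF f assms(1,2) _ _ \<open>x islimpt _\<close> _ that])
      (use assms(5) \<open>x \<in> K\<close> in auto)
  then show False using assms(3) by (auto simp: holomorphic_nonzero_def)
qed

text \<open>The modulus of f attains its minimum on K, and points of T approximate it. For countable
  T the existence of a zero thus becomes an event about countably many values, which the product
  sigma-algebra can see.\<close>

lemma compact_zero_iff:
  fixes f :: "complex \<Rightarrow> complex"
  assumes "compact K" "continuous_on K f" "T \<subseteq> K" "K \<subseteq> closure T"
  shows "(\<exists>z\<in>K. f z = 0) \<longleftrightarrow> (\<forall>n::nat. \<exists>x\<in>T. cmod (f x) < 1 / (1 + real n))"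
proof safe
  fix z n assume z: "z \<in> K" "f z = 0"
  obtain d where d: "d > 0" "\<And>x. x \<in> K \<Longrightarrow> dist x z < d \<Longrightarrow> dist (f x) (f z) < 1 / (1 + real n)"
    using assms(2) z unfolding continuous_on_iff by (metis of_nat_0_le_iff add_pos_nonneg zero_less_divide_1_iff zero_less_one)
  obtain x where "x \<in> T" "dist x z < d"
    using assms(4) z d(1) by (meson closure_approachable subsetD)
  then show "\<exists>x\<in>T. cmod (f x) < 1 / (1 + real n)" using d(2)[of x] assms(3) z by auto
next
  assume small: "\<forall>n::nat. \<exists>x\<in>T. cmod (f x) < 1 / (1 + real n)"
  then have "K \<noteq> {}" using assms(3) by blast
  moreover have "continuous_on K (\<lambda>x. cmod (f x))" using assms(2) by (rule continuous_on_norm)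
  ultimately obtain z where z: "z \<in> K" "\<And>x. x \<in> K \<Longrightarrow> cmod (f z) \<le> cmod (f x)"
    using continuous_attains_inf[OF assms(1)] by blast
  have "cmod (f z) \<le> 0"
  proof (rule ccontr)
    assume "\<not> cmod (f z) \<le> 0"
    then obtain n :: nat where "1 / (1 + real n) < cmod (f z)"
      by (metis nat_approx_posE not_le of_nat_Suc add.commute)
    then show False using small z(2) assms(3) by (meson less_trans not_less subsetD)
  qed
  then show "\<exists>z\<in>K. f z = 0" using z(1) by auto
qed

abbreviation path_space :: "complex set \<Rightarrow> (complex \<Rightarrow> complex) measure"
  where "path_space D \<equiv> restrict_space (Pi\<^sub>M D (\<lambda>_. borel)) (holomorphic_nonzero D)"

lemma measurable_eval_path_space: "z \<in> D \<Longrightarrow> (\<lambda>f. f z) \<in> borel_measurable (path_space D)"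
  by (intro measurable_restrict_space1 measurable_component_singleton)

lemma space_path_space: "f \<in> space (path_space D) \<Longrightarrow> f \<in> holomorphic_nonzero D"
  by (simp add: space_restrict_space)

lemma measurable_zero_in_compact:
  assumes "compact K" "K \<subseteq> D"
  shows "Measurable.pred (path_space D) (\<lambda>f. \<exists>z\<in>K. f z = 0)"
proof -
  obtain T where T: "countable T" "T \<subseteq> K" "K \<subseteq> closure T" using separable by blast
  have [measurable]: "(\<lambda>f. f x) \<in> borel_measurable (path_space D)" if "x \<in> T" for x
    using that T assms by (intro measurable_eval_path_space) auto
  have "Measurable.pred (path_space D) (\<lambda>f. \<forall>n::nat. \<exists>x\<in>T. cmod (f x) < 1 / (1 + real n))"
    using T(1) by (intro pred_intros_countable pred_intros_countable_bounded) measurable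
  moreover have "(\<exists>z\<in>K. f z = 0) \<longleftrightarrow> (\<forall>n::nat. \<exists>x\<in>T. cmod (f x) < 1 / (1 + real n))" if "f \<in> space (path_space D)" for f
    using space_path_space[OF that] assms T
    by (intro compact_zero_iff) (auto simp: holomorphic_nonzero_def intro: continuous_on_subset holomorphic_on_imp_continuous_on)
  ultimately show ?thesis by (subst measurable_cong) auto
qed

lemma separating_balls:
  fixes S :: "'a::metric_space set"
  assumes "finite S" and dense: "\<And>x e. e > 0 \<Longrightarrow> \<exists>y\<in>Q. dist y x < e"
  obtains P where "finite P" "disjoint P" "P \<subseteq> (\<lambda>(y, n::nat). cball y (1 / (1 + real n))) ` (Q \<times> UNIV)"
    "card P = card S" "\<And>b. b \<in> P \<Longrightarrow> S \<inter> b \<noteq> {}"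
proof -
  \<comment> \<open>The inserted 1 keeps the minimum meaningful when S has at most one
    point.\<close>
  define \<delta> where "\<delta> = Min (insert 1 ((\<lambda>(x, y). dist x y) ` {(x, y) \<in> S \<times> S. x \<noteq> y}))"
  have fin: "finite {(x, y) \<in> S \<times> S. x \<noteq> y}"
    using assms(1) by (auto intro: finite_subset[of _ "S \<times> S"])
  have "\<delta> > 0" unfolding \<delta>_def using fin by (subst Min_gr_iff) auto
  have \<delta>: "\<delta> \<le> dist x y" if "x \<in> S" "y \<in> S" "x \<noteq> y" for x y
    unfolding \<delta>_def using fin that by (intro Min_le) auto
  \<comment> \<open>If the balls around the centers chosen for x and y meet, the path from x over
    the two centers to y costs at most four radii; hence the quarter of \<delta>.\<close>
  obtain n :: nat where n: "1 / (1 + real n) < \<delta> / 4"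
    using \<open>\<delta> > 0\<close> nat_approx_posE[of "\<delta> / 4"] by (metis add.commute of_nat_Suc zero_less_divide_iff zero_less_numeral)
  let ?e = "1 / (1 + real n)"
  obtain c where c: "\<And>x. c x \<in> Q" "\<And>x. dist (c x) x < ?e"
    using dense[of ?e] by (metis add_pos_nonneg of_nat_0_le_iff zero_less_divide_1_iff zero_less_one)
  define b where "b x = cball (c x) ?e" for x
  have self: "x \<in> b x" for x using c(2)[of x] by (simp add: b_def)
  have disj: "b x \<inter> b y = {}" if "x \<in> S" "y \<in> S" "x \<noteq> y" for x y
  proof (rule ccontr)
    assume "b x \<inter> b y \<noteq> {}"
    then obtain w where "dist (c x) w \<le> ?e" "dist (c y) w \<le> ?e" by (auto simp: b_def)
    moreover have "dist x y \<le> dist (c x) x + dist (c x) w + dist (c y) w + dist (c y) y"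
      by (smt (verit) dist_commute dist_triangle)
    ultimately have "dist x y < \<delta>" using c(2)[of x] c(2)[of y] n by linarith
    then show False using \<delta>[OF that] by linarith
  qed
  show thesis
  proof (rule that[of "b ` S"])
    show "disjoint (b ` S)" unfolding disjoint_def using disj by (metis (no_types, lifting) imageE)
    have "inj_on b S" using self disj by (metis disjoint_iff inj_onI)
    then show "card (b ` S) = card S" by (rule card_image)
    show "b ` S \<subseteq> (\<lambda>(y, n::nat). cball y (1 / (1 + real n))) ` (Q \<times> UNIV)"
      using c(1) by (auto simp: b_def)
    show "S \<inter> B \<noteq> {}" if "B \<in> b ` S" for B using that self by blast
  qed (use assms in auto)
qed

lemma sum_disjoint_hits_le_card:
  assumes "finite S" "finite P" "disjoint P"
  shows "(\<Sum>b\<in>P. of_bool (S \<inter> b \<noteq> {})) \<le> card S"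
proof -
  have "(\<Sum>b\<in>P. of_bool (S \<inter> b \<noteq> {})) \<le> (\<Sum>b\<in>P. card (S \<inter> b))"
    using assms(1) by (intro sum_mono) (auto simp: Suc_le_eq card_gt_0_iff)
  also have "\<dots> = card (\<Union>b\<in>P. S \<inter> b)"
    using assms by (intro card_UN_disjoint[symmetric]) (auto simp: disjoint_def)
  also have "\<dots> \<le> card S" using assms(1) by (intro card_mono) auto
  finally show ?thesis .
qed

text \<open>The number of zeros in a compact set is the largest number of disjoint balls from a countable
  family that meet the zero set.\<close>

lemma measurable_zero_count_compact:
  assumes D: "open D" "connected D" and K: "compact K" "K \<subseteq> D"
  shows "(\<lambda>f. zero_count D f K) \<in> borel_measurable (path_space D)"
proof -
  obtain Q :: "complex set" where Q: "countable Q" "\<And>X. open X \<Longrightarrow> X \<noteq> {} \<Longrightarrow> \<exists>d\<in>Q. d \<in> X"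
    using countable_dense_setE by blast
  have dense: "\<exists>y\<in>Q. dist y x < e" if "e > 0" for x e
    using Q(2)[of "ball x e"] that by (auto simp: dist_commute)
  define \<B> where "\<B> = (\<lambda>(y, n::nat). cball y (1 / (1 + real n))) ` (Q \<times> UNIV)"
  have "countable \<B>" unfolding \<B>_def using Q(1) by simp
  have compact_\<B>: "compact b" if "b \<in> \<B>" for b using that by (auto simp: \<B>_def)
  define \<P> where "\<P> = {P. finite P \<and> P \<subseteq> \<B> \<and> disjoint P}"
  have "countable \<P>"
    by (rule countable_subset[OF _ countable_Collect_finite_subset[OF \<open>countable \<B>\<close>]]) (auto simp: \<P>_def)
  define h where "h P f = (\<Sum>b\<in>P. if \<exists>z\<in>K \<inter> b. f z = 0 then 1 else 0 :: ennreal)" for P and f :: "complex \<Rightarrow> complex"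
  have [measurable]: "h P \<in> borel_measurable (path_space D)" if "P \<in> \<P>" for P
    unfolding h_def
  proof (rule borel_measurable_sum)
    fix b assume "b \<in> P"
    then have "Measurable.pred (path_space D) (\<lambda>f. \<exists>z\<in>K \<inter> b. f z = 0)"
      using that K compact_\<B> by (intro measurable_zero_in_compact compact_Int) (auto simp: \<P>_def)
    then show "(\<lambda>f. if \<exists>z\<in>K \<inter> b. f z = 0 then 1 else 0 :: ennreal) \<in> borel_measurable (path_space D)"
      by measurable
  qed
  have "(\<lambda>f. SUP P\<in>\<P>. h P f) \<in> borel_measurable (path_space D)"
    using \<open>countable \<P>\<close> by (rule borel_measurable_SUP) measurable
  moreover have "zero_count D f K = (SUP P\<in>\<P>. h P f)" if "f \<in> space (path_space D)" for f
  proof -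
    define S where "S = {z \<in> K. f z = 0}"
    have fin: "finite S"
      unfolding S_def by (rule finite_zeros_compact[OF D space_path_space[OF that] K])
    have count: "zero_count D f K = of_nat (card S)"
    proof -
      have "{z \<in> D. z \<in> K \<and> f z = 0} = S" using K by (auto simp: S_def)
      then show ?thesis using fin by (simp add: zero_count_def)
    qed
    have h: "h P f = of_nat (\<Sum>b\<in>P. of_bool (S \<inter> b \<noteq> {}))" for P
      unfolding h_def of_nat_sum by (intro sum.cong refl) (auto simp: S_def)
    show ?thesis
    proof (rule antisym)
      obtain P where P: "finite P" "disjoint P" "P \<subseteq> \<B>" "card P = card S" "\<And>b. b \<in> P \<Longrightarrow> S \<inter> b \<noteq> {}"
        using separating_balls[OF fin dense] unfolding \<B>_def by blast
      have "h P f = of_nat (card S)" unfolding h using P by simp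
      then show "zero_count D f K \<le> (SUP P\<in>\<P>. h P f)"
        unfolding count using P by (intro SUP_upper2[of P]) (auto simp: \<P>_def)
      show "(SUP P\<in>\<P>. h P f) \<le> zero_count D f K"
        unfolding count h using fin by (intro SUP_least of_nat_mono sum_disjoint_hits_le_card) (auto simp: \<P>_def)
    qed
  qed
  ultimately show ?thesis by (subst measurable_cong) auto
qed

text \<open>Intersecting with a compact set makes all counts finite, so that the complement step can
  subtract in ennreal.\<close>

lemma measurable_zero_count_Int_compact:
  assumes D: "open D" "connected D" and K: "compact K" "K \<subseteq> D" and "B \<in> sets borel"
  shows "(\<lambda>f. zero_count D f (B \<inter> K)) \<in> borel_measurable (path_space D)"
proof -
  have "Int_stable {S :: complex set. closed S}" "{S :: complex set. closed S} \<subseteq> Pow UNIV"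
    "B \<in> sigma_sets UNIV {S. closed S}"
    using assms(5) by (auto simp: Int_stable_def borel_eq_closed)
  then show ?thesis
  proof (induction rule: sigma_sets_induct_disjoint)
    case (basic B)
    then show ?case using K by (intro measurable_zero_count_compact D) (auto intro: closed_Int_compact)
  next
    case empty
    then show ?case by (simp add: zero_count_def)
  next
    case (compl B)
    have "(\<lambda>f. zero_count D f K - zero_count D f (B \<inter> K)) \<in> borel_measurable (path_space D)"
      using measurable_zero_count_compact[OF D K] compl by (intro borel_measurable_minus_ennreal)
    moreover have "zero_count D f ((UNIV - B) \<inter> K) = zero_count D f K - zero_count D f (B \<inter> K)"
      if "f \<in> space (path_space D)" for f
    proof -
      have "finite {z \<in> K. f z = 0}" by (rule finite_zeros_compact[OF D space_path_space[OF that] K])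
      then have fin: "finite {z \<in> D. z \<in> B \<inter> K \<and> f z = 0}" by (rule finite_subset[rotated]) auto
      have "{z \<in> D. z \<in> (UNIV - B) \<inter> K \<and> f z = 0} = {z \<in> D. z \<in> K \<and> f z = 0} - {z \<in> D. z \<in> B \<inter> K \<and> f z = 0}" by auto
      then show ?thesis unfolding zero_count_def using fin by (simp only:) (intro emeasure_Diff; auto)
    qed
    ultimately show ?case by (subst measurable_cong) auto
  next
    case (union A)
    have "(\<lambda>f. \<Sum>i. zero_count D f (A i \<inter> K)) \<in> borel_measurable (path_space D)"
      using union by (intro borel_measurable_suminf_order) auto
    moreover have "zero_count D f ((\<Union>i. A i) \<inter> K) = (\<Sum>i. zero_count D f (A i \<inter> K))" for f
    proof -
      have "disjoint_family (\<lambda>i. {z \<in> D. z \<in> A i \<inter> K \<and> f z = 0})"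
        using union(1) by (auto simp: disjoint_family_on_def)
      moreover have "{z \<in> D. z \<in> (\<Union>i. A i) \<inter> K \<and> f z = 0} = (\<Union>i. {z \<in> D. z \<in> A i \<inter> K \<and> f z = 0})" by auto
      ultimately show ?thesis
        unfolding zero_count_def by (simp only:) (intro suminf_emeasure[symmetric]; auto)
    qed
    ultimately show ?case by simp
  qed
qed

text \<open>A Borel subset of D may contain infinitely many zeros; a compact exhaustion of D reduces
  it to the finite case by monotone limits.\<close>

lemma measurable_zero_count:
  assumes D: "open D" "connected D" and B: "B \<in> sets borel" "B \<subseteq> D"
  shows "(\<lambda>f. zero_count D f B) \<in> borel_measurable (path_space D)"
proof -
  obtain C where C: "\<And>n. compact (C n)" "\<And>n. C n \<subseteq> D" "\<And>n. C n \<subseteq> interior (C (Suc n))" "\<Union> (range C) = D"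
    using open_Union_compact_subsets[OF D(1)] by metis
  have inc: "incseq C" using C(3) interior_subset by (intro incseq_SucI) blast
  have "(\<lambda>f. SUP n. zero_count D f (B \<inter> C n)) \<in> borel_measurable (path_space D)"
    using measurable_zero_count_Int_compact[OF D C(1,2) B(1)] by (intro borel_measurable_SUP) auto
  moreover have "zero_count D f B = (SUP n. zero_count D f (B \<inter> C n))" for f
  proof -
    have "incseq (\<lambda>n. {z \<in> D. z \<in> B \<inter> C n \<and> f z = 0})" using inc by (fastforce simp: incseq_def)
    moreover have "{z \<in> D. z \<in> B \<and> f z = 0} = (\<Union>n. {z \<in> D. z \<in> B \<inter> C n \<and> f z = 0})" using C(4) by blast
    ultimately show ?thesis
      unfolding zero_count_def by (simp only:) (intro SUP_emeasure_incseq[symmetric]; auto)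
  qed
  ultimately show ?thesis by simp
qed

lemma equal_in_law_zero_process:
  assumes D: "open D" "connected D" and law: "equal_in_law D N Y M X"
    and Y: "AE \<omega> in N. (\<lambda>z. Y z \<omega>) \<in> holomorphic_nonzero D"
    and X: "AE \<omega> in M. (\<lambda>z. X z \<omega>) \<in> holomorphic_nonzero D"
  shows "equal_in_law (borel_subsets D) N (zero_process D Y) M (zero_process D X)"
proof -
  have restrict: "(\<lambda>z\<in>D. f z) \<in> holomorphic_nonzero D \<longleftrightarrow> f \<in> holomorphic_nonzero D" for f
    unfolding holomorphic_nonzero_def by (auto cong: holomorphic_cong)
  have count: "zero_count D (\<lambda>z\<in>D. f z) B = zero_count D f B" for f B
    by (auto simp: zero_count_def intro!: arg_cong[of _ _ "emeasure _"])
  have "equal_in_law (borel_subsets D) N (\<lambda>B \<omega>. zero_count D (\<lambda>z\<in>D. Y z \<omega>) B) M (\<lambda>B \<omega>. zero_count D (\<lambda>z\<in>D. X z \<omega>) B)"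
    by (rule equal_in_law_functional[OF law, of "holomorphic_nonzero D" "borel_subsets D" "\<lambda>B f. zero_count D f B"])
      (use Y X measurable_zero_count[OF D] in \<open>auto simp: restrict borel_subsets_def\<close>)
  then show ?thesis unfolding count zero_process_eq[abs_def] .
qed

section \<open>The conditioned process and its zeros\<close>

text \<open>Nonzero variance makes the value a nondegenerate Gaussian, whose law has a density and
  therefore no atom at 0.\<close>

lemma process_nonzero:
  assumes Y: "centered_complex_gaussian_process M T k Y" and t: "t \<in> T" "k t t \<noteq> 0"
  shows "AE \<omega> in M. Y t \<omega> \<noteq> 0"
proof (rule centered_complex_gaussian_nonzero[OF process_gaussian_single[OF Y t(1)]])
  show "(\<integral>\<omega>. (cmod (Y t \<omega>))\<^sup>2 \<partial>M) \<noteq> 0"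
    using process_second_moment[OF Y, of "{t}" "\<lambda>_. 1"] t by (auto simp: quadratic_form_def)
qed

lemma open_annulus: "open (annulus q)" and connected_annulus_complex: "connected (annulus q)"
proof -
  have "annulus q = norm -` {q<..<1}" by (auto simp: annulus_def)
  then show "open (annulus q)" by (simp add: open_vimage continuous_on_norm_id)
  show "connected (annulus q)"
    using connected_annulus(1)[of q "0 :: complex" 1] by (simp add: annulus_def)
qed

lemma infinite_annulus:
  assumes "0 < q" "q < 1" shows "infinite (annulus q)"
proof
  assume "finite (annulus q)"
  moreover have "complex_of_real ((q + 1) / 2) \<in> annulus q"
    using assms by (simp add: annulus_def norm_divide del: of_real_add of_real_divide)
  ultimately show False using finite_imp_not_open open_annulus by blast
qed

lemma holomorphic_gamma_fun:
  assumes q: "0 < q" "q < 1" and "\<forall>l\<in>{1..n}. \<alpha> l \<in> annulus q"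
  shows "gamma_fun q \<alpha> n holomorphic_on annulus q"
proof -
  have nz: "z \<noteq> 0" if "z \<in> annulus q" for z using that q by (auto simp: annulus_def)
  have theta: "theta q (cnj a * z) \<noteq> 0" if "a \<in> annulus q" "z \<in> annulus q" for a z
  proof (rule theta_nonzero[OF q])
    show n: "q\<^sup>2 < cmod (cnj a * z)" using annulus_mult(1)[OF that(2,1) q(1)] by (simp add: mult.commute)
    have "cmod (cnj a * z) < 1" using annulus_mult(2)[OF that(2,1) q(1)] by (simp add: mult.commute)
    moreover from this show "cnj a * z \<noteq> 1" by auto
    ultimately show "q\<^sup>2 * cmod (cnj a * z) < 1" using square_less_1[OF q] mult_left_le_one_le[of "cmod (cnj a * z)" "q\<^sup>2"]
      by (simp del: norm_mult)
  qed
  have "h_fun q a holomorphic_on annulus q" if a: "a \<in> annulus q" for a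
    unfolding h_fun_def
  proof (intro holomorphic_on_divide holomorphic_on_mult holomorphic_on_ident holomorphic_on_const
      holomorphic_theta[OF q])
  qed (simp_all add: nz[OF a] nz theta[OF a])
  then show ?thesis
    unfolding gamma_fun_def[abs_def] using assms(3) by (intro holomorphic_on_prod) blast
qed

text \<open>Zeros are counted once, so the two counts add because f does not vanish at the \<alpha>
  i. Injectivity then turns the count of points into a sum over indices.\<close>

lemma zero_count_mult:
  assumes \<alpha>: "inj_on \<alpha> I" "finite I" "\<alpha> ` I \<subseteq> D" and B: "B \<subseteq> D"
    and g: "\<And>z. z \<in> D \<Longrightarrow> g z = 0 \<longleftrightarrow> z \<in> \<alpha> ` I" and f: "\<And>i. i \<in> I \<Longrightarrow> f (\<alpha> i) \<noteq> 0"
  shows "zero_count D (\<lambda>z. g z * f z) B = zero_count D f B + (\<Sum>i\<in>I. dirac (\<alpha> i) B)"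
proof -
  have "{z \<in> D. z \<in> B \<and> g z * f z = 0} = {z \<in> D. z \<in> B \<and> f z = 0} \<union> (\<alpha> ` I \<inter> B)"
    using g B by auto
  moreover have "{z \<in> D. z \<in> B \<and> f z = 0} \<inter> (\<alpha> ` I \<inter> B) = {}" using f by auto
  ultimately have "zero_count D (\<lambda>z. g z * f z) B = zero_count D f B + emeasure (count_space UNIV) (\<alpha> ` I \<inter> B)"
    unfolding zero_count_def by (simp only:) (intro plus_emeasure[symmetric]; auto)
  also have "emeasure (count_space UNIV) (\<alpha> ` I \<inter> B) = (\<Sum>a\<in>\<alpha> ` I \<inter> B. 1)"
    using \<alpha>(2) by simp
  also have "\<dots> = (\<Sum>a\<in>\<alpha> ` I. dirac a B)"
    using \<alpha>(2) by (intro sum.mono_neutral_cong_left) (auto simp: dirac_def)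
  also have "\<dots> = (\<Sum>i\<in>I. dirac (\<alpha> i) B)" using \<alpha>(1) by (simp add: sum.reindex)
  finally show ?thesis .
qed

theorem proposition1p2:
  fixes q r :: real and n :: nat and \<alpha> :: "nat \<Rightarrow> complex"
    and M :: "'a measure" and \<zeta> :: "int \<Rightarrow> 'a \<Rightarrow> complex"
  assumes "0 < q" and "q < 1" and "0 < r"
    and "\<forall>l\<in>{1..n}. \<alpha> l \<in> annulus q" and "inj_on \<alpha> {1..n}"
    and "iid_std_complex_gaussian M \<zeta>"
  shows
    "(\<exists>Y. gaussian_analytic_function M (annulus q) (cond_kernels (szego_kernel q r) \<alpha> n) Y) \<and>
     (\<forall>(N :: 'b measure) Y.
        centered_complex_gaussian_process N (annulus q) (cond_kernels (szego_kernel q r) \<alpha> n) Y \<longrightarrow>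
        equal_in_law (annulus q) N Y
          M (\<lambda>z \<omega>. gamma_fun q \<alpha> n z * gaf_annulus q \<zeta> (r * (\<Prod>l=1..n. (cmod (\<alpha> l))\<^sup>2)) z \<omega>)) \<and>
     (\<forall>(N :: 'b measure) Y.
        gaussian_analytic_function N (annulus q) (cond_kernels (szego_kernel q r) \<alpha> n) Y \<longrightarrow>
        equal_in_law (borel_subsets (annulus q)) N (zero_process (annulus q) Y)
          M (\<lambda>B \<omega>. zero_process (annulus q) (gaf_annulus q \<zeta> (r * (\<Prod>l=1..n. (cmod (\<alpha> l))\<^sup>2))) B \<omega>
                   + (\<Sum>i=1..n. dirac (\<alpha> i) B)))"
proof -
  note q = \<open>0 < q\<close> \<open>q < 1\<close> and \<alpha> = \<open>\<forall>l\<in>{1..n}. \<alpha> l \<in> annulus q\<close> \<open>inj_on \<alpha> {1..n}\<close>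
    and iid = \<open>iid_std_complex_gaussian M \<zeta>\<close>
  let ?D = "annulus q" and ?k = "cond_kernels (szego_kernel q r) \<alpha> n"
  define s where "s = r * (\<Prod>l=1..n. (cmod (\<alpha> l))\<^sup>2)"
  define g where "g = gamma_fun q \<alpha> n"
  \<comment> \<open>A realization of the conditioned process on M itself: it settles existence, and
    every other realization Y is compared with it. The measurable version is taken because a
    Gaussian process has to be measurable in M, not just in its completion.\<close>
  define X where "X z \<omega> = g z * gaf_version q \<zeta> s z \<omega>" for z \<omega>
  have "0 \<notin> ?D" using q by (auto simp: annulus_def)
  then have s: "0 < s" unfolding s_def using \<open>0 < r\<close> \<alpha> by (intro mult_pos_pos prod_pos) fastforce+
  have k: "?k z w = g z * cnj (g w) * szego_kernel q s z w" if "z \<in> ?D" "w \<in> ?D" for z w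
    unfolding g_def s_def using cond_kernels_szego[OF q \<open>0 < r\<close> \<alpha> that] .
  have g_zero: "g z = 0 \<longleftrightarrow> z \<in> \<alpha> ` {1..n}" if "z \<in> ?D" for z
    unfolding g_def by (rule gamma_fun_eq_0_iff[OF q \<alpha>(1) that])
  have szego_diag: "szego_kernel q s z z \<noteq> 0" if "z \<in> ?D" for z
    using szego_sum_diag[OF q s that] by (auto simp: szego_kernel_eq)
  have X: "centered_complex_gaussian_process M ?D ?k X"
    unfolding X_def[abs_def] by (rule gaf_version_process[OF iid q s k])
  have X_holo: "AE \<omega> in M. (\<lambda>z. X z \<omega>) holomorphic_on ?D"
    using AE_tempered[OF iid]
  proof eventually_elim
    case (elim \<omega>)
    then show ?case
      unfolding X_def g_def gaf_version_def using holomorphic_gaf[OF q(1) s elim]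
      by (simp add: holomorphic_on_mult holomorphic_gamma_fun[OF q \<alpha>(1)])
  qed
  \<comment> \<open>At such a point the conditioned kernel has a nonzero diagonal value, so almost
    no path is identically zero.\<close>
  obtain z0 where z0: "z0 \<in> ?D" "z0 \<notin> \<alpha> ` {1..n}"
    using infinite_annulus[OF q] by (meson finite_imageI finite_atLeastAtMost finite_subset subsetI)
  have path: "AE \<omega> in K. (\<lambda>z. Y z \<omega>) \<in> holomorphic_nonzero ?D"
    if Y: "centered_complex_gaussian_process K ?D ?k Y" and "AE \<omega> in K. (\<lambda>z. Y z \<omega>) holomorphic_on ?D"
    for K :: "'k measure" and Y
  proof -
    have "AE \<omega> in K. Y z0 \<omega> \<noteq> 0"
      using z0 by (intro process_nonzero[OF Y]) (simp_all add: k g_zero szego_diag)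
    with that(2) show ?thesis by eventually_elim (use z0 in \<open>auto simp: holomorphic_nonzero_def\<close>)
  qed
  have gaf_nonzero: "AE \<omega> in M. \<forall>i\<in>{1..n}. gaf_version q \<zeta> s (\<alpha> i) \<omega> \<noteq> 0"
  proof (intro AE_finite_allI)
    fix i assume "i \<in> {1..n}"
    have "centered_complex_gaussian_process M ?D (szego_kernel q s) (\<lambda>z \<omega>. 1 * gaf_version q \<zeta> s z \<omega>)"
      by (rule gaf_version_process[OF iid q s]) simp
    then show "AE \<omega> in M. gaf_version q \<zeta> s (\<alpha> i) \<omega> \<noteq> 0"
      using process_nonzero[of M ?D "szego_kernel q s" "\<lambda>z \<omega>. 1 * gaf_version q \<zeta> s z \<omega>" "\<alpha> i"]
        \<alpha>(1) \<open>i \<in> {1..n}\<close> szego_diag[of "\<alpha> i"] by simp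
  qed simp
  have "\<exists>Y. gaussian_analytic_function M ?D ?k Y"
    using X X_holo by (auto simp: gaussian_analytic_function_def)
  moreover have "equal_in_law ?D N Y M (\<lambda>z \<omega>. g z * gaf_annulus q \<zeta> s z \<omega>)"
    if Y: "centered_complex_gaussian_process N ?D ?k Y" for N :: "'b measure" and Y
  proof (rule equal_in_law_AE[OF equal_in_law_gaussian[OF X Y]])
    show "AE \<omega> in M. \<forall>z\<in>?D. g z * gaf_annulus q \<zeta> s z \<omega> = X z \<omega>"
      using AE_tempered[OF iid] by eventually_elim (simp add: X_def gaf_version_def)
  qed
  moreover have "equal_in_law (borel_subsets ?D) N (zero_process ?D Y)
      M (\<lambda>B \<omega>. zero_process ?D (gaf_annulus q \<zeta> s) B \<omega> + (\<Sum>i=1..n. dirac (\<alpha> i) B))"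
    if Y: "gaussian_analytic_function N ?D ?k Y" for N :: "'b measure" and Y
  proof (rule equal_in_law_AE[OF equal_in_law_zero_process[OF open_annulus connected_annulus_complex equal_in_law_gaussian[OF X]]])
    show "centered_complex_gaussian_process N ?D ?k Y" "AE \<omega> in N. (\<lambda>z. Y z \<omega>) \<in> holomorphic_nonzero ?D"
      using Y path[of N Y] unfolding gaussian_analytic_function_def by blast+
    show "AE \<omega> in M. (\<lambda>z. X z \<omega>) \<in> holomorphic_nonzero ?D" by (rule path[OF X X_holo])
    show "AE \<omega> in M. \<forall>B\<in>borel_subsets ?D. zero_process ?D (gaf_annulus q \<zeta> s) B \<omega> + (\<Sum>i=1..n. dirac (\<alpha> i) B) =
        zero_process ?D X B \<omega>"
      using AE_tempered[OF iid] gaf_nonzero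
    proof eventually_elim
      case (elim \<omega>)
      have gaf: "gaf_annulus q \<zeta> s z \<omega> = gaf_version q \<zeta> s z \<omega>" for z
        using elim(1) by (simp add: gaf_version_def)
      show ?case
      proof
        fix B assume "B \<in> borel_subsets ?D"
        then have "zero_count ?D (\<lambda>z. g z * gaf_version q \<zeta> s z \<omega>) B =
            zero_count ?D (\<lambda>z. gaf_version q \<zeta> s z \<omega>) B + (\<Sum>i=1..n. dirac (\<alpha> i) B)"
          using \<alpha> elim(2) g_zero by (intro zero_count_mult) (auto simp: borel_subsets_def)
        then show "zero_process ?D (gaf_annulus q \<zeta> s) B \<omega> + (\<Sum>i=1..n. dirac (\<alpha> i) B) =
            zero_process ?D X B \<omega>"
          by (simp only: zero_process_eq X_def gaf)
      qed
    qed
  qed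
  ultimately show ?thesis
    unfolding g_def s_def by (intro conjI allI impI)
qed

end
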